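(* Let $F=f+r$ on $\mathbb{E}=\mathbb{E}_1\times\cdots\times\mathbb{E}_s$, let $\{\tilde x^{(k)}\}$ be generated by IBP or IBPG with Bregman divergences $D_i$ as described in the context, and suppose Assumptions 1, 2, 3 and 4 of the context hold. Assume moreover that: - $F$ is a KL function; - $f$ is continuously differentiable and $\nabla f$ is Lipschitz continuous on bounded subsets of $\mathbb{E}$; - there exists a constant $W_2$ such that for all $k\in\mathbb{N}$, $m=1,\dots,d_i^k$ and $i=1,\dots,s$, $\theta_i^{(k,m)}\le W_2$ in the case of IBP, respectively $\lambda_i^{(k,m)}\le W_2$ in the case of IBPG, and $\delta>\frac{L_HW_2}{\sigma W_1}$, where $\sigma=\min\{\sigma_1,\dots,\sigma_s\}$ and $L_H=\max\{L_{H_1},\dots,L_{H_s}\}$. Then the whole sequence $\{\tilde x^{(k)}\}$ converges to a critical point type II of $F$.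
   Context: **Problem.** $\mathbb{E}=\mathbb{E}_1\times\cdots\times\mathbb{E}_s$, each $\mathbb{E}_i$ a finite-dimensional real space with inner product $\langle\cdot,\cdot\rangle$ and its associated norm $\|\cdot\|$; $\|x\|^2=\sum_i\|x_i\|^2$ on $\mathbb{E}$. $F(x)=f(x)+r(x)$, where $f:\mathbb{E}\to\mathbb{R}$ is continuous and $r(x)=\sum_{i=1}^s r_i(x_i)$ with $r_i:\mathbb{E}_i\to\mathbb{R}\cup\{+\infty\}$ proper and lower semicontinuous. **Bregman distance.** $H_i:\mathbb{E}_i\to\mathbb{R}$ is strictly convex and continuously differentiable, $D_i(u,v)=H_i(u)-H_i(v)-\langle\nabla H_i(v),u-v\rangle$. **Algorithm.** Choose $\tilde x^{(0)}=\tilde x^{(-1)}\in\mathbb{E}$ and choose a method, IBP (inertial block proximal) or IBPG (inertial block proximal gradient). For $k=1,2,\dots$: set $x^{(k,0)}=\tilde x^{(k-1)}$; for $j=1,\dots,T_k$, choose a block $i\in\{1,\dots,s\}$ (deterministically or randomly), let $y_i$ be the value of the $i$th block before it was updated to $x_i^{(k,j-1)}$ (initially $y_i=\tilde x_i^{(-1)}$), let $f_i^{(k,j)}(x_i)=f(x_1^{(k,j-1)},\dots,x_{i-1}^{(k,j-1)},x_i,x_{i+1}^{(k,j-1)},\dots,x_s^{(k,j-1)})$ and $F_i^{(k,j)}=f_i^{(k,j)}+r_i$, and set $\hat x_i=x_i^{(k,j-1)}+\alpha_i^{(k,j)}(x_i^{(k,j-1)}-y_i)$. - IBP: $x_i^{(k,j)}\in\operatorname{argmin}_{u\in\mathbb{E}_i}\{F_i^{(k,j)}(u)+\frac{1}{\beta_i^{(k,j)}}D_i(u,\hat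 x_i)\}$. - IBPG: set $\grave x_i=x_i^{(k,j-1)}+\gamma_i^{(k,j)}(x_i^{(k,j-1)}-y_i)$ and $x_i^{(k,j)}\in\operatorname{argmin}_{u\in\mathbb{E}_i}\{r_i(u)+\langle\nabla f_i^{(k,j)}(\grave x_i),u\rangle+\frac{1}{\beta_i^{(k,j)}}D_i(u,\hat x_i)\}$. The other blocks are unchanged: $x_{i'}^{(k,j)}=x_{i'}^{(k,j-1)}$ for $i'\neq i$. After the inner loop, $\tilde x^{(k)}=x^{(k,T_k)}$. **Notation.** $d_i^k$ is the number of times block $i$ is updated during the $k$th outer loop. $\bar x_i^{(k,m)}$, $m=1,\dots,d_i^k$, is the value of block $i$ after its $m$th update in the $k$th outer loop; $\bar x_i^{(k,0)}=\tilde x_i^{(k-1)}$. $\bar\alpha_i^{(k,m)},\bar\beta_i^{(k,m)},\bar\gamma_i^{(k,m)}$ (and $\bar L_i^{(k,m)}$ below) are the values of $\alpha_i^{(k,j)},\beta_i^{(k,j)},\gamma_i^{(k,j)}$ (and $L_i^{(k,j)}$) used when updating $\bar x_i^{(k,m-1)}$ to $\bar x_i^{(k,m)}$. The $\alpha$'s and $\gamma$'s are nonnegative, the $\beta$'s positive. **Assumption 1.** For every $k$, all blocks are updated within the $T_k$ iterations of the $k$th outer loop, and $s\le T_k\le\bar T$ for a constant $\bar T$. **Assumption 2.** (A1) $H_i$ is $\sigma_i$-strongly convex ($\sigma_i>0$) and continuously differentiable, and $\nabla H_i$ is $L_{H_i}$-Lipschitz continuous, $i=1,\dots,s$. (A2)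 The proximal maps (argmin sets) used in the updates are well-defined (nonempty). **Choice of parameters.** Fix $0<\nu<1$ and $\delta>1$. - IBP: with $\theta_i^{(k,m)}=\frac{(L_{H_i}\bar\alpha_i^{(k,m)})^2}{2\nu\sigma_i\bar\beta_i^{(k,m)}}$ for $1\le m\le d_i^k$ and $\theta_i^{(k,d_i^k+1)}=\theta_i^{(k+1,1)}$, the parameters satisfy $\frac{(1-\nu)\sigma_i}{2\bar\beta_i^{(k,m)}}\ge\delta\,\theta_i^{(k,m+1)}$ for $m=1,\dots,d_i^k$ and all $i,k$. - IBPG: $\nabla f_i^{(k,j)}$ is $L_i^{(k,j)}$-Lipschitz continuous, $L_i^{(k,j)}>0$; for a fixed $\kappa>1$, $\bar\beta_i^{(k,m)}=\frac{\sigma_i}{\kappa\bar L_i^{(k,m)}}$; with $\lambda_i^{(k,m)}=\frac12\Big(\bar\gamma_i^{(k,m)}+\frac{\kappa L_{H_i}\bar\alpha_i^{(k,m)}}{\sigma_i}\Big)^2\frac{\bar L_i^{(k,m)}}{\nu(\kappa-1)}$ for $1\le m\le d_i^k$ and $\lambda_i^{(k,d_i^k+1)}=\lambda_i^{(k+1,1)}$, the parameters satisfy $\frac{(1-\nu)(\kappa-1)\bar L_i^{(k,m)}}{2}\ge\delta\,\lambda_i^{(k,m+1)}$ for $m=1,\dots,d_i^k$ and all $i,k$. **Assumption 3.** For IBP there are positive numbers $W_1,\overline\alpha,\underline\beta$ with $\theta_i^{(k,m)}\ge W_1$, $\bar\alpha_i^{(k,m)}\le\overline\alpha$, $\underline\beta\le\bar\beta_i^{(k,m)}$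 for all $k$, $m=1,\dots,d_i^k$, $i=1,\dots,s$. For IBPG there are positive numbers $W_1,\overline L,\overline\alpha,\overline\gamma$ with $\lambda_i^{(k,m)}\ge W_1$, $\bar L_i^{(k,m)}\le\overline L$, $\bar\alpha_i^{(k,m)}\le\overline\alpha$, $\bar\gamma_i^{(k,m)}\le\overline\gamma$ for all such $k,m,i$. **Assumption 4.** The sequence $\{\tilde x^{(k)}\}_{k\in\mathbb{N}}$ is bounded. **Subdifferential, critical points, KL.** For a proper lower semicontinuous $g$ and $x\in\operatorname{dom}g$, the Fréchet subdifferential $\hat\partial g(x)$ is the set of $v$ with $\liminf_{y\ne x,y\to x}\frac{g(y)-g(x)-\langle v,y-x\rangle}{\|y-x\|}\ge0$ (empty if $x\notin\operatorname{dom}g$); the limiting subdifferential $\partial g(x)$ is the set of $v$ for which there exist $x^{(k)}\to x$, $g(x^{(k)})\to g(x)$, $v^{(k)}\in\hat\partial g(x^{(k)})$, $v^{(k)}\to v$. $x^*\in\operatorname{dom}F$ is a critical point type II of $F$ if $0\in\partial F(x^* )$. A function $\phi$ has the KL property at $\bar x\in\operatorname{dom}\partial\phi$ if there exist $\eta\in(0,+\infty]$, a neighborhood $U$ of $\bar x$ and a concave function $\xi:[0,\eta)\to\mathbb{R}_+$, continuously differentiable on $(0,\eta)$, continuous at $0$, with $\xi(0)=0$ and $\xi'>0$ on $(0,\eta)$, such that $\xi'(\phi(x)-\phi(\bar x))\operatorname{dist}(0,\partial\phi(x))\ge1$ for all $x\in U$ with $\phi(\bar x)<\phi(x)<\phi(\bar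 x)+\eta$, where $\operatorname{dist}(0,\partial\phi(x))=\min\{\|y\|:y\in\partial\phi(x)\}$ ($+\infty$ if empty). $\phi$ is a KL function if it has the KL property at each point of $\operatorname{dom}\partial\phi$. *)

theory Defs
  imports "HOL-Analysis.Analysis"
begin

text \<open>
  The spaces \<open>E\<^sub>1, \<dots>, E\<^sub>s\<close> may have different dimensions.  They are rendered as linear subspaces
  \<open>V i\<close> of one Euclidean space \<open>'b\<close>, where \<open>i\<close> ranges over the finite index type \<open>'s\<close>
  (so \<open>s = CARD('s)\<close>); up to isometry every finite family of finite-dimensional inner product
  spaces has this form.  The norm of \<open>'b ^ 's\<close> is the Euclidean one, so \<open>prod_space V\<close> is
  \<open>E\<^sub>1 \<times> \<dots> \<times> E\<^sub>s\<close> with its product norm.  All functions are total in HOL, but only their values on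
  \<open>V i\<close> (respectively \<open>prod_space V\<close>) matter; every notion below is therefore relative
  to a carrier \<open>S\<close>.
\<close>

definition prod_space :: "('s::finite \<Rightarrow> 'b::euclidean_space set) \<Rightarrow> ('b ^ 's) set" where
  "prod_space V = {x. \<forall>i. x $ i \<in> V i}"


section \<open>Functions on a linear subspace\<close>

text \<open>
  For a subspace \<open>S\<close> the requirement \<open>v \<in> S\<close> makes the gradient unique: a derivative within \<open>S\<close>
  is determined in the directions of \<open>S\<close> only.
\<close>

definition gradient_on :: "'a::euclidean_space set \<Rightarrow> ('a \<Rightarrow> real) \<Rightarrow> 'a \<Rightarrow> 'a" where
  "gradient_on S g x = (THE v. v \<in> S \<and> (g has_derivative (\<lambda>h. v \<bullet> h)) (at x within S))"

definition C1_on :: "'a::euclidean_space set \<Rightarrow> ('a \<Rightarrow> real) \<Rightarrow> bool" where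
  "C1_on S g \<longleftrightarrow> g differentiable_on S \<and> continuous_on S (gradient_on S g)"

definition strictly_convex_on :: "'a::real_vector set \<Rightarrow> ('a \<Rightarrow> real) \<Rightarrow> bool" where
  "strictly_convex_on S g \<longleftrightarrow> convex S \<and>
     (\<forall>x\<in>S. \<forall>y\<in>S. \<forall>t. x \<noteq> y \<longrightarrow> 0 < t \<longrightarrow> t < 1 \<longrightarrow>
        g ((1 - t) *\<^sub>R x + t *\<^sub>R y) < (1 - t) * g x + t * g y)"

definition strongly_convex_on :: "real \<Rightarrow> 'a::real_normed_vector set \<Rightarrow> ('a \<Rightarrow> real) \<Rightarrow> bool" where
  "strongly_convex_on \<mu> S g \<longleftrightarrow> convex S \<and>
     (\<forall>x\<in>S. \<forall>y\<in>S. \<forall>t. 0 \<le> t \<longrightarrow> t \<le> 1 \<longrightarrow>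
        g ((1 - t) *\<^sub>R x + t *\<^sub>R y)
          \<le> (1 - t) * g x + t * g y - \<mu> / 2 * t * (1 - t) * (norm (x - y))\<^sup>2)"

definition bregman_dist ::
  "'a::euclidean_space set \<Rightarrow> ('a \<Rightarrow> real) \<Rightarrow> 'a \<Rightarrow> 'a \<Rightarrow> real" where
  "bregman_dist S h u v = h u - h v - gradient_on S h v \<bullet> (u - v)"

definition edom :: "'a set \<Rightarrow> ('a \<Rightarrow> ereal) \<Rightarrow> 'a set" where
  "edom S g = {x \<in> S. g x < \<infinity>}"

definition proper_on :: "'a set \<Rightarrow> ('a \<Rightarrow> ereal) \<Rightarrow> bool" where
  "proper_on S g \<longleftrightarrow> (\<forall>x\<in>S. g x \<noteq> -\<infinity>) \<and> edom S g \<noteq> {}"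

text \<open>
  At an isolated point of \<open>S\<close> (which for a subspace means \<open>S = {0}\<close>) the \<open>Liminf\<close> below is
  \<open>\<infinity>\<close>, so the conditions hold trivially there, as they should.
\<close>

definition lsc_on :: "'a::topological_space set \<Rightarrow> ('a \<Rightarrow> ereal) \<Rightarrow> bool" where
  "lsc_on S g \<longleftrightarrow> (\<forall>x\<in>S. g x \<le> Liminf (at x within S) g)"

definition frechet_subdiff ::
  "'a::real_inner set \<Rightarrow> ('a \<Rightarrow> ereal) \<Rightarrow> 'a \<Rightarrow> 'a set" where
  "frechet_subdiff S g x =
     (if x \<in> edom S g
      then {v \<in> S. 0 \<le> Liminf (at x within S)
              (\<lambda>y. (g y - g x - ereal (v \<bullet> (y - x))) / ereal (norm (y - x)))}
      else {})"

definition limiting_subdiff ::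
  "'a::real_inner set \<Rightarrow> ('a \<Rightarrow> ereal) \<Rightarrow> 'a \<Rightarrow> 'a set" where
  "limiting_subdiff S g x =
     (if x \<in> edom S g
      then {v. \<exists>X W. (\<forall>n. X n \<in> S \<and> W n \<in> frechet_subdiff S g (X n)) \<and>
                 X \<longlonglongrightarrow> x \<and> (\<lambda>n. g (X n)) \<longlonglongrightarrow> g x \<and> W \<longlonglongrightarrow> v}
      else {})"

definition critical_point_II :: "'a::real_inner set \<Rightarrow> ('a \<Rightarrow> ereal) \<Rightarrow> 'a \<Rightarrow> bool" where
  "critical_point_II S g x \<longleftrightarrow> x \<in> edom S g \<and> 0 \<in> limiting_subdiff S g x"

text \<open>
  The distance is \<open>\<infinity>\<close> for an empty subdifferential; otherwise the infimum is attained
  because the limiting subdifferential is closed.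
\<close>

definition subdiff_dist :: "'a::real_inner set \<Rightarrow> ('a \<Rightarrow> ereal) \<Rightarrow> 'a \<Rightarrow> ereal" where
  "subdiff_dist S g x = (INF v\<in>limiting_subdiff S g x. ereal (norm v))"

definition KL_property_at :: "'a::real_inner set \<Rightarrow> ('a \<Rightarrow> ereal) \<Rightarrow> 'a \<Rightarrow> bool" where
  "KL_property_at S g z \<longleftrightarrow>
     (\<exists>(\<eta>::ereal) U (\<xi>::real \<Rightarrow> real) \<xi>'.
        0 < \<eta> \<and> open U \<and> z \<in> U \<and>
        concave_on {t. 0 \<le> t \<and> ereal t < \<eta>} \<xi> \<and>
        (\<forall>t. 0 \<le> t \<and> ereal t < \<eta> \<longrightarrow> 0 \<le> \<xi> t) \<and>
        \<xi> 0 = 0 \<and> continuous (at_right 0) \<xi> \<and>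
        (\<forall>t. 0 < t \<and> ereal t < \<eta> \<longrightarrow> (\<xi> has_real_derivative \<xi>' t) (at t) \<and> 0 < \<xi>' t) \<and>
        continuous_on {t. 0 < t \<and> ereal t < \<eta>} \<xi>' \<and>
        (\<forall>x \<in> U \<inter> S. g z < g x \<and> g x < g z + \<eta> \<longrightarrow>
           1 \<le> ereal (\<xi>' (real_of_ereal (g x - g z))) * subdiff_dist S g x))"

definition KL_function :: "'a::real_inner set \<Rightarrow> ('a \<Rightarrow> ereal) \<Rightarrow> bool" where
  "KL_function S g \<longleftrightarrow>
     (\<forall>z\<in>S. limiting_subdiff S g z \<noteq> {} \<longrightarrow> KL_property_at S g z)"


section \<open>The problem\<close>

definition block_update :: "'b ^ 's \<Rightarrow> 's \<Rightarrow> 'b \<Rightarrow> 'b ^ ('s::finite)" where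
  "block_update x i u = (\<chi> l. if l = i then u else x $ l)"

definition objective ::
  "('b ^ 's::finite \<Rightarrow> real) \<Rightarrow> ('s \<Rightarrow> 'b \<Rightarrow> ereal) \<Rightarrow> 'b ^ 's \<Rightarrow> ereal" where
  "objective f r x = ereal (f x) + (\<Sum>i\<in>UNIV. r i (x $ i))"

definition composite_problem ::
  "('s::finite \<Rightarrow> 'b::euclidean_space set) \<Rightarrow> ('b ^ 's \<Rightarrow> real) \<Rightarrow> ('s \<Rightarrow> 'b \<Rightarrow> ereal) \<Rightarrow> bool" where
  "composite_problem V f r \<longleftrightarrow>
     (\<forall>i. subspace (V i)) \<and> continuous_on (prod_space V) f \<and>
     (\<forall>i. proper_on (V i) (r i) \<and> lsc_on (V i) (r i))"

definition bregman_kernels ::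
  "('s::finite \<Rightarrow> 'b::euclidean_space set) \<Rightarrow> ('s \<Rightarrow> 'b \<Rightarrow> real) \<Rightarrow>
   ('s \<Rightarrow> real) \<Rightarrow> ('s \<Rightarrow> real) \<Rightarrow> bool" where
  "bregman_kernels V H \<sigma> LH \<longleftrightarrow>
     (\<forall>i. strictly_convex_on (V i) (H i) \<and> C1_on (V i) (H i) \<and>
          0 < \<sigma> i \<and> strongly_convex_on (\<sigma> i) (V i) (H i) \<and>
          (LH i)-lipschitz_on (V i) (gradient_on (V i) (H i)))"


section \<open>The algorithms\<close>

text \<open>
  Indexing: \<open>blk k j\<close> is the block chosen in inner step \<open>j\<close> of outer loop \<open>k\<close>
  (\<open>k \<ge> 1\<close>, \<open>1 \<le> j \<le> T k\<close>) and \<open>x k j\<close> is the inner iterate \<open>x\<^sup>(\<^sup>k\<^sup>,\<^sup>j\<^sup>)\<close>.  As only the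
  parameters of the chosen block are used in a step, \<open>\<alpha> k j\<close> stands for \<open>\<alpha>\<^sub>i\<^sup>(\<^sup>k\<^sup>,\<^sup>j\<^sup>)\<close> with
  \<open>i = blk k j\<close>, and likewise for \<open>\<beta>\<close>, \<open>\<gamma>\<close> and \<open>L\<close>.  A random choice of blocks
  is covered by letting \<open>blk\<close> be arbitrary.
\<close>

datatype block_scheme = IBP | IBPG

text \<open>
  \<open>prev_value T blk z x k j i\<close> is the value which block \<open>i\<close> had before the most recent of its
  updates among all inner steps up to and including step \<open>j\<close> of loop \<open>k\<close>, and \<open>z $ i\<close> if
  there is no such update; \<open>z\<close> is the point \<open>x\<^sup>(\<^sup>-\<^sup>1\<^sup>)\<close>.
\<close>

fun prev_value ::
  "(nat \<Rightarrow> nat) \<Rightarrow> (nat \<Rightarrow> nat \<Rightarrow> 's) \<Rightarrow> 'b ^ 's \<Rightarrow> (nat \<Rightarrow> nat \<Rightarrow> 'b ^ 's) \<Rightarrow>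
   nat \<Rightarrow> nat \<Rightarrow> 's::finite \<Rightarrow> 'b" where
  "prev_value T blk z x 0 j i = z $ i"
| "prev_value T blk z x (Suc k) 0 i = prev_value T blk z x k (T k) i"
| "prev_value T blk z x (Suc k) (Suc j) i =
     (if blk (Suc k) (Suc j) = i then x (Suc k) j $ i
      else prev_value T blk z x (Suc k) j i)"

definition block_fun :: "('b ^ 's::finite \<Rightarrow> real) \<Rightarrow> 'b ^ 's \<Rightarrow> 's \<Rightarrow> 'b \<Rightarrow> real" where
  "block_fun f x i u = f (block_update x i u)"

text \<open>
  The objective minimised in one step, for current point \<open>x\<close>, previous block value \<open>y\<close>
  and parameters \<open>a, b, c\<close> (the \<open>\<alpha>\<close>, \<open>\<beta>\<close>, \<open>\<gamma>\<close> of the step).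
\<close>

definition step_objective ::
  "block_scheme \<Rightarrow> ('s::finite \<Rightarrow> 'b::euclidean_space set) \<Rightarrow> ('b ^ 's \<Rightarrow> real) \<Rightarrow>
   ('s \<Rightarrow> 'b \<Rightarrow> ereal) \<Rightarrow> ('s \<Rightarrow> 'b \<Rightarrow> real) \<Rightarrow>
   real \<Rightarrow> real \<Rightarrow> real \<Rightarrow> 'b ^ 's \<Rightarrow> 'b \<Rightarrow> 's \<Rightarrow> 'b \<Rightarrow> ereal" where
  "step_objective scheme V f r H a b c x y i u =
     (let xhat = x $ i + a *\<^sub>R (x $ i - y);
          xgrave = x $ i + c *\<^sub>R (x $ i - y);
          D = bregman_dist (V i) (H i)
      in case scheme of
           IBP \<Rightarrow> ereal (block_fun f x i u) + r i u + ereal (1 / b * D u xhat)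
         | IBPG \<Rightarrow> r i u + ereal (gradient_on (V i) (block_fun f x i) xgrave \<bullet> u)
                    + ereal (1 / b * D u xhat))"

text \<open>
  \<open>xt k\<close> is the outer iterate, with \<open>xt 0\<close> playing the role of both
  starting points, which coincide.
\<close>

definition block_run ::
  "block_scheme \<Rightarrow> ('s::finite \<Rightarrow> 'b::euclidean_space set) \<Rightarrow> ('b ^ 's \<Rightarrow> real) \<Rightarrow>
   ('s \<Rightarrow> 'b \<Rightarrow> ereal) \<Rightarrow> ('s \<Rightarrow> 'b \<Rightarrow> real) \<Rightarrow>
   (nat \<Rightarrow> nat \<Rightarrow> real) \<Rightarrow> (nat \<Rightarrow> nat \<Rightarrow> real) \<Rightarrow> (nat \<Rightarrow> nat \<Rightarrow> real) \<Rightarrow>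
   (nat \<Rightarrow> nat) \<Rightarrow> (nat \<Rightarrow> nat \<Rightarrow> 's) \<Rightarrow> (nat \<Rightarrow> nat \<Rightarrow> 'b ^ 's) \<Rightarrow> (nat \<Rightarrow> 'b ^ 's) \<Rightarrow> bool" where
  "block_run scheme V f r H \<alpha> \<beta> \<gamma> T blk x xt \<longleftrightarrow>
     xt 0 \<in> prod_space V \<and>
     (\<forall>k\<ge>1.
        x k 0 = xt (k - 1) \<and> xt k = x k (T k) \<and>
        (\<forall>j\<in>{1..T k}.
           let i = blk k j;
               y = prev_value T blk (xt 0) x k (j - 1) i
           in \<exists>u. is_arg_min
                    (step_objective scheme V f r H (\<alpha> k j) (\<beta> k j) (\<gamma> k j) (x k (j - 1)) y i)
                    (\<lambda>u. u \<in> V i) u \<and>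
                  x k j = block_update (x k (j - 1)) i u))"


section \<open>Parameters\<close>

definition num_updates :: "(nat \<Rightarrow> nat) \<Rightarrow> (nat \<Rightarrow> nat \<Rightarrow> 's) \<Rightarrow> 's \<Rightarrow> nat \<Rightarrow> nat" where
  "num_updates T blk i k = card {j \<in> {1..T k}. blk k j = i}"

text \<open>
  For \<open>1 \<le> m \<le> num_updates T blk i k\<close> this is the inner step in which block \<open>i\<close> is
  updated for the \<open>m\<close>-th time in loop \<open>k\<close>.
\<close>

definition update_step :: "(nat \<Rightarrow> nat \<Rightarrow> 's) \<Rightarrow> 's \<Rightarrow> nat \<Rightarrow> nat \<Rightarrow> nat" where
  "update_step blk i k m = (LEAST j. card {l \<in> {1..j}. blk k l = i} = m)"

definition at_update ::
  "(nat \<Rightarrow> nat \<Rightarrow> 's) \<Rightarrow> (nat \<Rightarrow> nat \<Rightarrow> real) \<Rightarrow> 's \<Rightarrow> nat \<Rightarrow> nat \<Rightarrow> real" where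
  "at_update blk a i k m = a k (update_step blk i k m)"

text \<open>
  The weights \<open>\<theta>\<^sub>i\<^sup>(\<^sup>k\<^sup>,\<^sup>m\<^sup>)\<close> of IBP and \<open>\<lambda>\<^sub>i\<^sup>(\<^sup>k\<^sup>,\<^sup>m\<^sup>)\<close> of IBPG for
  \<open>m \<ge> 1\<close>.  When \<open>m\<close> is one more than the number of updates in loop \<open>k\<close>, the weight is
  the one with indices \<open>(k + 1, 1)\<close>; this is the purpose of \<open>roll_over\<close>.
\<close>

definition roll_over ::
  "(nat \<Rightarrow> nat) \<Rightarrow> (nat \<Rightarrow> nat \<Rightarrow> 's) \<Rightarrow> ('s \<Rightarrow> nat \<Rightarrow> nat \<Rightarrow> real) \<Rightarrow> 's \<Rightarrow> nat \<Rightarrow> nat \<Rightarrow> real" where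
  "roll_over T blk w i k m = (if m \<le> num_updates T blk i k then w i k m else w i (k + 1) 1)"

definition theta_weight ::
  "real \<Rightarrow> ('s \<Rightarrow> real) \<Rightarrow> ('s \<Rightarrow> real) \<Rightarrow> (nat \<Rightarrow> nat \<Rightarrow> real) \<Rightarrow> (nat \<Rightarrow> nat \<Rightarrow> real) \<Rightarrow>
   (nat \<Rightarrow> nat) \<Rightarrow> (nat \<Rightarrow> nat \<Rightarrow> 's) \<Rightarrow> 's \<Rightarrow> nat \<Rightarrow> nat \<Rightarrow> real" where
  "theta_weight \<nu> \<sigma> LH \<alpha> \<beta> T blk =
     roll_over T blk (\<lambda>i k m.
       (LH i * at_update blk \<alpha> i k m)\<^sup>2 / (2 * \<nu> * \<sigma> i * at_update blk \<beta> i k m))"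

definition lambda_weight ::
  "real \<Rightarrow> real \<Rightarrow> ('s \<Rightarrow> real) \<Rightarrow> ('s \<Rightarrow> real) \<Rightarrow> (nat \<Rightarrow> nat \<Rightarrow> real) \<Rightarrow> (nat \<Rightarrow> nat \<Rightarrow> real) \<Rightarrow>
   (nat \<Rightarrow> nat \<Rightarrow> real) \<Rightarrow> (nat \<Rightarrow> nat) \<Rightarrow> (nat \<Rightarrow> nat \<Rightarrow> 's) \<Rightarrow> 's \<Rightarrow> nat \<Rightarrow> nat \<Rightarrow> real" where
  "lambda_weight \<nu> \<kappa> \<sigma> LH \<alpha> \<gamma> L T blk =
     roll_over T blk (\<lambda>i k m.
       1 / 2 * (at_update blk \<gamma> i k m + \<kappa> * LH i * at_update blk \<alpha> i k m / \<sigma> i)\<^sup>2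
         * (at_update blk L i k m / (\<nu> * (\<kappa> - 1))))"

definition IBP_parameters ::
  "real \<Rightarrow> real \<Rightarrow> ('s \<Rightarrow> real) \<Rightarrow> ('s \<Rightarrow> real) \<Rightarrow> (nat \<Rightarrow> nat \<Rightarrow> real) \<Rightarrow> (nat \<Rightarrow> nat \<Rightarrow> real) \<Rightarrow>
   (nat \<Rightarrow> nat) \<Rightarrow> (nat \<Rightarrow> nat \<Rightarrow> 's) \<Rightarrow> bool" where
  "IBP_parameters \<nu> \<delta> \<sigma> LH \<alpha> \<beta> T blk \<longleftrightarrow>
     (\<forall>k\<ge>1. \<forall>j\<in>{1..T k}. 0 \<le> \<alpha> k j \<and> 0 < \<beta> k j) \<and>
     (\<forall>k\<ge>1. \<forall>i. \<forall>m\<in>{1..num_updates T blk i k}.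
        (1 - \<nu>) * \<sigma> i / (2 * at_update blk \<beta> i k m)
          \<ge> \<delta> * theta_weight \<nu> \<sigma> LH \<alpha> \<beta> T blk i k (m + 1))"

definition IBPG_parameters ::
  "('s::finite \<Rightarrow> 'b::euclidean_space set) \<Rightarrow> ('b ^ 's \<Rightarrow> real) \<Rightarrow>
   real \<Rightarrow> real \<Rightarrow> real \<Rightarrow> ('s \<Rightarrow> real) \<Rightarrow> ('s \<Rightarrow> real) \<Rightarrow>
   (nat \<Rightarrow> nat \<Rightarrow> real) \<Rightarrow> (nat \<Rightarrow> nat \<Rightarrow> real) \<Rightarrow> (nat \<Rightarrow> nat \<Rightarrow> real) \<Rightarrow> (nat \<Rightarrow> nat \<Rightarrow> real) \<Rightarrow>
   (nat \<Rightarrow> nat) \<Rightarrow> (nat \<Rightarrow> nat \<Rightarrow> 's) \<Rightarrow> (nat \<Rightarrow> nat \<Rightarrow> 'b ^ 's) \<Rightarrow> bool" where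
  "IBPG_parameters V f \<nu> \<delta> \<kappa> \<sigma> LH \<alpha> \<beta> \<gamma> L T blk x \<longleftrightarrow>
     1 < \<kappa> \<and>
     (\<forall>k\<ge>1. \<forall>j\<in>{1..T k}. 0 \<le> \<alpha> k j \<and> 0 < \<beta> k j \<and> 0 \<le> \<gamma> k j \<and> 0 < L k j \<and>
        (L k j)-lipschitz_on (V (blk k j))
          (gradient_on (V (blk k j)) (block_fun f (x k (j - 1)) (blk k j)))) \<and>
     (\<forall>k\<ge>1. \<forall>i. \<forall>m\<in>{1..num_updates T blk i k}.
        at_update blk \<beta> i k m = \<sigma> i / (\<kappa> * at_update blk L i k m) \<and>
        (1 - \<nu>) * (\<kappa> - 1) * at_update blk L i k m / 2
          \<ge> \<delta> * lambda_weight \<nu> \<kappa> \<sigma> LH \<alpha> \<gamma> L T blk i k (m + 1))"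

definition essentially_cyclic :: "(nat \<Rightarrow> nat) \<Rightarrow> (nat \<Rightarrow> nat \<Rightarrow> 's::finite) \<Rightarrow> bool" where
  "essentially_cyclic T blk \<longleftrightarrow>
     (\<exists>Tbar. \<forall>k\<ge>1. blk k ` {1..T k} = UNIV \<and> CARD('s) \<le> T k \<and> T k \<le> Tbar)"

definition IBP_bounds ::
  "real \<Rightarrow> real \<Rightarrow> ('s \<Rightarrow> real) \<Rightarrow> ('s \<Rightarrow> real) \<Rightarrow> (nat \<Rightarrow> nat \<Rightarrow> real) \<Rightarrow> (nat \<Rightarrow> nat \<Rightarrow> real) \<Rightarrow>
   (nat \<Rightarrow> nat) \<Rightarrow> (nat \<Rightarrow> nat \<Rightarrow> 's) \<Rightarrow> bool" where
  "IBP_bounds W\<^sub>1 \<nu> \<sigma> LH \<alpha> \<beta> T blk \<longleftrightarrow>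
     0 < W\<^sub>1 \<and>
     (\<exists>amax>0. \<exists>bmin>0. \<forall>k\<ge>1. \<forall>i. \<forall>m\<in>{1..num_updates T blk i k}.
        W\<^sub>1 \<le> theta_weight \<nu> \<sigma> LH \<alpha> \<beta> T blk i k m \<and>
        at_update blk \<alpha> i k m \<le> amax \<and> bmin \<le> at_update blk \<beta> i k m)"

definition IBPG_bounds ::
  "real \<Rightarrow> real \<Rightarrow> real \<Rightarrow> ('s \<Rightarrow> real) \<Rightarrow> ('s \<Rightarrow> real) \<Rightarrow> (nat \<Rightarrow> nat \<Rightarrow> real) \<Rightarrow>
   (nat \<Rightarrow> nat \<Rightarrow> real) \<Rightarrow> (nat \<Rightarrow> nat \<Rightarrow> real) \<Rightarrow> (nat \<Rightarrow> nat) \<Rightarrow> (nat \<Rightarrow> nat \<Rightarrow> 's) \<Rightarrow> bool" where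
  "IBPG_bounds W\<^sub>1 \<nu> \<kappa> \<sigma> LH \<alpha> \<gamma> L T blk \<longleftrightarrow>
     0 < W\<^sub>1 \<and>
     (\<exists>Lmax>0. \<exists>amax>0. \<exists>cmax>0. \<forall>k\<ge>1. \<forall>i. \<forall>m\<in>{1..num_updates T blk i k}.
        W\<^sub>1 \<le> lambda_weight \<nu> \<kappa> \<sigma> LH \<alpha> \<gamma> L T blk i k m \<and>
        at_update blk L i k m \<le> Lmax \<and>
        at_update blk \<alpha> i k m \<le> amax \<and> at_update blk \<gamma> i k m \<le> cmax)"

end

(*
  The step inequalities hold with weights that vary from update to update, but the bounds on them
  allow constants A > W: with a and b the lengths of the current and of the previous move of the
  updated block, F(new) + A a^2 <= F(old) + W b^2.  Hence F plus (A + W)/2 times the squared last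
  moves of all blocks decreases, by a multiple of the squared length of each outer loop.

  The KL inequality is only assumed for F, not for this Lyapunov function.  It transfers: when F
  exceeds its limit by at least half of what the Lyapunov function does, the KL inequality of F
  applies; otherwise the quadratic part dominates and the last moves themselves are bounded below by
  a square root.  This gives a desingularizing function for the Lyapunov function along the
  iterates, and the usual finite length argument traps the sequence near a cluster point.
*)

theory Submission
  imports Defs
begin

subsection \<open>Gradients on a subspace\<close>

text \<open>The gap between A and W comes from the hypothesis on \<open>\<delta>\<close>. The
  parameter conditions bound the coefficient of a^2 below by \<open>\<delta>\<close> times the next
  weight, hence by \<open>\<delta> * W\<^sub>1\<close>, and the coefficient of b^2 is at most
  \<open>W\<^sub>2\<close>. On a nonzero space strong convexity forces
  \<open>\<sigma> i \<le> LH i\<close>, so the hypothesis implies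
  \<open>W\<^sub>2 < \<delta> * W\<^sub>1\<close>.

  Three obstacles shape the rest. F need not decrease and no lower bound of F is assumed, so the
  Lyapunov values are bounded below only through a cluster point. At a cluster point F is merely
  lower semicontinuous, so that its value there is the limit must be drawn from the minimality of
  the steps, tested at the cluster point. Finally, a step speaks about one block while the others
  have intermediate values: each block is therefore examined at its last update in a loop, and its
  move before that may belong to the preceding loop. Hence every error is measured by two
  consecutive loop lengths, and the length estimate is a two-term recursion.\<close>

lemma subspace_line:
  assumes "subspace S" "x \<in> S" "y \<in> S"
  shows "x + t *\<^sub>R (y - x) \<in> S"
  using assms by (simp add: subspace_add subspace_scale subspace_diff)

text \<open>The whole line stays in \<open>S\<close>, so a derivative within \<open>S\<close>
  becomes a two-sided derivative in one real variable.\<close>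

lemma has_real_derivative_along_line:
  fixes g :: "'a::euclidean_space \<Rightarrow> real"
  assumes S: "subspace S" "x \<in> S" "y \<in> S"
    and g: "(g has_derivative (\<lambda>h. v \<bullet> h)) (at (x + t *\<^sub>R (y - x)) within S)"
  shows "((\<lambda>t. g (x + t *\<^sub>R (y - x))) has_real_derivative v \<bullet> (y - x)) (at t)"
proof -
  have 1: "((\<lambda>t. x + t *\<^sub>R (y - x)) has_derivative (\<lambda>s. s *\<^sub>R (y - x))) (at t within UNIV)"
    by (auto intro!: derivative_eq_intros)
  have 2: "(g has_derivative (\<lambda>h. v \<bullet> h))
      (at (x + t *\<^sub>R (y - x)) within (\<lambda>t. x + t *\<^sub>R (y - x)) ` UNIV)"
    by (rule has_derivative_subset[OF g]) (auto intro: subspace_line[OF S])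
  show ?thesis
    using has_derivative_in_compose[OF 1 2]
    by (simp add: has_field_derivative_def mult_commute_abs)
qed

text \<open>The vector representing \<open>l\<close> on the whole space is projected to
  \<open>S\<close>; its orthogonal part does not act on \<open>S\<close>.\<close>

lemma subspace_riesz:
  fixes S :: "'a::euclidean_space set" and l :: "'a \<Rightarrow> real"
  assumes S: "subspace S" and l: "linear l"
  obtains v where "v \<in> S" "\<And>h. h \<in> S \<Longrightarrow> l h = v \<bullet> h"
proof -
  define w where "w = (\<Sum>b\<in>Basis. l b *\<^sub>R b)"
  have w: "l h = w \<bullet> h" for h
  proof -
    have "l h = l (\<Sum>b\<in>Basis. (h \<bullet> b) *\<^sub>R b)"
      by (simp add: euclidean_representation)
    also have "\<dots> = w \<bullet> h"
      by (simp add: linear_sum[OF l] linear_scale[OF l] w_def inner_sum_right inner_commute[of _ h] mult.commute)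
    finally show ?thesis .
  qed
  obtain y z where yz: "y \<in> span S" "\<And>w. w \<in> span S \<Longrightarrow> orthogonal z w" "w = y + z"
    by (metis orthogonal_subspace_decomp_exists)
  have "l h = y \<bullet> h" if "h \<in> S" for h
    using yz(2)[of h] that by (simp add: w yz(3) inner_add_left orthogonal_def span_base)
  moreover have "y \<in> S"
    using yz(1) S by (metis span_eq_iff)
  ultimately show thesis
    using that by blast
qed

lemma has_derivative_inner_unique:
  fixes g :: "'a::euclidean_space \<Rightarrow> real"
  assumes S: "subspace S" and x: "x \<in> S" and v: "v \<in> S" "w \<in> S"
    and dv: "(g has_derivative (\<lambda>h. v \<bullet> h)) (at x within S)"
    and dw: "(g has_derivative (\<lambda>h. w \<bullet> h)) (at x within S)"
  shows "v = w"
proof -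
  have y: "x + (v - w) \<in> S"
    using S x v by (simp add: subspace_add subspace_diff)
  have "((\<lambda>t. g (x + t *\<^sub>R ((x + (v - w)) - x))) has_real_derivative v \<bullet> ((x + (v - w)) - x)) (at 0)"
    by (rule has_real_derivative_along_line[OF S x y]) (use dv in simp)
  moreover have "((\<lambda>t. g (x + t *\<^sub>R ((x + (v - w)) - x))) has_real_derivative w \<bullet> ((x + (v - w)) - x)) (at 0)"
    by (rule has_real_derivative_along_line[OF S x y]) (use dw in simp)
  ultimately have "v \<bullet> (v - w) = w \<bullet> (v - w)"
    using DERIV_unique by fastforce
  then have "(v - w) \<bullet> (v - w) = 0"
    by (simp add: inner_diff_left)
  then show ?thesis
    by simp
qed

lemma gradient_on_eqI:
  assumes "subspace S" "x \<in> S" "v \<in> S" "(g has_derivative (\<lambda>h. v \<bullet> h)) (at x within S)"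
  shows "gradient_on S g x = v"
  unfolding gradient_on_def
  by (rule the_equality) (use assms has_derivative_inner_unique in blast)+

text \<open>The remainder estimate only evaluates the derivative at differences of points of
  \<open>S\<close>, so any derivative may be replaced by the vector of \<open>S\<close> that
  represents it there.\<close>

lemma gradient_on_works:
  assumes S: "subspace S" and x: "x \<in> S" and g: "g differentiable (at x within S)"
  shows "gradient_on S g x \<in> S"
    and "(g has_derivative (\<lambda>h. gradient_on S g x \<bullet> h)) (at x within S)"
proof -
  obtain l where l: "(g has_derivative l) (at x within S)"
    using g by (auto simp: differentiable_def)
  obtain v where v: "v \<in> S" "\<And>h. h \<in> S \<Longrightarrow> l h = v \<bullet> h"
    using subspace_riesz[OF S has_derivative_linear[OF l]] by blast
  have "(g has_derivative (\<lambda>h. v \<bullet> h)) (at x within S)"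
    unfolding has_derivative_within_alt
  proof (intro conjI allI impI)
    fix e :: real assume "0 < e"
    then obtain d where "d > 0" and
      d: "\<forall>y\<in>S. norm (y - x) < d \<longrightarrow> norm (g y - g x - l (y - x)) \<le> e * norm (y - x)"
      using l by (auto simp: has_derivative_within_alt)
    have "norm (g y - g x - v \<bullet> (y - x)) \<le> e * norm (y - x)" if "y \<in> S" "norm (y - x) < d" for y
      using d that v(2)[of "y - x"] S x by (auto simp: subspace_diff)
    with \<open>d > 0\<close> show "\<exists>d>0. \<forall>y\<in>S. norm (y - x) < d \<longrightarrow>
        norm (g y - g x - v \<bullet> (y - x)) \<le> e * norm (y - x)"
      by blast
  qed (rule bounded_linear_inner_right)
  moreover from gradient_on_eqI[OF S x v(1) this] have "gradient_on S g x = v" .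
  ultimately show "gradient_on S g x \<in> S"
    and "(g has_derivative (\<lambda>h. gradient_on S g x \<bullet> h)) (at x within S)"
    using v by auto
qed

lemma descent_lemma_on:
  fixes g :: "'a::euclidean_space \<Rightarrow> real"
  assumes S: "subspace S" and g: "g differentiable_on S"
    and B: "B \<subseteq> S" "convex B" and lip: "M-lipschitz_on B (gradient_on S g)"
    and x: "x \<in> B" and y: "y \<in> B"
  shows "g y \<le> g x + gradient_on S g x \<bullet> (y - x) + M / 2 * (norm (y - x))\<^sup>2"
proof -
  let ?G = "gradient_on S g"
  let ?z = "\<lambda>t. x + t *\<^sub>R (y - x)"
  \<comment> \<open>The claim is \<open>\<phi> 1 \<le> \<phi> 0\<close>. The segment stays in the
    convex set \<open>B\<close>, and the Lipschitz bound there makes the derivative of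
    \<open>\<phi>\<close> nonpositive.\<close>
  define \<phi> where "\<phi> = (\<lambda>t. g (?z t) - t * (?G x \<bullet> (y - x)) - M / 2 * t\<^sup>2 * (norm (y - x))\<^sup>2)"
  have xy: "x \<in> S" "y \<in> S"
    using B x y by auto
  have "\<exists>D. DERIV \<phi> t :> D \<and> D \<le> 0" if t: "0 \<le> t" "t \<le> 1" for t
  proof (intro exI conjI)
    have "?z t = (1 - t) *\<^sub>R x + t *\<^sub>R y"
      by (simp add: algebra_simps)
    then have zB: "?z t \<in> B"
      using convexD_alt[OF B(2) x y t] by simp
    have "(g has_derivative (\<lambda>h. ?G (?z t) \<bullet> h)) (at (?z t) within S)"
      using zB B g by (intro gradient_on_works[OF S]) (auto simp: differentiable_on_def)
    note has_real_derivative_along_line[OF S xy this]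
    then show "DERIV \<phi> t :> ?G (?z t) \<bullet> (y - x) - ?G x \<bullet> (y - x) - M * t * (norm (y - x))\<^sup>2"
      unfolding \<phi>_def by (auto intro!: derivative_eq_intros)
    have "?G (?z t) \<bullet> (y - x) - ?G x \<bullet> (y - x) \<le> norm (?G (?z t) - ?G x) * norm (y - x)"
      by (metis inner_diff_left norm_cauchy_schwarz)
    also have "\<dots> \<le> (M * norm (?z t - x)) * norm (y - x)"
      using lipschitz_on_normD[OF lip zB x] by (intro mult_right_mono) auto
    also have "\<dots> = M * t * (norm (y - x))\<^sup>2"
      using t by (simp add: power2_eq_square)
    finally show "?G (?z t) \<bullet> (y - x) - ?G x \<bullet> (y - x) - M * t * (norm (y - x))\<^sup>2 \<le> 0"
      by simp
  qed
  then have "\<phi> 1 \<le> \<phi> 0"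
    using DERIV_nonpos_imp_nonincreasing[of 0 1 \<phi>] by simp
  then show ?thesis
    by (simp add: \<phi>_def)
qed

text \<open>The strong convexity inequality at \<open>x + h (y - x)\<close> is divided by
  \<open>h\<close>, and \<open>h\<close> tends to 0 from the right.\<close>

lemma strongly_convex_on_gradient:
  fixes g :: "'a::euclidean_space \<Rightarrow> real"
  assumes S: "subspace S" and g: "g differentiable_on S" and sc: "strongly_convex_on \<mu> S g"
    and x: "x \<in> S" and y: "y \<in> S"
  shows "g x + gradient_on S g x \<bullet> (y - x) + \<mu> / 2 * (norm (y - x))\<^sup>2 \<le> g y"
proof -
  let ?z = "\<lambda>t. x + t *\<^sub>R (y - x)"
  let ?D = "gradient_on S g x \<bullet> (y - x)"
  have "(g has_derivative (\<lambda>h. gradient_on S g x \<bullet> h)) (at (?z 0) within S)"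
    using x g gradient_on_works[OF S x] by (simp add: differentiable_on_def)
  from has_real_derivative_along_line[OF S x y this]
  have "((\<lambda>h. (g (?z h) - g x) / h) \<longlongrightarrow> ?D) (at 0)"
    by (simp add: DERIV_def)
  then have lim: "((\<lambda>h. (g (?z h) - g x) / h) \<longlongrightarrow> ?D) (at_right 0)"
    by (rule tendsto_mono[rotated]) (simp add: at_within_le_at)
  have lim2: "((\<lambda>h. g y - g x - \<mu> / 2 * (1 - h) * (norm (y - x))\<^sup>2)
      \<longlongrightarrow> g y - g x - \<mu> / 2 * (1 - 0) * (norm (y - x))\<^sup>2) (at_right 0)"
    by (intro tendsto_intros)
  have "(g (?z h) - g x) / h \<le> g y - g x - \<mu> / 2 * (1 - h) * (norm (y - x))\<^sup>2"
    if h: "0 < h" "h < 1" for h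
  proof -
    have "?z h = (1 - h) *\<^sub>R x + h *\<^sub>R y"
      by (simp add: algebra_simps)
    moreover have "g ((1 - h) *\<^sub>R x + h *\<^sub>R y)
        \<le> (1 - h) * g x + h * g y - \<mu> / 2 * h * (1 - h) * (norm (x - y))\<^sup>2"
      using sc x y h by (simp add: strongly_convex_on_def)
    ultimately have "g (?z h) - g x \<le> (g y - g x - \<mu> / 2 * (1 - h) * (norm (y - x))\<^sup>2) * h"
      by (simp add: algebra_simps norm_minus_commute)
    then show ?thesis
      using h by (simp add: pos_divide_le_eq)
  qed
  then have "\<forall>\<^sub>F h in at_right 0. (g (?z h) - g x) / h \<le> g y - g x - \<mu> / 2 * (1 - h) * (norm (y - x))\<^sup>2"
    by (auto simp: eventually_at_right_field intro: exI[of _ 1])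
  from tendsto_le[OF _ lim2 lim this] show ?thesis
    by simp
qed

subsection \<open>Subdifferentials\<close>

text \<open>Multiplying out the quotient yields a form in which subgradients can be verified and
  added without dividing extended reals.\<close>

lemma frechet_subdiff_iff:
  fixes g :: "'a::real_inner \<Rightarrow> ereal"
  assumes x: "x \<in> S" "g x \<noteq> \<infinity>" and g: "\<And>y. y \<in> S \<Longrightarrow> g y \<noteq> -\<infinity>"
  shows "v \<in> frechet_subdiff S g x \<longleftrightarrow> v \<in> S \<and>
    (\<forall>e>0. \<exists>d>0. \<forall>y\<in>S. dist y x < d \<longrightarrow> g x + ereal (v \<bullet> (y - x) - e * norm (y - x)) \<le> g y)"
proof -
  obtain gx where gx: "g x = ereal gx"
    using x g[of x] by (cases "g x") auto
  let ?q = "\<lambda>y. (g y - g x - ereal (v \<bullet> (y - x))) / ereal (norm (y - x))"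
  have quot: "ereal (- e) < ?q y \<longleftrightarrow> g x + ereal (v \<bullet> (y - x) - e * norm (y - x)) < g y"
    if "y \<in> S" "y \<noteq> x" for y e
  proof -
    have n: "norm (y - x) > 0"
      using that by simp
    show ?thesis
      using g[OF that(1)] n by (cases "g y") (auto simp: gx field_simps)
  qed
  have "0 \<le> Liminf (at x within S) ?q \<longleftrightarrow>
      (\<forall>e>0. \<forall>\<^sub>F y in at x within S. ereal (- e) < ?q y)"
  proof
    assume "0 \<le> Liminf (at x within S) ?q"
    then show "\<forall>e>0. \<forall>\<^sub>F y in at x within S. ereal (- e) < ?q y"
      unfolding le_Liminf_iff by auto
  next
    assume *: "\<forall>e>0. \<forall>\<^sub>F y in at x within S. ereal (- e) < ?q y"
    show "0 \<le> Liminf (at x within S) ?q"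
      unfolding le_Liminf_iff
    proof (intro allI impI)
      fix c :: ereal assume "c < 0"
      then obtain e where "e < 0" "c < ereal e"
        using ereal_dense2[of c 0] by (auto simp: zero_ereal_def)
      from *[rule_format, of "- e"] show "\<forall>\<^sub>F y in at x within S. c < ?q y"
        by (rule eventually_mono) (use \<open>e < 0\<close> \<open>c < ereal e\<close> in \<open>auto intro: less_trans\<close>)
    qed
  qed
  also have "\<dots> \<longleftrightarrow> (\<forall>e>0. \<exists>d>0. \<forall>y\<in>S. y \<noteq> x \<and> dist y x < d \<longrightarrow>
      g x + ereal (v \<bullet> (y - x) - e * norm (y - x)) < g y)"
    unfolding eventually_at by (meson quot)
  also have "\<dots> \<longleftrightarrow> (\<forall>e>0. \<exists>d>0. \<forall>y\<in>S. dist y x < d \<longrightarrow>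
      g x + ereal (v \<bullet> (y - x) - e * norm (y - x)) \<le> g y)" (is "?A \<longleftrightarrow> ?B")
  proof
    assume ?A
    then show ?B
      by (force simp: gx less_imp_le)
  next
    assume B: ?B
    show ?A
    proof (intro allI impI)
      fix e :: real assume "0 < e"
      \<comment> \<open>Halving \<open>e\<close> turns the weak inequality into a strict one away
        from \<open>x\<close>.\<close>
      with B obtain d where "d > 0" and d: "\<forall>y\<in>S. dist y x < d \<longrightarrow>
          g x + ereal (v \<bullet> (y - x) - e / 2 * norm (y - x)) \<le> g y"
        by (meson half_gt_zero)
      have "g x + ereal (v \<bullet> (y - x) - e * norm (y - x)) < g y"
        if "y \<in> S" "y \<noteq> x" "dist y x < d" for y
      proof -
        have "e / 2 * norm (y - x) < e * norm (y - x)"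
          using that \<open>0 < e\<close> by simp
        then have "g x + ereal (v \<bullet> (y - x) - e * norm (y - x))
            < g x + ereal (v \<bullet> (y - x) - e / 2 * norm (y - x))"
          by (simp add: gx)
        then show ?thesis
          using d that by (meson less_le_trans)
      qed
      with \<open>d > 0\<close> show "\<exists>d>0. \<forall>y\<in>S. y \<noteq> x \<and> dist y x < d \<longrightarrow>
          g x + ereal (v \<bullet> (y - x) - e * norm (y - x)) < g y"
        by blast
    qed
  qed
  finally show ?thesis
    using x by (auto simp: frechet_subdiff_def edom_def)
qed

lemma frechet_subset_limiting: "frechet_subdiff S g x \<subseteq> limiting_subdiff S g x"
proof
  fix v assume v: "v \<in> frechet_subdiff S g x"
  then have "x \<in> edom S g"
    by (auto simp: frechet_subdiff_def split: if_splits)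
  moreover have "(\<forall>n::nat. x \<in> S \<and> v \<in> frechet_subdiff S g x) \<and>
      (\<lambda>_::nat. x) \<longlonglongrightarrow> x \<and> (\<lambda>_::nat. g x) \<longlonglongrightarrow> g x \<and> (\<lambda>_::nat. v) \<longlonglongrightarrow> v"
    using v \<open>x \<in> edom S g\<close> by (auto simp: edom_def)
  ultimately show "v \<in> limiting_subdiff S g x"
    unfolding limiting_subdiff_def by fastforce
qed

text \<open>Fermat rule for \<open>g + h\<close>: minimality bounds \<open>g y - g u\<close> below
  by \<open>h u - h y\<close>, which is \<open>- w \<bullet> (y - u)\<close> up to a first-order
  remainder.\<close>

lemma frechet_subdiff_minimizer:
  fixes g :: "'a::real_inner \<Rightarrow> ereal"
  assumes S: "subspace S" and u: "u \<in> S" "g u \<noteq> \<infinity>" and g: "\<And>y. y \<in> S \<Longrightarrow> g y \<noteq> -\<infinity>"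
    and h: "(h has_derivative (\<lambda>d. w \<bullet> d)) (at u within S)" and w: "w \<in> S"
    and min: "\<And>y. y \<in> S \<Longrightarrow> g u + ereal (h u) \<le> g y + ereal (h y)"
  shows "- w \<in> frechet_subdiff S g u"
proof -
  have "\<exists>d>0. \<forall>y\<in>S. dist y u < d \<longrightarrow> g u + ereal (- w \<bullet> (y - u) - e * norm (y - u)) \<le> g y"
    if "e > 0" for e
  proof -
    obtain d where "d > 0" and
      d: "\<forall>y\<in>S. norm (y - u) < d \<longrightarrow> norm (h y - h u - w \<bullet> (y - u)) \<le> e * norm (y - u)"
      using h \<open>e > 0\<close> by (auto simp: has_derivative_within_alt)
    have "g u + ereal (- w \<bullet> (y - u) - e * norm (y - u)) \<le> g y" if y: "y \<in> S" "dist y u < d" for y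
    proof -
      have "\<bar>h y - h u - w \<bullet> (y - u)\<bar> \<le> e * norm (y - u)"
        using d y by (auto simp: dist_norm)
      then have le: "- w \<bullet> (y - u) - e * norm (y - u) \<le> h u - h y"
        by simp
      show ?thesis
        using min[OF y(1)] g[OF y(1)] g[OF u(1)] u(2) le
        by (cases "g y"; cases "g u") auto
    qed
    with \<open>d > 0\<close> show ?thesis by blast
  qed
  then show ?thesis
    using w S by (subst frechet_subdiff_iff[of u S g, OF u g]) (auto simp: subspace_neg)
qed

lemma sum_ereal_not_MInf:
  fixes c :: "'i \<Rightarrow> ereal"
  assumes "\<And>i. i \<in> I \<Longrightarrow> c i \<noteq> -\<infinity>"
  shows "sum c I \<noteq> -\<infinity>"
  using assms by (induction I rule: infinite_finite_induct) (auto simp: ereal_plus_eq_MInfty)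

subsection \<open>Products\<close>

lemma subspace_prod_space:
  assumes "\<And>i. subspace (V i)"
  shows "subspace (prod_space V)"
  using assms by (auto simp: subspace_def prod_space_def)

lemma block_update_nth: "block_update x i u $ l = (if l = i then u else x $ l)"
  by (simp add: block_update_def)

lemma block_update_self [simp]: "block_update x i (x $ i) = x"
  by (simp add: vec_eq_iff block_update_nth)

lemma block_update_in_prod_space:
  assumes "x \<in> prod_space V" "u \<in> V i"
  shows "block_update x i u \<in> prod_space V"
  using assms by (auto simp: prod_space_def block_update_nth)

text \<open>Makes an update a translation along one block, so that norms, inner products and
  derivatives reduce to \<open>axis\<close>.\<close>

lemma block_update_eq:
  fixes u w :: "'b::euclidean_space"
  shows "block_update x i u = block_update x i w + axis i (u - w)"
  by (auto simp: vec_eq_iff block_update_nth axis_def)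

lemma norm_axis: "norm (axis i u) = norm (u :: 'b::euclidean_space)"
  by (simp add: norm_eq_sqrt_inner inner_axis)

lemma norm_block_update_diff:
  "norm (block_update x i u - block_update x i w) = norm (u - w :: 'b::euclidean_space)"
  by (subst block_update_eq[of x i u w]) (simp add: norm_axis)

text \<open>Pythagoras, comparing both vectors with the one whose block \<open>i\<close> is zero.
  Applied to the vector of last moves, it trades the old move of a block for the new one.\<close>

lemma norm_block_update_sq:
  fixes x :: "'b::euclidean_space ^ 's::finite"
  shows "(norm (block_update x i u))\<^sup>2 = (norm x)\<^sup>2 - (norm (x $ i))\<^sup>2 + (norm u)\<^sup>2"
proof -
  have *: "(norm (block_update x i v))\<^sup>2 = (norm (block_update x i 0))\<^sup>2 + (norm v)\<^sup>2" for v
    unfolding block_update_eq[of x i v 0]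
    by (simp add: power2_norm_eq_inner inner_add_left inner_add_right inner_axis inner_axis' block_update_nth)
  show ?thesis
    using *[of u] *[of "x $ i"] by simp
qed

lemma norm_block_update_le:
  fixes x :: "'b::euclidean_space ^ 's::finite"
  shows "norm (block_update x i u) \<le> norm x + norm u"
proof (rule power2_le_imp_le)
  have "(norm (block_update x i u))\<^sup>2 \<le> (norm x)\<^sup>2 + (norm u)\<^sup>2"
    by (simp add: norm_block_update_sq)
  also have "\<dots> \<le> (norm x + norm u)\<^sup>2"
    by (simp add: power2_sum)
  finally show "(norm (block_update x i u))\<^sup>2 \<le> (norm x + norm u)\<^sup>2" .
qed simp

lemma has_derivative_block_fun:
  fixes f :: "'b::euclidean_space ^ 's::finite \<Rightarrow> real"
  assumes x: "x \<in> prod_space V" and u: "u \<in> V i"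
    and f: "(f has_derivative (\<lambda>h. g \<bullet> h)) (at (block_update x i u) within prod_space V)"
  shows "(block_fun f x i has_derivative (\<lambda>h. g $ i \<bullet> h)) (at u within V i)"
proof -
  have eq: "block_update x i = (\<lambda>w. block_update x i 0 + axis i w)"
    by (rule ext) (subst block_update_eq[of x i _ 0], simp)
  have "bounded_linear (axis i :: 'b \<Rightarrow> 'b ^ 's)"
    by (rule linear_conv_bounded_linear[THEN iffD1], rule linearI) (auto simp: vec_eq_iff axis_def)
  then have "((\<lambda>w. block_update x i 0 + axis i w) has_derivative axis i) (at u within V i)"
    using has_derivative_add[OF has_derivative_const bounded_linear_imp_has_derivative] by simp
  then have "(block_update x i has_derivative axis i) (at u within V i)"
    by (subst eq)
  moreover have "(f has_derivative (\<lambda>h. g \<bullet> h)) (at (block_update x i u) within block_update x i ` V i)"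
    by (rule has_derivative_subset[OF f]) (use x in \<open>auto intro: block_update_in_prod_space\<close>)
  ultimately have "((\<lambda>w. f (block_update x i w)) has_derivative (\<lambda>h. g \<bullet> axis i h)) (at u within V i)"
    by (rule has_derivative_in_compose)
  then show ?thesis
    by (simp add: block_fun_def[abs_def] inner_axis)
qed

text \<open>The sum rule for a differentiable function plus a separable one. The blocks are
  independent variables, so their first-order lower bounds simply add up, with each remainder
  controlled by \<open>norm (y - x)\<close>.\<close>

lemma frechet_subdiff_objective:
  fixes f :: "'b::euclidean_space ^ 's::finite \<Rightarrow> real"
  assumes V: "\<And>i. subspace (V i)" and r: "\<And>i u. u \<in> V i \<Longrightarrow> r i u \<noteq> -\<infinity>"
    and x: "x \<in> prod_space V" and f: "(f has_derivative (\<lambda>h. g \<bullet> h)) (at x within prod_space V)"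
    and g: "g \<in> prod_space V" and \<xi>: "\<And>i. \<xi> $ i \<in> frechet_subdiff (V i) (r i) (x $ i)"
  shows "g + \<xi> \<in> frechet_subdiff (prod_space V) (objective f r) x"
proof -
  have xi: "x $ i \<in> V i" for i
    using x by (simp add: prod_space_def)
  have fin: "r i (x $ i) \<noteq> \<infinity>" for i
    using \<xi>[of i] by (auto simp: frechet_subdiff_def edom_def split: if_splits)
  have obj: "objective f r y \<noteq> -\<infinity>" if "y \<in> prod_space V" for y
    using that r sum_ereal_not_MInf[of UNIV "\<lambda>i. r i (y $ i)"]
    by (auto simp: objective_def prod_space_def)
  have ox: "objective f r x \<noteq> \<infinity>"
    using fin by (simp add: objective_def sum_Pinfty)
  define rx where "rx = (\<lambda>i. real_of_ereal (r i (x $ i)))"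
  have rx: "r i (x $ i) = ereal (rx i)" for i
    using fin[of i] r[OF xi] by (auto simp: rx_def ereal_real)
  have \<xi>': "\<forall>e>0. \<exists>d>0. \<forall>u\<in>V i. dist u (x $ i) < d \<longrightarrow>
      r i (x $ i) + ereal (\<xi> $ i \<bullet> (u - x $ i) - e * norm (u - x $ i)) \<le> r i u" for i
    using \<xi>[of i] by (subst (asm) frechet_subdiff_iff[of "x $ i" "V i" "r i", OF xi fin r]) auto
  have \<xi>V: "\<xi> $ i \<in> V i" for i
    using \<xi>[of i] by (subst (asm) frechet_subdiff_iff[of "x $ i" "V i" "r i", OF xi fin r]) auto
  have "\<exists>d>0. \<forall>y\<in>prod_space V. dist y x < d \<longrightarrow>
      objective f r x + ereal ((g + \<xi>) \<bullet> (y - x) - e * norm (y - x)) \<le> objective f r y"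
    if e: "e > 0" for e
  proof -
    \<comment> \<open>One share of the tolerance for \<open>f\<close> and one for each
      block.\<close>
    define e' where "e' = e / (1 + real CARD('s))"
    have e': "e' > 0"
      using e by (auto simp: e'_def intro!: divide_pos_pos)
    obtain d0 where d0: "d0 > 0" "\<forall>y\<in>prod_space V. norm (y - x) < d0 \<longrightarrow>
        norm (f y - f x - g \<bullet> (y - x)) \<le> e' * norm (y - x)"
      using f e' by (auto simp: has_derivative_within_alt)
    have "\<forall>i. \<exists>d>0. \<forall>u\<in>V i. dist u (x $ i) < d \<longrightarrow>
        r i (x $ i) + ereal (\<xi> $ i \<bullet> (u - x $ i) - e' * norm (u - x $ i)) \<le> r i u"
      using \<xi>' e' by blast
    from choice[OF this] obtain d where d: "\<And>i. d i > 0" "\<And>i u. u \<in> V i \<Longrightarrow> dist u (x $ i) < d i \<Longrightarrow>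
        r i (x $ i) + ereal (\<xi> $ i \<bullet> (u - x $ i) - e' * norm (u - x $ i)) \<le> r i u"
      by blast
    define d1 where "d1 = min d0 (Min (range d))"
    have "d1 > 0"
      using d0 d by (auto simp: d1_def)
    moreover have "objective f r x + ereal ((g + \<xi>) \<bullet> (y - x) - e * norm (y - x)) \<le> objective f r y"
      if y: "y \<in> prod_space V" "dist y x < d1" for y
    proof -
      have "dist (y $ i) (x $ i) < d i" for i
      proof -
        have "dist (y $ i) (x $ i) \<le> dist y x"
          by (rule dist_vec_nth_le)
        also have "\<dots> < Min (range d)"
          using y by (simp add: d1_def)
        also have "\<dots> \<le> d i"
          by (rule Min_le) auto
        finally show ?thesis .
      qed
      then have "r i (x $ i) + ereal (\<xi> $ i \<bullet> (y $ i - x $ i) - e' * norm (y $ i - x $ i)) \<le> r i (y $ i)" for i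
        using y by (intro d) (auto simp: prod_space_def)
      moreover have "e' * norm (y $ i - x $ i) \<le> e' * norm (y - x)" for i
        using e' Finite_Cartesian_Product.norm_nth_le[of "y - x" i] by simp
      then have "ereal (rx i + \<xi> $ i \<bullet> (y $ i - x $ i) - e' * norm (y - x)) \<le>
          r i (x $ i) + ereal (\<xi> $ i \<bullet> (y $ i - x $ i) - e' * norm (y $ i - x $ i))" for i
        by (simp add: rx algebra_simps)
      ultimately have ri: "ereal (rx i + \<xi> $ i \<bullet> (y $ i - x $ i) - e' * norm (y - x)) \<le> r i (y $ i)" for i
        by (meson order_trans)
      have "norm (y - x) < d0"
        using y by (simp add: d1_def dist_norm)
      then have fy: "f x + g \<bullet> (y - x) - e' * norm (y - x) \<le> f y"
        using d0 y by force
      have "objective f r x + ereal ((g + \<xi>) \<bullet> (y - x) - e * norm (y - x)) =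
          ereal (f x + (\<Sum>i\<in>UNIV. rx i) + (g + \<xi>) \<bullet> (y - x) - (e' * norm (y - x) + real CARD('s) * (e' * norm (y - x))))"
      proof -
        have "e = e' + real CARD('s) * e'"
          by (simp add: e'_def field_simps add_nonneg_eq_0_iff)
        then have "e * norm (y - x) = e' * norm (y - x) + real CARD('s) * (e' * norm (y - x))"
          by (metis distrib_right mult.assoc)
        then show ?thesis
          by (simp add: objective_def rx algebra_simps)
      qed
      also have "\<dots> = ereal (f x + g \<bullet> (y - x) - e' * norm (y - x)) +
          (\<Sum>i\<in>UNIV. ereal (rx i + \<xi> $ i \<bullet> (y $ i - x $ i) - e' * norm (y - x)))"
        by (simp add: inner_add_left inner_vec_def[of \<xi>] sum.distrib sum_subtractf algebra_simps)
      also have "\<dots> \<le> objective f r y"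
        unfolding objective_def by (intro add_mono sum_mono) (use fy ri in auto)
      finally show ?thesis .
    qed
    ultimately show ?thesis by blast
  qed
  moreover have "g + \<xi> \<in> prod_space V"
    using g \<xi>V V by (auto simp: prod_space_def subspace_add)
  ultimately show ?thesis
    by (subst frechet_subdiff_iff[of x "prod_space V" "objective f r", OF x ox obj]) auto
qed

subsection \<open>Convergence of descent sequences of KL functions\<close>

lemma lsc_on_sequentially:
  fixes g :: "'a::metric_space \<Rightarrow> ereal"
  assumes "lsc_on S g" "x \<in> S" "\<And>n. X n \<in> S" "X \<longlonglongrightarrow> x"
  shows "g x \<le> liminf (\<lambda>n. g (X n))"
  unfolding le_Liminf_iff
proof (intro allI impI)
  fix c assume c: "c < g x"
  then have "c < Liminf (at x within S) g"
    using assms(1,2) by (auto simp: lsc_on_def intro: less_le_trans)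
  then have "\<forall>\<^sub>F y in at x within S. c < g y"
    by (rule less_LiminfD)
  then obtain d where d: "d > 0" "\<And>y. y \<in> S \<Longrightarrow> y \<noteq> x \<Longrightarrow> dist y x < d \<Longrightarrow> c < g y"
    by (auto simp: eventually_at)
  have "\<forall>\<^sub>F n in sequentially. dist (X n) x < d"
    using assms(4) d(1) by (rule tendstoD)
  \<comment> \<open>The sequence may hit \<open>x\<close>, which the punctured limit ignores; there
    \<open>c < g x\<close> is used instead.\<close>
  then show "\<forall>\<^sub>F n in sequentially. c < g (X n)"
    by (rule eventually_mono) (use c d assms(3) in metis)
qed

text \<open>Extracts what the length argument needs from the KL property: a finite
  \<open>\<eta>\<close>, the tangent inequality in place of concavity, and an inequality for every
  single subgradient in place of the distance.\<close>

lemma KL_desingularizer: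
  fixes g :: "'a::real_inner \<Rightarrow> ereal"
  assumes KL: "KL_property_at S g z" and gz: "g z = ereal l"
  obtains \<epsilon> \<eta> :: real and \<xi> \<xi>' :: "real \<Rightarrow> real" where
    "0 < \<epsilon>" "0 < \<eta>" "\<xi> 0 = 0" "\<And>t. 0 \<le> t \<Longrightarrow> t < \<eta> \<Longrightarrow> 0 \<le> \<xi> t"
    "\<And>u. (\<And>n::nat. 0 \<le> u n) \<Longrightarrow> u \<longlonglongrightarrow> 0 \<Longrightarrow> (\<lambda>n. \<xi> (u n)) \<longlonglongrightarrow> 0"
    "\<And>t. 0 < t \<Longrightarrow> t < \<eta> \<Longrightarrow> 0 < \<xi>' t"
    "\<And>s t. 0 < s \<Longrightarrow> s < \<eta> \<Longrightarrow> 0 \<le> t \<Longrightarrow> t < \<eta> \<Longrightarrow> \<xi> t \<le> \<xi> s + \<xi>' s * (t - s)"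
    "\<And>x t v. x \<in> S \<Longrightarrow> dist x z < \<epsilon> \<Longrightarrow> g x = ereal (l + t) \<Longrightarrow> 0 < t \<Longrightarrow> t < \<eta> \<Longrightarrow>
      v \<in> limiting_subdiff S g x \<Longrightarrow> 1 \<le> \<xi>' t * norm v"
proof -
  obtain h :: ereal and U \<xi> \<xi>' where h: "0 < h" "open U" "z \<in> U"
    and conc: "concave_on {t. 0 \<le> t \<and> ereal t < h} \<xi>"
    and nonneg: "\<And>t. 0 \<le> t \<Longrightarrow> ereal t < h \<Longrightarrow> 0 \<le> \<xi> t"
    and \<xi>0: "\<xi> 0 = 0" "continuous (at_right 0) \<xi>"
    and der: "\<And>t. 0 < t \<Longrightarrow> ereal t < h \<Longrightarrow> (\<xi> has_real_derivative \<xi>' t) (at t) \<and> 0 < \<xi>' t"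
    and ineq: "\<And>x. x \<in> U \<inter> S \<Longrightarrow> g z < g x \<Longrightarrow> g x < g z + h \<Longrightarrow>
        1 \<le> ereal (\<xi>' (real_of_ereal (g x - g z))) * subdiff_dist S g x"
    using KL unfolding KL_property_at_def by blast
  obtain \<epsilon> where \<epsilon>: "\<epsilon> > 0" "ball z \<epsilon> \<subseteq> U"
    using h by (meson open_contains_ball)
  obtain \<eta> :: real where \<eta>: "0 < \<eta>" "ereal \<eta> < h"
    using ereal_dense2[OF h(1)] by (auto simp: zero_ereal_def)
  have lt: "ereal t < h" if "t < \<eta>" for t
    using that \<eta>(2) by (meson ereal_less_eq(3) le_less_trans less_imp_le)
  have conv: "convex_on {0..<\<eta>} (\<lambda>t. - \<xi> t)"
    using conc unfolding concave_on_def by (rule convex_on_subset) (auto simp: lt)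
  show thesis
  proof
    show "0 \<le> \<xi> t" if "0 \<le> t" "t < \<eta>" for t
      using that nonneg lt by auto
    show "0 < \<xi>' t" if "0 < t" "t < \<eta>" for t
      using that der lt by auto
    show "(\<lambda>n. \<xi> (u n)) \<longlonglongrightarrow> 0" if u: "\<And>n::nat. 0 \<le> u n" "u \<longlonglongrightarrow> 0" for u
    proof -
      have "continuous (at 0 within {0..}) \<xi>"
        using \<xi>0(2) by (simp add: at_within_Ici_at_right)
      from continuous_within_tendsto_compose[OF this _ u(2)] u(1) show ?thesis
        by (auto simp: \<xi>0(1))
    qed
    show "\<xi> t \<le> \<xi> s + \<xi>' s * (t - s)" if st: "0 < s" "s < \<eta>" "0 \<le> t" "t < \<eta>" for s t
    proof -
      have "((\<lambda>t. - \<xi> t) has_real_derivative - \<xi>' s) (at s within {0..<\<eta>})"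
        using der[OF st(1) lt[OF st(2)]] by (metis DERIV_minus has_field_derivative_at_within)
      from convex_on_imp_above_tangent[OF conv _ _ _ this, of t] st
      have "(- \<xi> t) - (- \<xi> s) \<ge> - \<xi>' s * (t - s)"
        by (simp add: interior_atLeastLessThan)
      then show ?thesis
        by (simp add: algebra_simps)
    qed
    show "1 \<le> \<xi>' t * norm v" if "x \<in> S" "dist x z < \<epsilon>" "g x = ereal (l + t)" "0 < t" "t < \<eta>"
      "v \<in> limiting_subdiff S g x" for x t v
    proof -
      have pos: "0 < \<xi>' t"
        using der that lt by auto
      have "subdiff_dist S g x \<le> ereal (norm v)"
        unfolding subdiff_dist_def using that by (intro INF_lower)
      then have "ereal (\<xi>' t) * subdiff_dist S g x \<le> ereal (\<xi>' t) * ereal (norm v)"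
        using pos by (intro ereal_mult_left_mono) auto
      moreover have "1 \<le> ereal (\<xi>' (real_of_ereal (g x - g z))) * subdiff_dist S g x"
      proof (rule ineq)
        show "x \<in> U \<inter> S"
          using that \<epsilon> by (auto simp: dist_commute)
        show "g x < g z + h"
          using lt[OF \<open>t < \<eta>\<close>] by (cases h) (auto simp: that gz)
      qed (use that gz in auto)
      then have "1 \<le> ereal (\<xi>' t) * subdiff_dist S g x"
        by (simp add: that gz)
      ultimately have "1 \<le> ereal (\<xi>' t) * ereal (norm v)"
        by (rule order_trans[rotated])
      then have "ereal 1 \<le> ereal (\<xi>' t * norm v)"
        by (simp only: one_ereal_def times_ereal.simps)
      then show ?thesis
        by simp
    qed
  qed (use \<epsilon> \<eta> \<xi>0 in auto)
qed

text \<open>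
  A desingularizing function \<open>\<xi>\<close> of \<open>g\<close> at \<open>z\<close> yields one for sums of \<open>g\<close> and a quadratic
  remainder \<open>q\<close>, namely \<open>\<psi> t = 2 \<xi> (t/2) + 2 sqrt t\<close>: if \<open>g x - g z + q = t\<close>, then
  one of the two summands is at least \<open>t/2\<close>.
\<close>

lemma KL_desingularizer_remainder:
  fixes g :: "'a::real_inner \<Rightarrow> ereal"
  assumes KL: "KL_property_at S g z" and gz: "g z = ereal l"
  obtains \<epsilon> \<eta> :: real and \<psi> \<psi>' :: "real \<Rightarrow> real" where
    "0 < \<epsilon>" "0 < \<eta>" "\<And>t. 0 \<le> t \<Longrightarrow> t < \<eta> \<Longrightarrow> 0 \<le> \<psi> t"
    "\<And>u. (\<And>n::nat. 0 \<le> u n) \<Longrightarrow> u \<longlonglongrightarrow> 0 \<Longrightarrow> (\<lambda>n. \<psi> (u n)) \<longlonglongrightarrow> 0"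
    "\<And>t. 0 < t \<Longrightarrow> t < \<eta> \<Longrightarrow> 0 < \<psi>' t"
    "\<And>s t. 0 < s \<Longrightarrow> s < \<eta> \<Longrightarrow> 0 \<le> t \<Longrightarrow> t \<le> s \<Longrightarrow> \<psi>' s * (s - t) \<le> \<psi> s - \<psi> t"
    "\<And>x t q v. x \<in> S \<Longrightarrow> dist x z < \<epsilon> \<Longrightarrow> g x = ereal (l + t) \<Longrightarrow> 0 \<le> q \<Longrightarrow> 0 < t + q \<Longrightarrow>
      t + q < \<eta> \<Longrightarrow> v \<in> limiting_subdiff S g x \<Longrightarrow> 1 \<le> \<psi>' (t + q) * (norm v + sqrt (2 * q))"
proof -
  from KL_desingularizer[OF assms] obtain \<epsilon> \<eta> :: real and \<xi> \<xi>' :: "real \<Rightarrow> real" where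
    \<epsilon>: "0 < \<epsilon>" "0 < \<eta>" and \<xi>0: "\<xi> 0 = 0" and nonneg: "\<And>t. 0 \<le> t \<Longrightarrow> t < \<eta> \<Longrightarrow> 0 \<le> \<xi> t" and
    lim: "\<And>u. (\<And>n::nat. 0 \<le> u n) \<Longrightarrow> u \<longlonglongrightarrow> 0 \<Longrightarrow> (\<lambda>n. \<xi> (u n)) \<longlonglongrightarrow> 0" and
    pos: "\<And>t. 0 < t \<Longrightarrow> t < \<eta> \<Longrightarrow> 0 < \<xi>' t" and
    tang: "\<And>s t. 0 < s \<Longrightarrow> s < \<eta> \<Longrightarrow> 0 \<le> t \<Longrightarrow> t < \<eta> \<Longrightarrow> \<xi> t \<le> \<xi> s + \<xi>' s * (t - s)" and
    KL: "\<And>x t v. x \<in> S \<Longrightarrow> dist x z < \<epsilon> \<Longrightarrow> g x = ereal (l + t) \<Longrightarrow> 0 < t \<Longrightarrow> t < \<eta> \<Longrightarrow>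
      v \<in> limiting_subdiff S g x \<Longrightarrow> 1 \<le> \<xi>' t * norm v"
    by blast
  \<comment> \<open>Two tangent inequalities added. The monotonicity is needed because the KL
    inequality speaks of \<open>\<xi>'\<close> at \<open>t\<close>, whereas \<open>\<psi>'\<close>
    evaluates it at \<open>(t + q) / 2\<close>.\<close>
  have anti: "\<xi>' s \<ge> \<xi>' t" if "0 < s" "s \<le> t" "t < \<eta>" for s t
  proof (cases "s = t")
    case False
    have "\<xi> t \<le> \<xi> s + \<xi>' s * (t - s)" "\<xi> s \<le> \<xi> t + \<xi>' t * (s - t)"
      using that by (auto intro: tang)
    then have "0 \<le> (\<xi>' s - \<xi>' t) * (t - s)"
      by (simp add: algebra_simps)
    then show ?thesis
      using that False by (simp add: zero_le_mult_iff)
  qed auto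
  define \<psi> where "\<psi> = (\<lambda>t. 2 * \<xi> (t / 2) + 2 * sqrt t)"
  define \<psi>' where "\<psi>' = (\<lambda>t. \<xi>' (t / 2) + 1 / sqrt t)"
  show thesis
  proof
    show "0 < \<epsilon>" "0 < \<eta>" by (fact \<epsilon>)+
    show "0 \<le> \<psi> t" if "0 \<le> t" "t < \<eta>" for t
      using that nonneg[of "t / 2"] by (simp add: \<psi>_def)
    show pos': "0 < \<psi>' t" if "0 < t" "t < \<eta>" for t
      using that pos[of "t / 2"] by (simp add: \<psi>'_def add_pos_nonneg)
    show "(\<lambda>n. \<psi> (u n)) \<longlonglongrightarrow> 0" if u: "\<And>n::nat. 0 \<le> u n" "u \<longlonglongrightarrow> 0" for u
    proof -
      have "(\<lambda>n. \<xi> (u n / 2)) \<longlonglongrightarrow> 0"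
        using u by (intro lim) (auto intro: tendsto_eq_intros)
      moreover have "(\<lambda>n. sqrt (u n)) \<longlonglongrightarrow> 0"
        using tendsto_real_sqrt[OF u(2)] by simp
      ultimately have "(\<lambda>n. 2 * \<xi> (u n / 2) + 2 * sqrt (u n)) \<longlonglongrightarrow> 2 * 0 + 2 * 0"
        by (intro tendsto_intros)
      then show ?thesis
        by (simp add: \<psi>_def)
    qed
    show "\<psi>' s * (s - t) \<le> \<psi> s - \<psi> t" if st: "0 < s" "s < \<eta>" "0 \<le> t" "t \<le> s" for s t
    proof -
      have "\<xi> (t / 2) \<le> \<xi> (s / 2) + \<xi>' (s / 2) * (t / 2 - s / 2)"
        using st by (intro tang) auto
      moreover have "(1 / sqrt s) * (s - t) \<le> 2 * sqrt s - 2 * sqrt t"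
      proof -
        have "s - t = (sqrt s - sqrt t) * (sqrt s + sqrt t)"
          using st by (simp add: algebra_simps)
        also have "\<dots> \<le> (sqrt s - sqrt t) * (2 * sqrt s)"
          using st by (intro mult_left_mono) auto
        finally show ?thesis
          using st by (simp add: field_simps)
      qed
      ultimately show ?thesis
        unfolding \<psi>_def \<psi>'_def by (simp add: algebra_simps diff_divide_distrib)
    qed
    show "1 \<le> \<psi>' (t + q) * (norm v + sqrt (2 * q))"
      if *: "x \<in> S" "dist x z < \<epsilon>" "g x = ereal (l + t)" "0 \<le> q" "0 < t + q" "t + q < \<eta>"
        "v \<in> limiting_subdiff S g x" for x t q v
    proof (cases "q \<ge> (t + q) / 2")
      \<comment> \<open>Here \<open>t\<close> may be negative, as \<open>g\<close> itself can lie
        below \<open>l\<close> while the sum with \<open>q\<close> lies above. The square root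
        summand of \<open>\<psi>\<close> alone gives the bound.\<close>
      case True
      have "1 = (1 / sqrt (t + q)) * sqrt (t + q)"
        using * by simp
      also have "\<dots> \<le> \<psi>' (t + q) * (norm v + sqrt (2 * q))"
      proof (rule mult_mono)
        show "1 / sqrt (t + q) \<le> \<psi>' (t + q)"
          using pos[of "(t + q) / 2"] * by (simp add: \<psi>'_def)
        have "sqrt (t + q) \<le> sqrt (2 * q)"
          using True by simp
        then show "sqrt (t + q) \<le> norm v + sqrt (2 * q)"
          by (simp add: add_increasing)
      qed (use pos'[of "t + q"] * in auto)
      finally show ?thesis .
    next
      case False
      have "1 \<le> \<xi>' t * norm v"
        using * False by (intro KL) auto
      also have "\<dots> \<le> \<psi>' (t + q) * (norm v + sqrt (2 * q))"
      proof (rule mult_mono)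
        have "\<xi>' t \<le> \<xi>' ((t + q) / 2)"
          using * False by (intro anti) auto
        then show "\<xi>' t \<le> \<psi>' (t + q)"
          using * by (simp add: \<psi>'_def add_increasing2)
      qed (use pos'[of "t + q"] * in auto)
      finally show ?thesis .
    qed
  qed
qed

text \<open>Each shifted sum on the right exceeds the sum on the left by boundary terms at most. The
  two weights add up to 1/2, so half of the sum is absorbed; the terms in \<open>b\<close>
  telescope.\<close>

lemma sum_le_of_quarter_recursion:
  fixes s b :: "nat \<Rightarrow> real"
  assumes s: "\<And>j. 0 \<le> s j" and b: "0 \<le> b n"
    and rec: "\<And>j. j < n \<Longrightarrow> s (Suc (Suc j)) \<le> (s (Suc j) + s j) / 4 + (b j - b (Suc j))"
  shows "(\<Sum>j<n. s (Suc (Suc j))) \<le> s 0 + s 1 + 2 * b 0"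
proof -
  let ?P = "\<Sum>j<n. s (Suc (Suc j))"
  have 1: "(\<Sum>j<n. s (Suc j)) \<le> s 1 + ?P"
    using sum.lessThan_Suc_shift[of "\<lambda>j. s (Suc j)" n] s[of "Suc n"] by simp
  have 2: "(\<Sum>j<n. s j) \<le> s 0 + (\<Sum>j<n. s (Suc j))"
    using sum.lessThan_Suc_shift[of s n] s[of n] by simp
  have "?P \<le> (\<Sum>j<n. (s (Suc j) + s j) / 4 + (b j - b (Suc j)))"
    using rec by (intro sum_mono) auto
  also have "\<dots> = ((\<Sum>j<n. s (Suc j)) + (\<Sum>j<n. s j)) / 4 + (b 0 - b n)"
    by (simp add: sum.distrib sum_divide_distrib sum_lessThan_telescope' add_divide_distrib)
  finally have 3: "?P \<le> ((\<Sum>j<n. s (Suc j)) + (\<Sum>j<n. s j)) / 4 + (b 0 - b n)" .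
  have "P \<le> s0 + s1 + 2 * b0" if "P \<le> (A1 + A0) / 4 + (b0 - bn)" "A1 \<le> s1 + P" "A0 \<le> s0 + A1"
    "0 \<le> bn" "0 \<le> s0" "0 \<le> s1" for P A0 A1 b0 bn s0 s1 :: real
  proof -
    have "4 * P \<le> A1 + A0 + 4 * b0 - 4 * bn"
      using that(1) by argo
    then show ?thesis
      using that(2-) by argo
  qed
  from this[OF 3 1 2 b s s] show ?thesis .
qed

text \<open>The block structure is forgotten here: \<open>X\<close> stands for the outer iterates,
  \<open>S\<close> for the loop lengths and \<open>Q\<close> for the quadratic part of the Lyapunov
  function.\<close>

locale descent_sequence =
  fixes E :: "'a::euclidean_space set" and F :: "'a \<Rightarrow> ereal" and X :: "nat \<Rightarrow> 'a"
    and S Q :: "nat \<Rightarrow> real" and c R :: real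
  assumes closed: "closed E" and lsc: "lsc_on E F" and not_MInf: "\<And>y. y \<in> E \<Longrightarrow> F y \<noteq> -\<infinity>"
    and X: "\<And>k. X k \<in> E" "\<And>k. norm (X k) \<le> R" "\<And>k. F (X k) < \<infinity>"
    and S: "\<And>k. 0 \<le> S k"
    and Q: "\<And>k. 0 \<le> Q k"
    and c: "0 < c"
    and descent: "\<And>k. F (X (Suc k)) + ereal (Q (Suc k) + c * (S (Suc k))\<^sup>2) \<le> F (X k) + ereal (Q k)"
begin

definition val :: "nat \<Rightarrow> real" where
  "val k = real_of_ereal (F (X k))"

lemma F_X: "F (X k) = ereal (val k)"
  using X(1)[of k] X(3)[of k] not_MInf[of "X k"] unfolding val_def by (cases "F (X k)") auto

lemma val_descent: "val (Suc k) + Q (Suc k) + c * (S (Suc k))\<^sup>2 \<le> val k + Q k"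
  using descent[of k] by (simp add: F_X)

text \<open>The shifted index is kept because the bounds at \<open>X (Suc k)\<close> involve both
  \<open>S (Suc k)\<close> and \<open>S k\<close>.\<close>

lemma cluster_point:
  obtains z \<rho> where "z \<in> E" "norm z \<le> R" "strict_mono \<rho>" "(\<lambda>n. X (Suc (\<rho> n))) \<longlonglongrightarrow> z"
proof -
  have "compact (E \<inter> cball 0 R)"
    using closed by (simp add: closed_Int_compact)
  moreover have "\<forall>n. X (Suc n) \<in> E \<inter> cball 0 R"
    using X by auto
  ultimately obtain z \<rho> where "z \<in> E \<inter> cball 0 R" "strict_mono \<rho>" "((\<lambda>n. X (Suc n)) \<circ> \<rho>) \<longlonglongrightarrow> z"
    using seq_compactE[of "E \<inter> cball 0 R" "\<lambda>n. X (Suc n)"] by (auto simp: compact_eq_seq_compact_metric)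
  then show thesis
    by (intro that[of z \<rho>]) (auto simp: o_def)
qed

text \<open>If the decreasing values were unbounded below, \<open>F\<close> would tend to
  \<open>-\<infinity>\<close> along a convergent subsequence, since \<open>Q\<close> is nonnegative.
  Lower semicontinuity and \<open>not_MInf\<close> at the cluster point exclude this.\<close>

lemma limits:
  obtains l where "(\<lambda>k. val k + Q k) \<longlonglongrightarrow> l" "\<And>k. l \<le> val k + Q k" "S \<longlonglongrightarrow> 0"
proof -
  let ?G = "\<lambda>k. val k + Q k"
  have dec: "decseq ?G"
  proof (rule decseq_SucI)
    show "?G (Suc k) \<le> ?G k" for k
      using val_descent[of k] c by (smt (verit) mult_nonneg_nonneg zero_le_power2)
  qed
  have "\<exists>b. \<forall>k. b \<le> ?G k"
  proof (rule ccontr)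
    assume nb: "\<not> (\<exists>b. \<forall>k. b \<le> ?G k)"
    obtain z \<rho> where z: "z \<in> E" "strict_mono \<rho>" "(\<lambda>n. X (Suc (\<rho> n))) \<longlonglongrightarrow> z"
      by (metis cluster_point)
    obtain b where b: "ereal b < F z"
      using not_MInf[OF z(1)] by (metis ereal_MInfty_lessI ereal_dense2)
    from nb obtain k where k: "?G k < b"
      by (metis not_le)
    have "F z \<le> liminf (\<lambda>n. F (X (Suc (\<rho> n))))"
      using lsc z X by (intro lsc_on_sequentially) auto
    with b have "ereal b < liminf (\<lambda>n. F (X (Suc (\<rho> n))))"
      by simp
    then have "\<forall>\<^sub>F n in sequentially. ereal b < F (X (Suc (\<rho> n)))"
      by (rule less_LiminfD)
    moreover have "\<forall>\<^sub>F n in sequentially. k \<le> n"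
      by (rule eventually_ge_at_top)
    ultimately have "\<forall>\<^sub>F n::nat in sequentially. False"
    proof eventually_elim
      case (elim n)
      have "k \<le> Suc (\<rho> n)"
        using elim(2) seq_suble[OF z(2), of n] by simp
      then have "?G (Suc (\<rho> n)) \<le> ?G k"
        using dec by (auto simp: decseq_def)
      with elim(1) k Q[of "Suc (\<rho> n)"] show False
        by (simp add: F_X)
    qed
    then show False by simp
  qed
  then obtain b where "\<forall>k. b \<le> ?G k" ..
  then obtain l where l: "?G \<longlonglongrightarrow> l" "\<forall>k. l \<le> ?G k"
    using decseq_convergent[OF dec] by metis
  have "(\<lambda>k. (?G k - ?G (Suc k)) / c) \<longlonglongrightarrow> (l - l) / c"
    using c by (intro tendsto_intros l(1) LIMSEQ_Suc[OF l(1)]) auto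
  then have lim0: "(\<lambda>k. (?G k - ?G (Suc k)) / c) \<longlonglongrightarrow> 0"
    by simp
  have "(S (Suc k))\<^sup>2 \<le> (?G k - ?G (Suc k)) / c" for k
    using val_descent[of k] c by (simp add: pos_le_divide_eq mult.commute)
  then have "(\<lambda>k. (S (Suc k))\<^sup>2) \<longlonglongrightarrow> 0"
    by (intro tendsto_sandwich[OF _ _ tendsto_const lim0]) auto
  then have "(\<lambda>k. sqrt ((S (Suc k))\<^sup>2)) \<longlonglongrightarrow> sqrt 0"
    by (rule tendsto_real_sqrt)
  then have "S \<longlonglongrightarrow> 0"
    using S by (simp add: filterlim_sequentially_Suc)
  with l show thesis
    using that by blast
qed

theorem convergence:
  assumes KL: "KL_function E F"
    and steps: "\<And>k. dist (X (Suc k)) (X k) \<le> S (Suc k)"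
    and QS: "\<And>k. Q k \<le> D * (S k)\<^sup>2"
    and sub: "\<And>k. \<exists>v\<in>frechet_subdiff E F (X (Suc k)). norm v \<le> C * (S (Suc k) + S k)"
    and upper: "\<And>k w e. w \<in> E \<Longrightarrow> norm w \<le> R \<Longrightarrow> e = norm (w - X (Suc k)) + S (Suc k) + S k \<Longrightarrow>
      F (X (Suc k)) \<le> F w + ereal (C * (e + e\<^sup>2))"
  shows "\<exists>z. critical_point_II E F z \<and> X \<longlonglongrightarrow> z"
proof -
  let ?G = "\<lambda>k. val k + Q k"
  obtain l where G: "?G \<longlonglongrightarrow> l" and l: "\<And>k. l \<le> ?G k" and S0: "S \<longlonglongrightarrow> 0"
    by (metis limits)
  have "(\<lambda>k. D * (S k)\<^sup>2) \<longlonglongrightarrow> D * 0\<^sup>2"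
    by (intro tendsto_intros S0)
  then have "(\<lambda>k. D * (S k)\<^sup>2) \<longlonglongrightarrow> 0" by simp
  then have Q0: "Q \<longlonglongrightarrow> 0"
    using QS Q by (intro tendsto_sandwich[OF _ _ tendsto_const, of 0 Q]) auto
  have vall: "val \<longlonglongrightarrow> l"
    using tendsto_diff[OF G Q0] by simp
  obtain z \<rho> where z: "z \<in> E" "norm z \<le> R" and \<rho>: "strict_mono \<rho>" "(\<lambda>n. X (Suc (\<rho> n))) \<longlonglongrightarrow> z"
    by (metis cluster_point)
  have sub\<rho>: "(\<lambda>n. u (Suc (\<rho> n))) \<longlonglongrightarrow> a" "(\<lambda>n. u (\<rho> n)) \<longlonglongrightarrow> a"
    if "u \<longlonglongrightarrow> a" for u :: "nat \<Rightarrow> real" and a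
    using LIMSEQ_subseq_LIMSEQ[OF LIMSEQ_Suc[OF that] \<rho>(1)] LIMSEQ_subseq_LIMSEQ[OF that \<rho>(1)]
    by (simp_all add: o_def)
  \<comment> \<open>Lower semicontinuity gives one inequality and rules out an infinite value. For
    the other, \<open>upper\<close> is applied with \<open>w = z\<close>, where its error term tends
    to 0 along the subsequence.\<close>
  have Fz: "F z = ereal l"
  proof (rule antisym)
    have "F z \<le> liminf (\<lambda>n. F (X (Suc (\<rho> n))))"
      using lsc z X \<rho> by (intro lsc_on_sequentially) auto
    also have "(\<lambda>n. F (X (Suc (\<rho> n)))) \<longlonglongrightarrow> ereal l"
      using sub\<rho>(1)[OF vall] by (simp add: F_X)
    then have "liminf (\<lambda>n. F (X (Suc (\<rho> n)))) = ereal l"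
      by (rule lim_imp_Liminf[rotated]) simp
    finally show le: "F z \<le> ereal l" .
    then obtain b where b: "F z = ereal b"
      using not_MInf[OF z(1)] by (cases "F z") auto
    define e where "e = (\<lambda>n. norm (z - X (Suc (\<rho> n))) + S (Suc (\<rho> n)) + S (\<rho> n))"
    have "e \<longlonglongrightarrow> norm (z - z) + 0 + 0"
      unfolding e_def by (intro tendsto_intros \<rho> sub\<rho> S0)
    then have "e \<longlonglongrightarrow> 0" by simp
    then have "(\<lambda>n. b + C * (e n + (e n)\<^sup>2)) \<longlonglongrightarrow> b + C * (0 + 0\<^sup>2)"
      by (intro tendsto_intros)
    then have "(\<lambda>n. b + C * (e n + (e n)\<^sup>2)) \<longlonglongrightarrow> b" by simp
    moreover have "val (Suc (\<rho> n)) \<le> b + C * (e n + (e n)\<^sup>2)" for n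
      using upper[OF z, of "e n" "\<rho> n"] by (simp add: e_def F_X b)
    ultimately have "l \<le> b"
      by (intro LIMSEQ_le[OF sub\<rho>(1)[OF vall]]) auto
    then show "ereal l \<le> F z"
      by (simp add: b)
  qed
  obtain v where v: "\<And>k. v k \<in> frechet_subdiff E F (X (Suc k))" "\<And>k. norm (v k) \<le> C * (S (Suc k) + S k)"
    using sub by metis
  have crit: "0 \<in> limiting_subdiff E F z"
  proof -
    have "(\<lambda>n. C * (S (Suc (\<rho> n)) + S (\<rho> n))) \<longlonglongrightarrow> C * (0 + 0)"
      by (intro tendsto_intros sub\<rho> S0)
    then have "(\<lambda>n. v (\<rho> n)) \<longlonglongrightarrow> 0"
      using v(2) by (intro Lim_null_comparison[of "\<lambda>n. v (\<rho> n)" "\<lambda>n. C * (S (Suc (\<rho> n)) + S (\<rho> n))"]) auto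
    moreover have "(\<lambda>n. F (X (Suc (\<rho> n)))) \<longlonglongrightarrow> F z"
      using sub\<rho>(1)[OF vall] by (simp add: F_X Fz)
    ultimately have "(\<forall>n. X (Suc (\<rho> n)) \<in> E \<and> v (\<rho> n) \<in> frechet_subdiff E F (X (Suc (\<rho> n)))) \<and>
        (\<lambda>n. X (Suc (\<rho> n))) \<longlonglongrightarrow> z \<and> (\<lambda>n. F (X (Suc (\<rho> n)))) \<longlonglongrightarrow> F z \<and> (\<lambda>n. v (\<rho> n)) \<longlonglongrightarrow> 0"
      using \<rho> v(1) X(1) by blast
    then have "\<exists>Y W. (\<forall>n. Y n \<in> E \<and> W n \<in> frechet_subdiff E F (Y n)) \<and>
        Y \<longlonglongrightarrow> z \<and> (\<lambda>n. F (Y n)) \<longlonglongrightarrow> F z \<and> W \<longlonglongrightarrow> 0"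
      by (intro exI[of _ "\<lambda>n. X (Suc (\<rho> n))"] exI[of _ "\<lambda>n. v (\<rho> n)"])
    with z Fz show ?thesis
      by (simp add: limiting_subdiff_def edom_def)
  qed
  then have KLz: "KL_property_at E F z"
    using KL z by (auto simp: KL_function_def)
  from KL_desingularizer_remainder[OF KLz Fz]
  obtain \<epsilon> \<eta> :: real and \<psi> \<psi>' where \<epsilon>: "0 < \<epsilon>" "0 < \<eta>" and
    \<psi>: "\<And>t. 0 \<le> t \<Longrightarrow> t < \<eta> \<Longrightarrow> 0 \<le> \<psi> t"
      "\<And>u. (\<And>n::nat. 0 \<le> u n) \<Longrightarrow> u \<longlonglongrightarrow> 0 \<Longrightarrow> (\<lambda>n. \<psi> (u n)) \<longlonglongrightarrow> 0"
      "\<And>t. 0 < t \<Longrightarrow> t < \<eta> \<Longrightarrow> 0 < \<psi>' t"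
      "\<And>s t. 0 < s \<Longrightarrow> s < \<eta> \<Longrightarrow> 0 \<le> t \<Longrightarrow> t \<le> s \<Longrightarrow> \<psi>' s * (s - t) \<le> \<psi> s - \<psi> t" and
    KLi: "\<And>x t q v. x \<in> E \<Longrightarrow> dist x z < \<epsilon> \<Longrightarrow> F x = ereal (l + t) \<Longrightarrow> 0 \<le> q \<Longrightarrow> 0 < t + q \<Longrightarrow>
      t + q < \<eta> \<Longrightarrow> v \<in> limiting_subdiff E F x \<Longrightarrow> 1 \<le> \<psi>' (t + q) * (norm v + sqrt (2 * q))"
    by blast
  define a where "a = (\<lambda>k. ?G k - l)"
  have a_nonneg: "0 \<le> a k" for k
    using l[of k] by (simp add: a_def)
  have a_lim: "a \<longlonglongrightarrow> 0"
    using tendsto_diff[OF G tendsto_const[of l]] by (simp add: a_def)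
  have a_desc: "c * (S (Suc k))\<^sup>2 \<le> a k - a (Suc k)" for k
    using val_descent[of k] by (simp add: a_def)
  \<comment> \<open>The first summand stems from the bound on the subgradients, the second from the
    root of the remainder in \<open>KLi\<close>. The absolute values are there because no sign of
    \<open>C\<close> or \<open>D\<close> is assumed.\<close>
  define B where "B = \<bar>C\<bar> + sqrt (2 * \<bar>D\<bar>)"
  have B: "0 \<le> B"
    by (simp add: B_def)
  have key: "S (Suc (Suc k)) \<le> (S (Suc k) + S k) / 4 + (B / c * \<psi> (a (Suc k)) - B / c * \<psi> (a (Suc (Suc k))))"
    if near: "dist (X (Suc k)) z < \<epsilon>" and small: "a (Suc k) < \<eta>" for k
  proof (cases "a (Suc k) = 0")
    \<comment> \<open>The KL inequality says nothing once the Lyapunov value has reached its limit;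
      but then it stays there and the next length is 0.\<close>
    case True
    have "c * (S (Suc (Suc k)))\<^sup>2 \<le> - a (Suc (Suc k))"
      using a_desc[of "Suc k"] True by simp
    moreover have "0 \<le> c * (S (Suc (Suc k)))\<^sup>2"
      using c by simp
    ultimately have "a (Suc (Suc k)) = 0" "c * (S (Suc (Suc k)))\<^sup>2 = 0"
      using a_nonneg[of "Suc (Suc k)"] by linarith+
    then show ?thesis
      using True c S[of k] S[of "Suc k"] by simp
  next
    case False
    then have pos: "0 < a (Suc k)"
      using a_nonneg[of "Suc k"] by simp
    let ?s = "S (Suc (Suc k))" and ?y = "S (Suc k) + S k"
    let ?d = "\<psi> (a (Suc k)) - \<psi> (a (Suc (Suc k)))"
    have p': "0 < \<psi>' (a (Suc k))"
      using pos small \<psi>(3) by auto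
    have y: "0 \<le> ?y"
      using S by simp
    have "sqrt (2 * Q (Suc k)) \<le> sqrt (2 * (\<bar>D\<bar> * (S (Suc k))\<^sup>2))"
      using QS[of "Suc k"] mult_right_mono[OF abs_ge_self[of D], of "(S (Suc k))\<^sup>2"] by simp
    also have "\<dots> = sqrt (2 * \<bar>D\<bar>) * S (Suc k)"
      using S[of "Suc k"] by (simp add: real_sqrt_mult)
    also have "\<dots> \<le> sqrt (2 * \<bar>D\<bar>) * ?y"
      using S by (intro mult_left_mono) auto
    finally have "norm (v k) + sqrt (2 * Q (Suc k)) \<le> B * ?y"
      using v(2)[of k] mult_right_mono[OF abs_ge_self[of C] y] by (simp add: B_def algebra_simps)
    moreover have "1 \<le> \<psi>' (val (Suc k) - l + Q (Suc k)) * (norm (v k) + sqrt (2 * Q (Suc k)))"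
      using v(1)[of k] frechet_subset_limiting pos small near X Q
      by (intro KLi[of "X (Suc k)"]) (auto simp: F_X a_def)
    then have "1 \<le> \<psi>' (a (Suc k)) * (norm (v k) + sqrt (2 * Q (Suc k)))"
      by (simp add: a_def algebra_simps)
    \<comment> \<open>The bound involves the two preceding lengths, while the descent inequality
      below involves the next one. Multiplying them relates three consecutive lengths.\<close>
    ultimately have one: "1 \<le> \<psi>' (a (Suc k)) * (B * ?y)"
      using p' by (meson mult_left_mono less_imp_le order_trans)
    have "\<psi>' (a (Suc k)) * (c * ?s\<^sup>2) \<le> \<psi>' (a (Suc k)) * (a (Suc k) - a (Suc (Suc k)))"
      using p' a_desc by (intro mult_left_mono) auto
    also have "\<dots> \<le> ?d"
      using pos small a_nonneg a_desc[of "Suc k"] c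
      by (intro \<psi>) (auto, smt (verit) mult_nonneg_nonneg zero_le_power2)
    finally have d: "\<psi>' (a (Suc k)) * (c * ?s\<^sup>2) \<le> ?d" .
    have "c * ?s\<^sup>2 \<le> (\<psi>' (a (Suc k)) * (B * ?y)) * (c * ?s\<^sup>2)"
      using one c mult_right_mono[OF one, of "c * ?s\<^sup>2"] by simp
    also have "\<dots> = (B * ?y) * (\<psi>' (a (Suc k)) * (c * ?s\<^sup>2))"
      by simp
    also have "\<dots> \<le> (B * ?y) * ?d"
      using d B y by (intro mult_left_mono) auto
    finally have "?s\<^sup>2 \<le> ?y * (B / c * ?d)"
      using c by (simp add: field_simps)
    \<comment> \<open>Arithmetic-geometric mean inequality, with the weight 1/4 that the recursion
      can absorb.\<close>
    also have "\<dots> \<le> (?y / 4 + B / c * ?d)\<^sup>2"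
    proof -
      have "x * w \<le> (x / 4 + w)\<^sup>2" for x w :: real
        using zero_le_power2[of "x / 4 - w"] by (simp add: power2_eq_square algebra_simps)
      then show ?thesis .
    qed
    finally have "?s \<le> \<bar>?y / 4 + B / c * ?d\<bar>"
      by (metis abs_le_square_iff S abs_of_nonneg)
    moreover have "0 \<le> ?d"
      using d p' c by (smt (verit) mult_nonneg_nonneg zero_le_power2)
    then have "0 \<le> ?y / 4 + B / c * ?d"
      using y B c by simp
    ultimately show ?thesis
      by (simp add: algebra_simps)
  qed
  have "X \<longlonglongrightarrow> z"
  proof (rule metric_LIMSEQ_I)
    fix \<epsilon>' :: real assume "0 < \<epsilon>'"
    \<comment> \<open>Trapping the sequence in balls of arbitrarily small radius already is
      convergence, so no separate Cauchy argument is made.\<close>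
    define \<delta> where "\<delta> = min \<epsilon> \<epsilon>'"
    have \<delta>: "0 < \<delta>" "\<delta> \<le> \<epsilon>" "\<delta> \<le> \<epsilon>'"
      using \<epsilon> \<open>0 < \<epsilon>'\<close> by (auto simp: \<delta>_def)
    obtain N where N: "\<And>k. k \<ge> N \<Longrightarrow> a k < \<eta>"
      using order_tendstoD(2)[OF a_lim \<epsilon>(2)] by (auto simp: eventually_sequentially)
    \<comment> \<open>The initial distance plus the bound of
      \<open>sum_le_of_quarter_recursion\<close> for the whole remaining length; for large
      \<open>n\<close> it is smaller than the radius.\<close>
    have "(\<lambda>n. dist (X (Suc (\<rho> n))) z + S (\<rho> n) + S (Suc (\<rho> n)) + 2 * (B / c * \<psi> (a (Suc (\<rho> n)))))
        \<longlonglongrightarrow> dist z z + 0 + 0 + 2 * (B / c * 0)"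
      by (intro tendsto_intros \<rho> sub\<rho> S0 \<psi>(2) a_nonneg a_lim)
    then have "\<forall>\<^sub>F n in sequentially.
        dist (X (Suc (\<rho> n))) z + S (\<rho> n) + S (Suc (\<rho> n)) + 2 * (B / c * \<psi> (a (Suc (\<rho> n)))) < \<delta>"
      using \<delta>(1) by (intro order_tendstoD(2)) auto
    from eventually_happens'[OF sequentially_bot eventually_conj[OF eventually_ge_at_top[of N] this]]
    obtain n where n: "N \<le> n"
        "dist (X (Suc (\<rho> n))) z + S (\<rho> n) + S (Suc (\<rho> n)) + 2 * (B / c * \<psi> (a (Suc (\<rho> n)))) < \<delta>"
      by blast
    define K where "K = \<rho> n"
    have K: "N \<le> K"
      using n(1) seq_suble[OF \<rho>(1), of n] by (simp add: K_def)
    \<comment> \<open>Strong induction: the length up to index \<open>m\<close> is bounded by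
      applying \<open>key\<close> at all earlier points, and these have to be near
      \<open>z\<close>.\<close>
    have trapped: "dist (X (Suc K + m)) z < \<delta>" for m
    proof (induction m rule: less_induct)
      case (less m)
      have "(\<Sum>j<m. S (K + Suc (Suc j))) \<le> S (K + 0) + S (K + 1) + 2 * (B / c * \<psi> (a (Suc K + 0)))"
      proof (rule sum_le_of_quarter_recursion[of "\<lambda>j. S (K + j)" "\<lambda>j. B / c * \<psi> (a (Suc K + j))" m])
        show "0 \<le> B / c * \<psi> (a (Suc K + m))"
          using B c \<psi>(1) a_nonneg N K by simp
        show "S (K + Suc (Suc j)) \<le> (S (K + Suc j) + S (K + j)) / 4
            + (B / c * \<psi> (a (Suc K + j)) - B / c * \<psi> (a (Suc K + Suc j)))" if "j < m" for j
          using key[of "K + j"] less.IH[OF that] \<delta> N K by simp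
      qed (use S in auto)
      moreover have "dist (X (Suc K + m)) (X (Suc K)) \<le> (\<Sum>j<m. S (K + Suc (Suc j)))"
      proof (induction m)
        case (Suc m)
        have "dist (X (Suc K + Suc m)) (X (Suc K)) \<le>
            dist (X (Suc (Suc K + m))) (X (Suc K + m)) + dist (X (Suc K + m)) (X (Suc K))"
          by (simp add: dist_triangle)
        with Suc steps[of "Suc K + m"] show ?case
          by simp
      qed simp
      moreover have "dist (X (Suc K + m)) z \<le> dist (X (Suc K + m)) (X (Suc K)) + dist (X (Suc K)) z"
        by (rule dist_triangle)
      ultimately show ?case
        using n(2) by (simp add: K_def)
    qed
    have "dist (X k) z < \<epsilon>'" if "k \<ge> Suc K" for k
      using trapped[of "k - Suc K"] that \<delta>(3) by simp
    then show "\<exists>no. \<forall>k\<ge>no. dist (X k) z < \<epsilon>'"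
      by blast
  qed
  moreover have "critical_point_II E F z"
    using z Fz crit by (simp add: critical_point_II_def edom_def)
  ultimately show ?thesis
    by blast
qed

end

subsection \<open>Block descent schemes\<close>

text \<open>The slack of a strict inequality can be shared between the summands even if some of them
  are infinite. This is the reason why sums of lower semicontinuous functions are lower
  semicontinuous.\<close>

lemma less_add_ereal_split:
  fixes a b c :: ereal
  assumes c: "c < a + b" and fin: "a \<noteq> -\<infinity>" "b \<noteq> -\<infinity>"
  obtains a' b' :: real where "ereal a' < a" "ereal b' < b" "c < ereal a' + ereal b'"
proof -
  have below: "\<exists>q>p. ereal q < y" if "ereal p < y" for p :: real and y :: ereal
    using ereal_dense2[OF that] by auto
  have below': "\<exists>q. ereal q < y" if "y \<noteq> -\<infinity>" for y :: ereal
    using that ereal_dense2[of "-\<infinity>" y] by auto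
  consider (minf) "c = -\<infinity>" | (fin) p q s where "c = ereal s" "a = ereal p" "b = ereal q"
    | (a) s where "c = ereal s" "a = \<infinity>" | (b) s where "c = ereal s" "b = \<infinity>"
    using c fin by (cases a; cases b; cases c) auto
  then show thesis
  proof cases
    case minf
    then show thesis
      using below'[OF fin(1)] below'[OF fin(2)] that by auto
  next
    case fin
    then have "s < p + q"
      using c by simp
    then show thesis
      using fin by (intro that[of "p - (p + q - s) / 3" "q - (p + q - s) / 3"]) (auto simp: field_simps)
  next
    case a
    obtain b' where "ereal b' < b"
      using below'[OF fin(2)] by blast
    with a show thesis
      by (intro that[of "s - b' + 1" b']) auto
  next
    case b
    obtain a' where "ereal a' < a"
      using below'[OF fin(1)] by blast
    with b show thesis
      by (intro that[of a' "s - a' + 1"]) auto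
  qed
qed

lemma lsc_on_add:
  assumes g: "lsc_on S g" and h: "lsc_on S h"
    and not_MInf: "\<And>x. x \<in> S \<Longrightarrow> g x \<noteq> -\<infinity>" "\<And>x. x \<in> S \<Longrightarrow> h x \<noteq> -\<infinity>"
  shows "lsc_on S (\<lambda>x. g x + h x)"
  unfolding lsc_on_def le_Liminf_iff
proof (intro ballI allI impI)
  fix x and c :: ereal assume x: "x \<in> S" and c: "c < g x + h x"
  obtain a b :: real where ab: "ereal a < g x" "ereal b < h x" "c < ereal a + ereal b"
    using less_add_ereal_split[OF c not_MInf(1)[OF x] not_MInf(2)[OF x]] .
  have "ereal a < Liminf (at x within S) g" "ereal b < Liminf (at x within S) h"
    using g h x ab by (auto simp: lsc_on_def intro: less_le_trans)
  then have "\<forall>\<^sub>F y in at x within S. ereal a < g y" "\<forall>\<^sub>F y in at x within S. ereal b < h y"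
    by (auto dest: less_LiminfD)
  then show "\<forall>\<^sub>F y in at x within S. c < g y + h y"
  proof eventually_elim
    case (elim y)
    then have "ereal a + ereal b \<le> g y + h y"
      by (intro add_mono less_imp_le)
    with ab(3) show ?case
      by (rule less_le_trans)
  qed
qed

lemma lsc_on_sum:
  fixes g :: "'i \<Rightarrow> 'a::topological_space \<Rightarrow> ereal"
  assumes "finite I" "\<And>i. i \<in> I \<Longrightarrow> lsc_on S (g i)" "\<And>i x. i \<in> I \<Longrightarrow> x \<in> S \<Longrightarrow> g i x \<noteq> -\<infinity>"
  shows "lsc_on S (\<lambda>x. \<Sum>i\<in>I. g i x)"
  using assms
proof (induction I rule: finite_induct)
  case empty
  show ?case
    by (auto simp: lsc_on_def le_Liminf_iff)
next
  case (insert i I)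
  have "lsc_on S (\<lambda>x. g i x + (\<Sum>i\<in>I. g i x))"
    using insert by (intro lsc_on_add sum_ereal_not_MInf) auto
  then show ?case
    using insert by simp
qed

lemma lsc_on_component:
  fixes g :: "'b::euclidean_space \<Rightarrow> ereal"
  assumes g: "lsc_on (V i) g"
  shows "lsc_on (prod_space V) (\<lambda>x. g (x $ i))"
  unfolding lsc_on_def le_Liminf_iff
proof (intro ballI allI impI)
  fix x and c :: ereal assume x: "x \<in> prod_space V" and c: "c < g (x $ i)"
  then have "c < Liminf (at (x $ i) within V i) g"
    using g by (auto simp: lsc_on_def prod_space_def intro: less_le_trans)
  then have "\<forall>\<^sub>F u in at (x $ i) within V i. c < g u"
    by (rule less_LiminfD)
  then obtain d where d: "d > 0" "\<And>u. u \<in> V i \<Longrightarrow> u \<noteq> x $ i \<Longrightarrow> dist u (x $ i) < d \<Longrightarrow> c < g u"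
    by (auto simp: eventually_at)
  \<comment> \<open>A point \<open>y \<noteq> x\<close> may share block \<open>i\<close> with
    \<open>x\<close>; the punctured limit in \<open>V i\<close> does not see it, but there
    \<open>c < g (x $ i)\<close> applies.\<close>
  have "c < g (y $ i)" if "y \<in> prod_space V" "dist y x < d" for y
    using d(2)[of "y $ i"] c that dist_vec_nth_le[of y i x]
    by (cases "y $ i = x $ i") (auto simp: prod_space_def)
  then show "\<forall>\<^sub>F y in at x within prod_space V. c < g (y $ i)"
    using d(1) by (auto simp: eventually_at)
qed

lemma lsc_on_continuous:
  fixes f :: "'a::topological_space \<Rightarrow> real"
  assumes "continuous_on S f"
  shows "lsc_on S (\<lambda>x. ereal (f x))"
  unfolding lsc_on_def
proof
  fix x assume "x \<in> S"
  show "ereal (f x) \<le> Liminf (at x within S) (\<lambda>x. ereal (f x))"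
  proof (cases "at x within S = bot")
    case False
    have "((\<lambda>x. ereal (f x)) \<longlongrightarrow> ereal (f x)) (at x within S)"
      using assms \<open>x \<in> S\<close> by (auto simp: continuous_on_def)
    from lim_imp_Liminf[OF False this] show ?thesis
      by simp
  qed (simp add: Liminf_bot)
qed

lemma norm_vec_le_sum: "norm x \<le> (\<Sum>i\<in>UNIV. norm (x $ i))"
  by (simp add: norm_vec_def L2_set_le_sum)

lemma objective_not_MInf:
  assumes "composite_problem V f r" "x \<in> prod_space V"
  shows "objective f r x \<noteq> -\<infinity>"
proof -
  have "(\<Sum>i\<in>UNIV. r i (x $ i)) \<noteq> -\<infinity>"
    using assms by (intro sum_ereal_not_MInf) (auto simp: composite_problem_def proper_on_def prod_space_def)
  then show ?thesis
    by (simp add: objective_def)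
qed

lemma lsc_on_objective:
  assumes "composite_problem V f r"
  shows "lsc_on (prod_space V) (objective f r)"
proof -
  have *: "r i (x $ i) \<noteq> -\<infinity>" if "x \<in> prod_space V" for i x
    using assms that by (auto simp: composite_problem_def proper_on_def prod_space_def)
  have "lsc_on (prod_space V) (\<lambda>x. ereal (f x) + (\<Sum>i\<in>UNIV. r i (x $ i)))"
    using assms * by (intro lsc_on_add lsc_on_sum lsc_on_continuous lsc_on_component sum_ereal_not_MInf)
      (auto simp: composite_problem_def)
  then show ?thesis
    by (simp add: objective_def[abs_def])
qed

text \<open>
  One inner step from \<open>y\<close> to \<open>y'\<close> updating block \<open>i\<close>, whose value before \<open>y\<close> was \<open>q\<close>.  The last
  condition bounds \<open>r\<^sub>i\<close> at the new point by its values at other points; it replaces the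
  minimality of the step when passing to cluster points.
\<close>

definition descent_step ::
  "('s::finite \<Rightarrow> 'b::euclidean_space set) \<Rightarrow> ('b ^ 's \<Rightarrow> real) \<Rightarrow> ('s \<Rightarrow> 'b \<Rightarrow> ereal) \<Rightarrow>
   real \<Rightarrow> real \<Rightarrow> real \<Rightarrow> 'b ^ 's \<Rightarrow> 'b \<Rightarrow> 's \<Rightarrow> 'b ^ 's \<Rightarrow> bool" where
  "descent_step V f r A W K y q i y' \<longleftrightarrow>
     objective f r y' + ereal (A * (norm (y' - y))\<^sup>2) \<le> objective f r y + ereal (W * (norm (y $ i - q))\<^sup>2) \<and>
     (\<exists>\<xi>\<in>frechet_subdiff (V i) (r i) (y' $ i).
        norm (\<xi> + gradient_on (prod_space V) f y' $ i) \<le> K * (norm (y' - y) + norm (y $ i - q))) \<and>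
     (\<forall>B M w e. B \<subseteq> prod_space V \<longrightarrow> convex B \<longrightarrow> M-lipschitz_on B (gradient_on (prod_space V) f) \<longrightarrow>
        y' \<in> B \<longrightarrow> w \<in> V i \<longrightarrow> block_update y' i w \<in> B \<longrightarrow>
        e = norm (w - y' $ i) + norm (y' - y) + norm (y $ i - q) \<longrightarrow>
        r i (y' $ i) \<le> r i w + ereal
          (gradient_on (prod_space V) f y' $ i \<bullet> (w - y' $ i) + (M + K) * e\<^sup>2))"

text \<open>Facts about the iterates that precede any descent estimate. Membership of iterates and
  previous values in the spaces is used to establish \<open>descent_step\<close>, hence the
  separation from \<open>block_descent\<close>.\<close>

locale block_updates =
  fixes V :: "'s::finite \<Rightarrow> 'b::euclidean_space set"
    and f :: "'b ^ 's \<Rightarrow> real" and r :: "'s \<Rightarrow> 'b \<Rightarrow> ereal"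
    and T :: "nat \<Rightarrow> nat" and blk :: "nat \<Rightarrow> nat \<Rightarrow> 's"
    and x :: "nat \<Rightarrow> nat \<Rightarrow> 'b ^ 's" and xt :: "nat \<Rightarrow> 'b ^ 's"
    and Tbar :: nat
  assumes problem: "composite_problem V f r"
    and C1: "C1_on (prod_space V) f"
    and xt_0: "xt 0 \<in> prod_space V"
    and x_0: "\<And>k. x (Suc k) 0 = xt k"
    and xt_Suc: "\<And>k. xt (Suc k) = x (Suc k) (T (Suc k))"
    and x_Suc: "\<And>k j. j < T (Suc k) \<Longrightarrow> x (Suc k) (Suc j) =
          block_update (x (Suc k) j) (blk (Suc k) (Suc j)) (x (Suc k) (Suc j) $ blk (Suc k) (Suc j))"
    and x_in: "\<And>k j. j < T (Suc k) \<Longrightarrow>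
          x (Suc k) (Suc j) $ blk (Suc k) (Suc j) \<in> V (blk (Suc k) (Suc j))"
    and all_blocks: "\<And>k. blk (Suc k) ` {1..T (Suc k)} = UNIV"
    and T_le: "\<And>k. T (Suc k) \<le> Tbar"
begin

abbreviation "P \<equiv> prod_space V"
abbreviation "G \<equiv> gradient_on P f"
abbreviation "F \<equiv> objective f r"

lemma subspace_V: "subspace (V i)"
  using problem by (simp add: composite_problem_def)

lemma subspace_P: "subspace P"
  by (rule subspace_prod_space) (rule subspace_V)

lemma xt_in_P: "xt k \<in> P"
  and x_in_P: "j \<le> T (Suc k) \<Longrightarrow> x (Suc k) j \<in> P"
proof -
  have inner: "x (Suc k) j \<in> P" if "xt k \<in> P" "j \<le> T (Suc k)" for k j
    using that(2)
  proof (induction j)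
    case 0
    show ?case using that by (simp add: x_0)
  next
    case (Suc j)
    then have "block_update (x (Suc k) j) (blk (Suc k) (Suc j)) (x (Suc k) (Suc j) $ blk (Suc k) (Suc j)) \<in> P"
      by (intro block_update_in_prod_space x_in) auto
    then show ?case
      using x_Suc[of j k] Suc.prems by simp
  qed
  show xt: "xt k \<in> P" for k
    by (induction k) (auto simp: xt_0 xt_Suc inner)
  show "x (Suc k) j \<in> P" if "j \<le> T (Suc k)"
    using inner[OF xt that] .
qed

lemma G_in_P: "y \<in> P \<Longrightarrow> G y \<in> P"
  and has_derivative_G: "y \<in> P \<Longrightarrow> (f has_derivative (\<lambda>h. G y \<bullet> h)) (at y within P)"
  using C1 gradient_on_works[OF subspace_P] by (auto simp: C1_on_def differentiable_on_def)

lemma prev_value_in_V: "j \<le> T k \<Longrightarrow> prev_value T blk (xt 0) x k j i \<in> V i"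
proof (induction k arbitrary: j)
  case 0
  show ?case
    using xt_0 by (simp add: prod_space_def)
next
  case (Suc k)
  show ?case
    using Suc.prems
  proof (induction j)
    case (Suc j)
    then show ?case
      using x_in_P[of j k] by (auto simp: prod_space_def)
  qed (simp add: Suc.IH)
qed

end

locale block_descent = block_updates V f r T blk x xt Tbar
  for V :: "'s::finite \<Rightarrow> 'b::euclidean_space set" and f r T blk x xt Tbar +
  fixes A W K :: real
  assumes W: "0 \<le> W" "W < A" and K: "0 \<le> K"
    and step: "\<And>k j i. j < T (Suc k) \<Longrightarrow> i = blk (Suc k) (Suc j) \<Longrightarrow>
          descent_step V f r A W K (x (Suc k) j) (prev_value T blk (xt 0) x (Suc k) j i) i (x (Suc k) (Suc j))"
begin

section \<open>Last moves, loop lengths and the Lyapunov function\<close>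

definition last_moves :: "nat \<Rightarrow> nat \<Rightarrow> 'b ^ 's" where
  "last_moves k j = (\<chi> i. x k j $ i - prev_value T blk (xt 0) x k j i)"

text \<open>This is not \<open>last_moves k (T k)\<close>, because nothing is known about
  \<open>x 0\<close>. For \<open>k = 0\<close> its value is 0.\<close>

definition outer_last_moves :: "nat \<Rightarrow> 'b ^ 's" where
  "outer_last_moves k = (\<chi> i. xt k $ i - prev_value T blk (xt 0) x k (T k) i)"

definition inner_step :: "nat \<Rightarrow> nat \<Rightarrow> real" where
  "inner_step k j = norm (x k (Suc j) - x k j)"

definition loop_length :: "nat \<Rightarrow> real" where
  "loop_length k = (\<Sum>j<T k. inner_step k j)"

lemma x_Suc_nth:
  assumes "j < T (Suc k)" "l \<noteq> blk (Suc k) (Suc j)"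
  shows "x (Suc k) (Suc j) $ l = x (Suc k) j $ l"
  using arg_cong[OF x_Suc[OF assms(1)], of "\<lambda>y. y $ l"] assms(2) by (simp add: block_update_nth)

lemma last_moves_0: "last_moves (Suc k) 0 = outer_last_moves k"
  by (simp add: last_moves_def outer_last_moves_def x_0)

lemma outer_last_moves_Suc: "outer_last_moves (Suc k) = last_moves (Suc k) (T (Suc k))"
  by (simp add: last_moves_def outer_last_moves_def xt_Suc)

lemma last_moves_Suc:
  assumes "j < T (Suc k)"
  shows "last_moves (Suc k) (Suc j) = block_update (last_moves (Suc k) j) (blk (Suc k) (Suc j))
    (x (Suc k) (Suc j) $ blk (Suc k) (Suc j) - x (Suc k) j $ blk (Suc k) (Suc j))"
  using x_Suc_nth[OF assms] by (auto simp: vec_eq_iff block_update_nth last_moves_def)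

lemma inner_step_eq:
  assumes "j < T (Suc k)"
  shows "inner_step (Suc k) j =
    norm (x (Suc k) (Suc j) $ blk (Suc k) (Suc j) - x (Suc k) j $ blk (Suc k) (Suc j))"
proof -
  let ?i = "blk (Suc k) (Suc j)"
  have "inner_step (Suc k) j =
      norm (block_update (x (Suc k) j) ?i (x (Suc k) (Suc j) $ ?i) - block_update (x (Suc k) j) ?i (x (Suc k) j $ ?i))"
    using x_Suc[OF assms] by (simp add: inner_step_def)
  then show ?thesis
    by (simp only: norm_block_update_diff)
qed

lemma inner_step_nonneg [simp]: "0 \<le> inner_step k j"
  by (simp add: inner_step_def)

lemma loop_length_nonneg: "0 \<le> loop_length k"
  by (simp add: loop_length_def sum_nonneg)

lemma inner_sum_le: "j \<le> T k \<Longrightarrow> (\<Sum>l<j. inner_step k l) \<le> loop_length k"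
  unfolding loop_length_def by (rule sum_mono2) auto

lemma inner_step_le: "j < T k \<Longrightarrow> inner_step k j \<le> loop_length k"
  unfolding loop_length_def by (rule member_le_sum) auto

lemma norm_x_diff_le:
  assumes "i \<le> j" shows "norm (x k j - x k i) \<le> (\<Sum>l\<in>{i..<j}. inner_step k l)"
  using assms
proof (induction j rule: dec_induct)
  case (step j)
  have "norm (x k (Suc j) - x k i) \<le> norm (x k (Suc j) - x k j) + norm (x k j - x k i)"
    by (rule norm_triangle_ineq[THEN order_trans[rotated]]) simp
  with step show ?case
    by (simp add: inner_step_def)
qed simp

lemma norm_x_diff_le_loop_length:
  assumes "i \<le> j" "j \<le> T k" shows "norm (x k j - x k i) \<le> loop_length k"
proof -
  have "(\<Sum>l\<in>{i..<j}. inner_step k l) \<le> loop_length k"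
    unfolding loop_length_def using assms by (intro sum_mono2) auto
  with norm_x_diff_le[OF assms(1)] show ?thesis
    by (rule order_trans)
qed

text \<open>Only one block of the last moves changes, from length b to length a. With the mean
  \<open>\<rho> = (A + W) / 2\<close> as weight, \<open>W \<le> \<rho>\<close> covers the term in
  b^2, and \<open>A - \<rho> = (A - W) / 2\<close> remains in front of a^2.\<close>

lemma potential_step:
  assumes j: "j < T (Suc k)"
  shows "F (x (Suc k) (Suc j)) + ereal ((A + W) / 2 * (norm (last_moves (Suc k) (Suc j)))\<^sup>2
      + (A - W) / 2 * (inner_step (Suc k) j)\<^sup>2)
    \<le> F (x (Suc k) j) + ereal ((A + W) / 2 * (norm (last_moves (Suc k) j))\<^sup>2)"
proof -
  let ?i = "blk (Suc k) (Suc j)"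
  let ?a = "inner_step (Suc k) j" and ?b = "norm (last_moves (Suc k) j $ ?i)"
  let ?\<rho> = "(A + W) / 2" and ?n = "(norm (last_moves (Suc k) j))\<^sup>2"
  have norm_sq: "(norm (last_moves (Suc k) (Suc j)))\<^sup>2 = ?n - ?b\<^sup>2 + ?a\<^sup>2"
    unfolding last_moves_Suc[OF j] norm_block_update_sq inner_step_eq[OF j] ..
  have desc: "F (x (Suc k) (Suc j)) + ereal (A * ?a\<^sup>2) \<le> F (x (Suc k) j) + ereal (W * ?b\<^sup>2)"
    using step[OF j refl] by (simp add: descent_step_def inner_step_def last_moves_def)
  have "F (x (Suc k) (Suc j)) + ereal (?\<rho> * (norm (last_moves (Suc k) (Suc j)))\<^sup>2 + (A - W) / 2 * ?a\<^sup>2)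
      = F (x (Suc k) (Suc j)) + ereal (A * ?a\<^sup>2) + ereal (?\<rho> * (?n - ?b\<^sup>2))"
  proof -
    have "?\<rho> * (?n - ?b\<^sup>2 + ?a\<^sup>2) + (A - W) / 2 * ?a\<^sup>2 = A * ?a\<^sup>2 + ?\<rho> * (?n - ?b\<^sup>2)"
      by (simp add: algebra_simps add_divide_distrib diff_divide_distrib)
    then show ?thesis
      unfolding norm_sq by (simp only: add.assoc plus_ereal.simps)
  qed
  also have "\<dots> \<le> F (x (Suc k) j) + ereal (W * ?b\<^sup>2) + ereal (?\<rho> * (?n - ?b\<^sup>2))"
    by (intro add_right_mono desc)
  also have "\<dots> = F (x (Suc k) j) + ereal (W * ?b\<^sup>2 + ?\<rho> * (?n - ?b\<^sup>2))"
    by (simp add: add.assoc)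
  also have "\<dots> \<le> F (x (Suc k) j) + ereal (?\<rho> * ?n)"
  proof (intro add_left_mono)
    have "W * ?b\<^sup>2 \<le> ?\<rho> * ?b\<^sup>2"
      using W by (intro mult_right_mono) auto
    moreover have "w + \<rho> * (n - b) \<le> \<rho> * n" if "w \<le> \<rho> * b" for w \<rho> n b :: real
      using that by (simp add: right_diff_distrib)
    ultimately show "ereal (W * ?b\<^sup>2 + ?\<rho> * (?n - ?b\<^sup>2)) \<le> ereal (?\<rho> * ?n)"
      by (simp only: ereal_less_eq)
  qed
  finally show ?thesis .
qed

lemma potential_inner:
  assumes "j \<le> T (Suc k)"
  shows "F (x (Suc k) j) + ereal ((A + W) / 2 * (norm (last_moves (Suc k) j))\<^sup>2
      + (A - W) / 2 * (\<Sum>l<j. (inner_step (Suc k) l)\<^sup>2))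
    \<le> F (xt k) + ereal ((A + W) / 2 * (norm (outer_last_moves k))\<^sup>2)"
  using assms
proof (induction j)
  case 0
  show ?case
    by (simp add: last_moves_0 x_0)
next
  case (Suc j)
  let ?n = "\<lambda>j. (A + W) / 2 * (norm (last_moves (Suc k) j))\<^sup>2"
  let ?s = "(A - W) / 2 * (\<Sum>l<j. (inner_step (Suc k) l)\<^sup>2)"
  have "F (x (Suc k) (Suc j)) + ereal (?n (Suc j) + (A - W) / 2 * (\<Sum>l<Suc j. (inner_step (Suc k) l)\<^sup>2))
      = F (x (Suc k) (Suc j)) + ereal (?n (Suc j) + (A - W) / 2 * (inner_step (Suc k) j)\<^sup>2) + ereal ?s"
    by (simp add: add_ac distrib_left)
  also have "\<dots> \<le> F (x (Suc k) j) + ereal (?n j) + ereal ?s"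
    using Suc.prems by (intro add_right_mono potential_step) simp
  also have "\<dots> = F (x (Suc k) j) + ereal (?n j + ?s)"
    by (simp add: add.assoc)
  also have "\<dots> \<le> F (xt k) + ereal ((A + W) / 2 * (norm (outer_last_moves k))\<^sup>2)"
    using Suc by simp
  finally show ?case .
qed

text \<open>The square of a sum of at most \<open>Tbar\<close> lengths is at most
  \<open>Tbar\<close> times the sum of their squares; the 1 keeps the denominator positive.\<close>

definition decrease :: real where
  "decrease = (A - W) / (2 * (real Tbar + 1))"

lemma decrease_pos: "0 < decrease"
  using W by (simp add: decrease_def)

lemma potential_outer:
  "F (xt (Suc k)) + ereal ((A + W) / 2 * (norm (outer_last_moves (Suc k)))\<^sup>2
      + decrease * (loop_length (Suc k))\<^sup>2)
    \<le> F (xt k) + ereal ((A + W) / 2 * (norm (outer_last_moves k))\<^sup>2)"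
proof -
  let ?q = "\<Sum>l<T (Suc k). (inner_step (Suc k) l)\<^sup>2"
  have "(loop_length (Suc k))\<^sup>2 \<le> ?q * real (T (Suc k))"
    using sum_squared_le_sum_of_squares[of "inner_step (Suc k)" "{..<T (Suc k)}"]
    by (simp add: loop_length_def)
  also have "\<dots> \<le> ?q * (real Tbar + 1)"
    using T_le[of k] by (intro mult_left_mono sum_nonneg) auto
  finally have "decrease * (loop_length (Suc k))\<^sup>2 \<le> decrease * (?q * (real Tbar + 1))"
    using decrease_pos by (intro mult_left_mono) auto
  also have "\<dots> = (A - W) / 2 * ?q"
    by (simp add: decrease_def field_simps add_nonneg_eq_0_iff)
  finally have "ereal ((A + W) / 2 * (norm (outer_last_moves (Suc k)))\<^sup>2 + decrease * (loop_length (Suc k))\<^sup>2)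
      \<le> ereal ((A + W) / 2 * (norm (outer_last_moves (Suc k)))\<^sup>2 + (A - W) / 2 * ?q)"
    by simp
  then have "F (xt (Suc k)) + ereal ((A + W) / 2 * (norm (outer_last_moves (Suc k)))\<^sup>2
      + decrease * (loop_length (Suc k))\<^sup>2)
    \<le> F (xt (Suc k)) + ereal ((A + W) / 2 * (norm (outer_last_moves (Suc k)))\<^sup>2 + (A - W) / 2 * ?q)"
    by (rule add_left_mono)
  also have "\<dots> \<le> F (xt k) + ereal ((A + W) / 2 * (norm (outer_last_moves k))\<^sup>2)"
    using potential_inner[of "T (Suc k)" k] by (simp add: xt_Suc outer_last_moves_Suc)
  finally show ?thesis .
qed

text \<open>Step \<open>l\<close> is the last update of block \<open>i\<close> in the loop. Later
  steps leave the block alone, so what \<open>descent_step\<close> says about \<open>r i\<close> at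
  this step still holds at the end of the loop.\<close>

lemma last_update:
  obtains l where "l < T (Suc k)" "blk (Suc k) (Suc l) = i" "xt (Suc k) $ i = x (Suc k) (Suc l) $ i"
    "norm (outer_last_moves (Suc k) $ i) = inner_step (Suc k) l"
proof -
  have "\<exists>l<j. blk (Suc k) (Suc l) = i \<and> x (Suc k) j $ i = x (Suc k) (Suc l) $ i
      \<and> norm (last_moves (Suc k) j $ i) = inner_step (Suc k) l"
    if "j \<le> T (Suc k)" "i \<in> blk (Suc k) ` {1..j}" for j
    using that
  proof (induction j)
    case (Suc j)
    show ?case
    proof (cases "blk (Suc k) (Suc j) = i")
      case True
      then show ?thesis
        using Suc.prems last_moves_Suc[of j k] inner_step_eq[of j k]
        by (intro exI[of _ j]) (auto simp: block_update_nth)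
    next
      case False
      then have "i \<in> blk (Suc k) ` {1..j}"
        using Suc.prems(2) by (auto simp: atLeastAtMostSuc_conv)
      with Suc.IH Suc.prems(1) obtain l where "l < j" "blk (Suc k) (Suc l) = i"
        "x (Suc k) j $ i = x (Suc k) (Suc l) $ i" "norm (last_moves (Suc k) j $ i) = inner_step (Suc k) l"
        by auto
      then show ?thesis
        using False Suc.prems(1) x_Suc_nth[of j k i] last_moves_Suc[of j k]
        by (intro exI[of _ l]) (auto simp: block_update_nth)
    qed
  qed simp
  from this[of "T (Suc k)"] all_blocks[of k] that show thesis
    by (auto simp: xt_Suc outer_last_moves_Suc)
qed

lemma norm_outer_last_moves_nth_le: "norm (outer_last_moves (Suc k) $ i) \<le> loop_length (Suc k)"
  by (rule last_update[of k i]) (simp add: inner_step_le)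

lemma norm_outer_last_moves_le:
  "norm (outer_last_moves (Suc k)) \<le> real CARD('s) * loop_length (Suc k)"
proof -
  have "norm (outer_last_moves (Suc k)) \<le> (\<Sum>i\<in>UNIV. norm (outer_last_moves (Suc k) $ i))"
    by (rule norm_vec_le_sum)
  also have "\<dots> \<le> (\<Sum>i\<in>(UNIV::'s set). loop_length (Suc k))"
    by (intro sum_mono norm_outer_last_moves_nth_le)
  finally show ?thesis
    by simp
qed

text \<open>In the middle of a loop the last move of a block may stem from the preceding loop. This
  is where the sum of two consecutive loop lengths originates.\<close>

lemma norm_last_moves_nth_le:
  assumes "j \<le> T (Suc (Suc k))"
  shows "norm (last_moves (Suc (Suc k)) j $ i) \<le> loop_length (Suc (Suc k)) + loop_length (Suc k)"
proof -
  have "norm (last_moves (Suc (Suc k)) j $ i) \<le> loop_length (Suc k) + (\<Sum>l<j. inner_step (Suc (Suc k)) l)"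
    using assms
  proof (induction j)
    case 0
    show ?case
      by (simp add: last_moves_0 norm_outer_last_moves_nth_le)
  next
    case (Suc j)
    have "norm (last_moves (Suc (Suc k)) (Suc j) $ i) \<le>
        max (norm (last_moves (Suc (Suc k)) j $ i)) (inner_step (Suc (Suc k)) j)"
      using last_moves_Suc[of j "Suc k"] inner_step_eq[of j "Suc k"] Suc.prems by (auto simp: block_update_nth)
    also have "\<dots> \<le> loop_length (Suc k) + (\<Sum>l<Suc j. inner_step (Suc (Suc k)) l)"
    proof -
      have "0 \<le> (\<Sum>l<j. inner_step (Suc (Suc k)) l)"
        by (intro sum_nonneg) simp
      moreover have "norm (last_moves (Suc (Suc k)) j $ i) \<le> loop_length (Suc k) + (\<Sum>l<j. inner_step (Suc (Suc k)) l)"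
        using Suc by simp
      ultimately show ?thesis
        using loop_length_nonneg[of "Suc k"] inner_step_nonneg[of "Suc (Suc k)" j]
        unfolding sum.lessThan_Suc by linarith
    qed
    finally show ?case .
  qed
  with inner_sum_le[OF assms] show ?thesis
    by linarith
qed

text \<open>Each block was last set by a step that supplies a Frechet subgradient, and these exist
  only in the domain. The starting point may have infinite value, so the sequence is studied from
  the first loop on.\<close>

lemma F_xt_finite: "F (xt (Suc k)) < \<infinity>"
proof -
  have "r i (xt (Suc k) $ i) \<noteq> \<infinity>" for i
  proof -
    obtain l where l: "l < T (Suc k)" "i = blk (Suc k) (Suc l)" "xt (Suc k) $ i = x (Suc k) (Suc l) $ i"
      by (metis last_update)
    from step[OF l(1,2)] show ?thesis
      by (auto simp: descent_step_def l(3) frechet_subdiff_def edom_def split: if_splits)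
  qed
  then show ?thesis
    by (simp add: objective_def sum_Pinfty)
qed

lemma descent_sequence:
  assumes "\<And>k. norm (xt k) \<le> R"
  shows "descent_sequence P F (\<lambda>k. xt (Suc k)) (\<lambda>k. loop_length (Suc k))
    (\<lambda>k. (A + W) / 2 * (norm (outer_last_moves (Suc k)))\<^sup>2) decrease R"
proof
  show "closed P"
    by (rule closed_subspace[OF subspace_P])
  show "lsc_on P F"
    by (rule lsc_on_objective[OF problem])
qed (use problem objective_not_MInf xt_in_P F_xt_finite loop_length_nonneg W decrease_pos
    potential_outer assms in auto)

theorem convergence:
  assumes bounded: "bounded (range xt)"
    and KL: "KL_function P F"
    and Lip: "\<And>B. B \<subseteq> P \<Longrightarrow> bounded B \<Longrightarrow> \<exists>M. M-lipschitz_on B G"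
  shows "\<exists>z. critical_point_II P F z \<and> xt \<longlonglongrightarrow> z"
proof -
  obtain R where R: "\<And>k. norm (xt k) \<le> R"
    using bounded by (auto simp: bounded_iff)
  have R0: "0 \<le> R"
    using R[of 0] norm_ge_zero by (rule order_trans[rotated])
  interpret D: descent_sequence P F "\<lambda>k. xt (Suc k)" "\<lambda>k. loop_length (Suc k)"
    "\<lambda>k. (A + W) / 2 * (norm (outer_last_moves (Suc k)))\<^sup>2" decrease R
    by (rule descent_sequence[OF R])
  obtain l where "(\<lambda>k. loop_length (Suc k)) \<longlonglongrightarrow> 0"
    by (metis D.limits)
  then obtain Smax where Smax: "\<And>k. loop_length (Suc k) \<le> Smax"
    using convergent_imp_Bseq[of "\<lambda>k. loop_length (Suc k)"]
    by (auto simp: convergent_def Bseq_def abs_le_iff)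
  have Smax0: "0 \<le> Smax"
    using Smax[of 0] loop_length_nonneg by (rule order_trans[rotated])
  \<comment> \<open>Inner iterates have norm at most \<open>R + Smax\<close>; replacing one block by
    that of a point of norm at most \<open>R\<close> adds at most another \<open>R\<close>.\<close>
  define B where "B = P \<inter> cball 0 (2 * R + Smax)"
  have B: "B \<subseteq> P" "bounded B" "convex B"
    unfolding B_def using subspace_P
    by (auto intro: bounded_subset[OF bounded_cball] convex_Int subspace_imp_convex)
  obtain M where M: "M-lipschitz_on B G"
    using Lip B by blast
  have M0: "0 \<le> M"
    using M by (rule lipschitz_on_nonneg)
  define G0 where "G0 = norm (G 0) + M * (2 * R + Smax)"
  have zeroB: "0 \<in> B"
    using R0 Smax0 subspace_0[OF subspace_P] by (simp add: B_def)
  have G0: "norm (G y) \<le> G0" if "y \<in> B" for y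
  proof -
    have "norm (G y - G 0) \<le> M * norm (y - 0)"
      by (rule lipschitz_on_normD[OF M that zeroB])
    also have "\<dots> \<le> M * (2 * R + Smax)"
      using that M0 by (intro mult_left_mono) (auto simp: B_def)
    finally show ?thesis
      using norm_triangle_sub[of "G y" "G 0"] by (simp add: G0_def)
  qed
  have G0_nonneg: "0 \<le> G0"
    using G0[OF zeroB] norm_ge_zero by (rule order_trans[rotated])
  have norm_x: "norm (x (Suc k) j) \<le> R + Smax" if "j \<le> T (Suc k)" for k j
  proof -
    have "norm (x (Suc k) j - xt k) \<le> Smax"
      using norm_x_diff_le_loop_length[of 0 j "Suc k"] that Smax[of k] by (simp add: x_0)
    then show ?thesis
      using norm_triangle_sub[of "x (Suc k) j" "xt k"] R[of k] by simp
  qed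
  have xB: "x (Suc k) j \<in> B" if "j \<le> T (Suc k)" for k j
    using norm_x[OF that] x_in_P[OF that] R0 by (simp add: B_def)
  have smallB: "w \<in> B" if "w \<in> P" "norm w \<le> R" for w
    using that R0 Smax0 by (simp add: B_def)
  let ?S = "\<lambda>k. loop_length (Suc k)"
  \<comment> \<open>The subgradient of \<open>r i\<close> is paired with the gradient of
    \<open>f\<close> at the inner iterate of its last update. Moving to the gradient at the end of
    the loop costs \<open>M\<close> times a loop length, after which the blocks can be
    assembled.\<close>
  have sub: "\<exists>v\<in>frechet_subdiff P F (xt (Suc (Suc k))).
      norm v \<le> real CARD('s) * (2 * K + M) * (?S (Suc k) + ?S k)" for k
  proof -
    have "\<exists>\<xi>\<in>frechet_subdiff (V i) (r i) (xt (Suc (Suc k)) $ i).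
        norm (G (xt (Suc (Suc k))) $ i + \<xi>) \<le> (2 * K + M) * (?S (Suc k) + ?S k)" for i
    proof -
      obtain l where l: "l < T (Suc (Suc k))" "i = blk (Suc (Suc k)) (Suc l)"
        "xt (Suc (Suc k)) $ i = x (Suc (Suc k)) (Suc l) $ i"
        by (metis last_update)
      let ?y = "x (Suc (Suc k)) (Suc l)" and ?xt = "xt (Suc (Suc k))"
      obtain \<xi> where \<xi>: "\<xi> \<in> frechet_subdiff (V i) (r i) (?y $ i)"
        "norm (\<xi> + G ?y $ i) \<le> K * (inner_step (Suc (Suc k)) l + norm (last_moves (Suc (Suc k)) l $ i))"
        using step[OF l(1,2)] by (auto simp: descent_step_def inner_step_def last_moves_def)
      have "inner_step (Suc (Suc k)) l + norm (last_moves (Suc (Suc k)) l $ i) \<le> 2 * (?S (Suc k) + ?S k)"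
        using inner_step_le[OF l(1)] norm_last_moves_nth_le[of l k i] l(1) loop_length_nonneg[of "Suc k"] by simp
      then have "norm (\<xi> + G ?y $ i) \<le> K * (2 * (?S (Suc k) + ?S k))"
        using \<xi>(2) K by (meson mult_left_mono order_trans)
      moreover have "norm (G ?xt $ i - G ?y $ i) \<le> M * (?S (Suc k) + ?S k)"
      proof -
        have "norm (G ?xt $ i - G ?y $ i) \<le> norm (G ?xt - G ?y)"
          by (metis Finite_Cartesian_Product.norm_nth_le vector_minus_component)
        also have "\<dots> \<le> M * norm (?xt - ?y)"
          using l(1) by (intro lipschitz_on_normD[OF M]) (auto simp: xt_Suc intro: xB)
        also have "norm (?xt - ?y) \<le> ?S (Suc k) + ?S k"
          using norm_x_diff_le_loop_length[of "Suc l" "T (Suc (Suc k))" "Suc (Suc k)"] l(1)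
            loop_length_nonneg[of "Suc k"] by (simp add: xt_Suc)
        finally show ?thesis
          using M0 by (simp add: mult_left_mono)
      qed
      moreover have "G ?xt $ i + \<xi> = (\<xi> + G ?y $ i) + (G ?xt $ i - G ?y $ i)"
        by simp
      ultimately have "norm (G ?xt $ i + \<xi>) \<le> K * (2 * (?S (Suc k) + ?S k)) + M * (?S (Suc k) + ?S k)"
        by (simp only:) (rule norm_triangle_le, rule add_mono)
      then show ?thesis
        using \<xi>(1) l(3) by (intro bexI[of _ \<xi>]) (auto simp: algebra_simps)
    qed
    then have "\<forall>i. \<exists>\<xi>. \<xi> \<in> frechet_subdiff (V i) (r i) (xt (Suc (Suc k)) $ i) \<and>
        norm (G (xt (Suc (Suc k))) $ i + \<xi>) \<le> (2 * K + M) * (?S (Suc k) + ?S k)"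
      by blast
    from choice[OF this] obtain \<xi> where \<xi>: "\<And>i. \<xi> i \<in> frechet_subdiff (V i) (r i) (xt (Suc (Suc k)) $ i)"
      "\<And>i. norm (G (xt (Suc (Suc k))) $ i + \<xi> i) \<le> (2 * K + M) * (?S (Suc k) + ?S k)"
      by blast
    let ?v = "G (xt (Suc (Suc k))) + (\<chi> i. \<xi> i)"
    have "?v \<in> frechet_subdiff P F (xt (Suc (Suc k)))"
      using \<xi>(1) problem xt_in_P G_in_P has_derivative_G subspace_V
      by (intro frechet_subdiff_objective) (auto simp: composite_problem_def proper_on_def)
    moreover have "norm ?v \<le> real CARD('s) * (2 * K + M) * (?S (Suc k) + ?S k)"
    proof -
      have "norm ?v \<le> (\<Sum>i\<in>UNIV. norm (?v $ i))"
        by (rule norm_vec_le_sum)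
      also have "\<dots> \<le> (\<Sum>i\<in>(UNIV::'s set). (2 * K + M) * (?S (Suc k) + ?S k))"
        using \<xi>(2) by (intro sum_mono) simp
      finally show ?thesis
        by (simp add: mult.assoc)
    qed
    ultimately show ?thesis
      by blast
  qed
  \<comment> \<open>The first summand serves \<open>sub\<close>. In \<open>upper\<close>, the
    function \<open>f\<close> and each block contribute at most
    \<open>(G0 + 4 * (M + K)) * (e + e\<^sup>2)\<close>, where the 4 arises from an error of a step
    of at most \<open>2 * e\<close>.\<close>
  define C where "C = real CARD('s) * (2 * K + M) + (real CARD('s) + 1) * (G0 + 4 * (M + K))"
  have C: "real CARD('s) * (2 * K + M) \<le> C" "(real CARD('s) + 1) * (G0 + 4 * (M + K)) \<le> C"
    using M0 K G0_nonneg by (auto simp: C_def)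
  have upper: "F (xt (Suc (Suc k))) \<le> F w + ereal (C * (e + e\<^sup>2))"
    if w: "w \<in> P" "norm w \<le> R" and e: "e = norm (w - xt (Suc (Suc k))) + ?S (Suc k) + ?S k" for k w e
  proof -
    let ?xt = "xt (Suc (Suc k))"
    have e0: "0 \<le> e" "norm (w - ?xt) \<le> e"
      using e loop_length_nonneg[of "Suc k"] loop_length_nonneg[of "Suc (Suc k)"] by auto
    \<comment> \<open>Only block \<open>i\<close> of \<open>w\<close> is inserted into the inner
      iterate, so that the comparison clause of \<open>descent_step\<close> applies to it.\<close>
    have block: "r i (?xt $ i) \<le> r i (w $ i) + ereal (G0 * e + (M + K) * (2 * e)\<^sup>2)" for i
    proof -
      obtain l where l: "l < T (Suc (Suc k))" "i = blk (Suc (Suc k)) (Suc l)"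
        "?xt $ i = x (Suc (Suc k)) (Suc l) $ i"
        by (metis last_update)
      let ?y = "x (Suc (Suc k)) (Suc l)"
      have yB: "?y \<in> B"
        using l(1) by (intro xB) simp
      have wi: "w $ i \<in> V i"
        using w(1) by (simp add: prod_space_def)
      have diff: "norm (w $ i - ?y $ i) \<le> norm (w - ?xt)"
        using Finite_Cartesian_Product.norm_nth_le[of "w - ?xt" i] by (simp add: l(3))
      have "norm (block_update ?y i (w $ i)) \<le> 2 * R + Smax"
        using norm_block_update_le[of ?y i "w $ i"] norm_x[of "Suc l" "Suc k"] l(1) w(2)
          Finite_Cartesian_Product.norm_nth_le[of w i] by simp
      then have zB: "block_update ?y i (w $ i) \<in> B"
        using block_update_in_prod_space[of ?y V "w $ i" i] wi yB by (simp add: B_def)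
      define e' where "e' = norm (w $ i - ?y $ i) + norm (?y - x (Suc (Suc k)) l)
        + norm (x (Suc (Suc k)) l $ i - prev_value T blk (xt 0) x (Suc (Suc k)) l i)"
      have e': "0 \<le> e'" "e' \<le> 2 * e"
      proof -
        have "norm (?y - x (Suc (Suc k)) l) \<le> ?S (Suc k)"
          using inner_step_le[OF l(1)] by (simp add: inner_step_def)
        moreover have "norm (x (Suc (Suc k)) l $ i - prev_value T blk (xt 0) x (Suc (Suc k)) l i) \<le> ?S (Suc k) + ?S k"
          using norm_last_moves_nth_le[of l k i] l(1) by (simp add: last_moves_def)
        ultimately show "e' \<le> 2 * e"
          using diff norm_ge_zero[of "w - ?xt"] loop_length_nonneg[of "Suc k"] unfolding e'_def e by argo
      qed (simp add: e'_def)
      have "r i (?y $ i) \<le> r i (w $ i) + ereal (G ?y $ i \<bullet> (w $ i - ?y $ i) + (M + K) * e'\<^sup>2)"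
        using step[OF l(1,2)] B(1,3) M yB wi zB e'_def unfolding descent_step_def by blast
      also have "\<dots> \<le> r i (w $ i) + ereal (G0 * e + (M + K) * (2 * e)\<^sup>2)"
      proof (rule add_left_mono)
        have "G ?y $ i \<bullet> (w $ i - ?y $ i) \<le> norm (G ?y $ i) * norm (w $ i - ?y $ i)"
          by (rule norm_cauchy_schwarz)
        also have "\<dots> \<le> G0 * e"
          using G0[OF yB] Finite_Cartesian_Product.norm_nth_le[of "G ?y" i] diff e0 G0_nonneg
          by (intro mult_mono) auto
        moreover have "(M + K) * e'\<^sup>2 \<le> (M + K) * (2 * e)\<^sup>2"
          using e' M0 K by (intro mult_left_mono power_mono) auto
        ultimately show "ereal (G ?y $ i \<bullet> (w $ i - ?y $ i) + (M + K) * e'\<^sup>2)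
            \<le> ereal (G0 * e + (M + K) * (2 * e)\<^sup>2)"
          by simp
      qed
      finally show ?thesis
        by (simp add: l(3))
    qed
    have fbound: "f ?xt \<le> f w + (G0 * e + (M + K) * (2 * e)\<^sup>2)"
    proof -
      have wB: "w \<in> B" "?xt \<in> B"
        using smallB w xt_in_P R by auto
      have "f ?xt \<le> f w + G w \<bullet> (?xt - w) + M / 2 * (norm (?xt - w))\<^sup>2"
        using C1 by (intro descent_lemma_on[OF subspace_P _ B(1,3) M wB]) (simp add: C1_on_def)
      moreover have "G w \<bullet> (?xt - w) \<le> G0 * e"
      proof -
        have "G w \<bullet> (?xt - w) \<le> norm (G w) * norm (?xt - w)"
          by (rule norm_cauchy_schwarz)
        also have "\<dots> \<le> G0 * e"
          using G0[OF wB(1)] e0 G0_nonneg by (intro mult_mono) (auto simp: norm_minus_commute)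
        finally show ?thesis .
      qed
      moreover have "M / 2 * (norm (?xt - w))\<^sup>2 \<le> (M + K) * (2 * e)\<^sup>2"
        using M0 K e0 by (intro mult_mono power_mono) (auto simp: norm_minus_commute)
      ultimately show ?thesis
        by simp
    qed
    have "F ?xt \<le> ereal (f w + (G0 * e + (M + K) * (2 * e)\<^sup>2)) +
        (\<Sum>i\<in>UNIV. r i (w $ i) + ereal (G0 * e + (M + K) * (2 * e)\<^sup>2))"
      unfolding objective_def using block fbound by (intro add_mono sum_mono) auto
    also have "\<dots> = F w + ereal ((real CARD('s) + 1) * (G0 * e + (M + K) * (2 * e)\<^sup>2))"
    proof -
      have "ereal (a + d) + (b + ereal (n * d)) = ereal a + b + ereal ((n + 1) * d)" for a b d n
        by (cases b) (auto simp: algebra_simps)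
      then show ?thesis
        by (simp add: objective_def sum.distrib)
    qed
    also have "\<dots> \<le> F w + ereal (C * (e + e\<^sup>2))"
    proof (intro add_left_mono)
      have "G0 * e + (M + K) * (2 * e)\<^sup>2 \<le> (G0 + 4 * (M + K)) * (e + e\<^sup>2)"
        using G0_nonneg M0 K e0 by (simp add: algebra_simps power2_eq_square)
      then have "(real CARD('s) + 1) * (G0 * e + (M + K) * (2 * e)\<^sup>2)
          \<le> (real CARD('s) + 1) * ((G0 + 4 * (M + K)) * (e + e\<^sup>2))"
        by (intro mult_left_mono) auto
      also have "\<dots> \<le> C * (e + e\<^sup>2)"
        using mult_right_mono[OF C(2), of "e + e\<^sup>2"] e0 by (simp add: mult.assoc)
      finally show "ereal ((real CARD('s) + 1) * (G0 * e + (M + K) * (2 * e)\<^sup>2)) \<le> ereal (C * (e + e\<^sup>2))"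
        by simp
    qed
    finally show ?thesis .
  qed
  have "\<exists>z. critical_point_II P F z \<and> (\<lambda>k. xt (Suc k)) \<longlonglongrightarrow> z"
  proof (rule D.convergence[OF KL, where C = C and D = "(A + W) / 2 * (real CARD('s))\<^sup>2"])
    show "dist (xt (Suc (Suc k))) (xt (Suc k)) \<le> ?S (Suc k)" for k
      using norm_x_diff_le_loop_length[of 0 "T (Suc (Suc k))" "Suc (Suc k)"]
      by (simp add: dist_norm x_0 xt_Suc[of "Suc k"])
    show "(A + W) / 2 * (norm (outer_last_moves (Suc k)))\<^sup>2
        \<le> (A + W) / 2 * (real CARD('s))\<^sup>2 * (?S k)\<^sup>2" for k
    proof -
      have "(norm (outer_last_moves (Suc k)))\<^sup>2 \<le> (real CARD('s) * ?S k)\<^sup>2"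
        by (intro power_mono norm_outer_last_moves_le) simp
      then have "(A + W) / 2 * (norm (outer_last_moves (Suc k)))\<^sup>2 \<le> (A + W) / 2 * (real CARD('s) * ?S k)\<^sup>2"
        using W by (intro mult_left_mono) auto
      then show ?thesis
        by (simp add: power_mult_distrib mult.assoc)
    qed
    show "\<exists>v\<in>frechet_subdiff P F (xt (Suc (Suc k))). norm v \<le> C * (?S (Suc k) + ?S k)" for k
    proof -
      have "real CARD('s) * (2 * K + M) * (?S (Suc k) + ?S k) \<le> C * (?S (Suc k) + ?S k)"
        using C(1) loop_length_nonneg[of "Suc k"] loop_length_nonneg[of "Suc (Suc k)"]
        by (intro mult_right_mono) auto
      with sub[of k] show ?thesis
        by (meson order_trans)
    qed
  qed (rule upper)
  then show ?thesis
    by (simp add: filterlim_sequentially_Suc)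
qed

end

subsection \<open>Inertial proximal steps\<close>

lemma bregman_dist_le:
  assumes "subspace S" "h differentiable_on S" "L-lipschitz_on S (gradient_on S h)" "u \<in> S" "v \<in> S"
  shows "bregman_dist S h u v \<le> L / 2 * (norm (u - v))\<^sup>2"
  using descent_lemma_on[OF assms(1,2) order_refl subspace_imp_convex[OF assms(1)] assms(3,5,4)]
  by (simp add: bregman_dist_def)

lemma bregman_dist_ge:
  assumes "subspace S" "h differentiable_on S" "strongly_convex_on \<sigma> S h" "u \<in> S" "v \<in> S"
  shows "\<sigma> / 2 * (norm (u - v))\<^sup>2 \<le> bregman_dist S h u v"
  using strongly_convex_on_gradient[OF assms(1,2,3,5,4)] by (simp add: bregman_dist_def)

text \<open>Both quadratic bounds of one Bregman distance are compared. A zero space does not relate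
  the two constants, hence the two distinct points.\<close>

lemma strong_convexity_le_lipschitz:
  assumes "subspace S" "h differentiable_on S" "strongly_convex_on \<sigma> S h"
    and "L-lipschitz_on S (gradient_on S h)" "u \<in> S" "v \<in> S" "u \<noteq> v"
  shows "\<sigma> \<le> L"
proof -
  have "\<sigma> / 2 * (norm (u - v))\<^sup>2 \<le> L / 2 * (norm (u - v))\<^sup>2"
    using bregman_dist_le[of S h L u v] bregman_dist_ge[of S h \<sigma> u v] assms by linarith
  then show ?thesis
    using assms(7) by simp
qed

text \<open>Three-point identity: the difference is a pairing of a gradient difference with
  \<open>u - p\<close>, minus the Bregman distance from \<open>p\<close> to
  \<open>u\<close>.\<close>

lemma bregman_dist_diff_le:
  assumes S: "subspace S" and h: "h differentiable_on S" "strongly_convex_on \<sigma> S h"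
    and L: "L-lipschitz_on S (gradient_on S h)" and mem: "u \<in> S" "p \<in> S" "v \<in> S"
  shows "bregman_dist S h p v - bregman_dist S h u v
    \<le> L * norm (v - p) * norm (u - p) - \<sigma> / 2 * (norm (u - p))\<^sup>2"
proof -
  let ?g = "gradient_on S h"
  have "bregman_dist S h p v - bregman_dist S h u v = (?g v - ?g p) \<bullet> (u - p) - bregman_dist S h u p"
    by (simp add: bregman_dist_def algebra_simps inner_diff_left inner_diff_right)
  also have "(?g v - ?g p) \<bullet> (u - p) \<le> norm (?g v - ?g p) * norm (u - p)"
    by (rule norm_cauchy_schwarz)
  also have "\<dots> \<le> L * norm (v - p) * norm (u - p)"
    using L mem by (intro mult_right_mono lipschitz_on_normD) auto
  finally show ?thesis
    using bregman_dist_ge[OF S h mem(1,2)] by simp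
qed

text \<open>Covers both schemes: \<open>g\<close> is the block function for IBP and the linear
  function given by the gradient at the extrapolated point for IBPG. The bounds \<open>amax\<close>
  and \<open>bmax\<close> keep later constants independent of the step.\<close>

locale prox_step =
  fixes S :: "'a::euclidean_space set" and h :: "'a \<Rightarrow> real" and r :: "'a \<Rightarrow> ereal" and g :: "'a \<Rightarrow> real"
    and \<sigma> L \<alpha> \<beta> amax bmax :: real and p q u :: 'a
  assumes S: "subspace S" and h: "h differentiable_on S" "strongly_convex_on \<sigma> S h"
    and L: "L-lipschitz_on S (gradient_on S h)"
    and r: "proper_on S r"
    and mem: "p \<in> S" "q \<in> S" "u \<in> S"
    and \<sigma>: "0 < \<sigma>" and \<alpha>: "0 \<le> \<alpha>" "\<alpha> \<le> amax" and \<beta>: "0 < \<beta>" "1 / \<beta> \<le> bmax"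
    and min: "\<And>w. w \<in> S \<Longrightarrow>
      r u + ereal (g u + 1 / \<beta> * bregman_dist S h u (p + \<alpha> *\<^sub>R (p - q)))
        \<le> r w + ereal (g w + 1 / \<beta> * bregman_dist S h w (p + \<alpha> *\<^sub>R (p - q)))"
begin

abbreviation "xhat \<equiv> p + \<alpha> *\<^sub>R (p - q)"

lemma xhat: "xhat \<in> S"
  using S mem by (intro subspace_add subspace_scale subspace_diff) auto

lemma L_nonneg: "0 \<le> L"
  using L by (rule lipschitz_on_nonneg)

lemma bmax_nonneg: "0 \<le> bmax"
  using \<beta> by (meson divide_nonneg_pos order_trans zero_le_one)

lemma r_not_MInf: "w \<in> S \<Longrightarrow> r w \<noteq> -\<infinity>"
  using r by (auto simp: proper_on_def)

lemma r_finite: "r u \<noteq> \<infinity>"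
proof -
  obtain w where w: "w \<in> S" "r w < \<infinity>"
    using r by (auto simp: proper_on_def edom_def)
  with min[OF w(1)] show ?thesis
    by (cases "r w") auto
qed

lemma norm_diff_xhat: "norm (w - xhat) \<le> norm (w - u) + norm (u - p) + \<alpha> * norm (p - q)"
proof -
  have "norm (w - xhat) = norm ((w - u) + (u - p) - \<alpha> *\<^sub>R (p - q))"
    by (simp add: algebra_simps)
  also have "\<dots> \<le> norm (w - u) + norm (u - p) + norm (\<alpha> *\<^sub>R (p - q))"
    by (meson add_right_mono norm_triangle_ineq norm_triangle_ineq4 order_trans)
  finally show ?thesis
    using \<alpha> by simp
qed

lemma norm_diff_xhat_le: "norm (w - xhat) \<le> (1 + amax) * (norm (w - u) + norm (u - p) + norm (p - q))"
proof -
  have "norm (w - xhat) \<le> norm (w - u) + norm (u - p) + amax * norm (p - q)"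
    using norm_diff_xhat[of w] mult_right_mono[OF \<alpha>(2), of "norm (p - q)"] by simp
  moreover have "0 \<le> amax * (norm (w - u) + norm (u - p))"
    using \<alpha> by simp
  ultimately show ?thesis
    by (simp add: algebra_simps add_increasing)
qed

text \<open>Minimality is tested at the current value \<open>p\<close>. As \<open>xhat - p\<close>
  is \<open>\<alpha>\<close> times the previous move, the inertia enters as a product of the two
  moves.\<close>

lemma descent:
  "r u + ereal (g u + 1 / \<beta> * (\<sigma> / 2 * (norm (u - p))\<^sup>2 - L * \<alpha> * norm (p - q) * norm (u - p)))
    \<le> r p + ereal (g p)"
proof -
  let ?D = "\<lambda>w. bregman_dist S h w xhat"
  have eq: "norm (xhat - p) = \<alpha> * norm (p - q)"
    using \<alpha> by simp
  have "\<sigma> / 2 * (norm (u - p))\<^sup>2 - L * \<alpha> * norm (p - q) * norm (u - p) \<le> ?D u - ?D p"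
    using bregman_dist_diff_le[OF S h L mem(3,1) xhat] unfolding eq mult.assoc by argo
  then have "1 / \<beta> * (\<sigma> / 2 * (norm (u - p))\<^sup>2 - L * \<alpha> * norm (p - q) * norm (u - p)) \<le> 1 / \<beta> * (?D u - ?D p)"
    using \<beta> by (intro mult_left_mono) auto
  then show ?thesis
    using min[OF mem(1)] by (cases "r u"; cases "r p") (auto simp: right_diff_distrib)
qed

text \<open>By the Fermat rule the negative gradient of the smooth part is a subgradient; adding
  \<open>v\<close> leaves only the difference of kernel gradients at \<open>u\<close> and
  \<open>xhat\<close>.\<close>

lemma subgradient:
  assumes v: "v \<in> S" "(g has_derivative (\<lambda>d. v \<bullet> d)) (at u within S)"
  shows "\<exists>\<xi>\<in>frechet_subdiff S r u. norm (\<xi> + v) \<le> bmax * L * (1 + amax) * (norm (u - p) + norm (p - q))"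
proof
  let ?G = "gradient_on S h"
  let ?w = "v + (1 / \<beta>) *\<^sub>R (?G u - ?G xhat)"
  have Gu: "?G u \<in> S" "(h has_derivative (\<lambda>d. ?G u \<bullet> d)) (at u within S)" "?G xhat \<in> S"
    using gradient_on_works[OF S] mem(3) xhat h(1) by (auto simp: differentiable_on_def)
  have "((\<lambda>w. g w + 1 / \<beta> * (h w - h xhat - ?G xhat \<bullet> (w - xhat))) has_derivative
      (\<lambda>d. v \<bullet> d + 1 / \<beta> * (?G u \<bullet> d - ?G xhat \<bullet> d))) (at u within S)"
    by (rule derivative_eq_intros v(2) Gu(2) refl | simp)+
  then have der: "((\<lambda>w. g w + 1 / \<beta> * bregman_dist S h w xhat) has_derivative (\<lambda>d. ?w \<bullet> d)) (at u within S)"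
    by (simp add: bregman_dist_def inner_add_left inner_diff_left)
  show "- ?w \<in> frechet_subdiff S r u"
    using min S v Gu
    by (intro frechet_subdiff_minimizer[where g = r, OF S mem(3) r_finite _ der])
      (auto simp: r_not_MInf intro!: subspace_add subspace_scale subspace_diff)
  have "norm (- ?w + v) = 1 / \<beta> * norm (?G u - ?G xhat)"
    using \<beta> by simp
  also have "\<dots> \<le> bmax * (L * norm (u - xhat))"
    using \<beta> bmax_nonneg mem(3) xhat by (intro mult_mono lipschitz_on_normD[OF L]) auto
  also have "\<dots> \<le> bmax * (L * ((1 + amax) * (norm (u - p) + norm (p - q))))"
    using norm_diff_xhat_le[of u] bmax_nonneg L_nonneg by (intro mult_left_mono) auto
  finally show "norm (- ?w + v) \<le> bmax * L * (1 + amax) * (norm (u - p) + norm (p - q))"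
    by (simp add: mult.assoc)
qed

text \<open>Minimality is tested at an arbitrary \<open>w\<close>: the Bregman term at
  \<open>u\<close> is nonnegative and is dropped, the one at \<open>w\<close> is at most
  quadratic.\<close>

lemma value_le:
  assumes w: "w \<in> S" and e: "e = norm (w - u) + norm (u - p) + norm (p - q)"
  shows "r u \<le> r w + ereal (g w - g u + bmax * L * (1 + amax)\<^sup>2 * e\<^sup>2)"
proof -
  have nonneg: "0 \<le> bregman_dist S h u xhat"
    using bregman_dist_ge[OF S h mem(3) xhat] \<sigma> by (smt (verit) mult_nonneg_nonneg zero_le_power2 divide_nonneg_pos)
  have "bregman_dist S h w xhat \<le> L / 2 * (norm (w - xhat))\<^sup>2"
    by (rule bregman_dist_le[OF S h(1) L w xhat])
  also have "\<dots> \<le> L * ((1 + amax) * e)\<^sup>2"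
    using norm_diff_xhat_le[of w] L_nonneg unfolding e by (intro mult_mono power_mono) auto
  finally have "1 / \<beta> * bregman_dist S h w xhat \<le> 1 / \<beta> * (L * ((1 + amax) * e)\<^sup>2)"
    using \<beta> by (intro mult_left_mono) auto
  also have "\<dots> \<le> bmax * (L * ((1 + amax) * e)\<^sup>2)"
    using \<beta> L_nonneg by (intro mult_right_mono) auto
  finally have "1 / \<beta> * bregman_dist S h w xhat \<le> bmax * L * (1 + amax)\<^sup>2 * e\<^sup>2"
    by (simp add: power_mult_distrib mult.assoc)
  moreover have "0 \<le> 1 / \<beta> * bregman_dist S h u xhat"
    using nonneg \<beta> by simp
  ultimately show ?thesis
    using min[OF w] by (cases "r u"; cases "r w") auto
qed

end

section \<open>Steps of IBP and IBPG as descent steps\<close>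

lemma young_le:
  fixes a b c s :: real
  assumes "0 < c"
  shows "s * b * a \<le> c / 2 * a\<^sup>2 + s\<^sup>2 / (2 * c) * b\<^sup>2"
proof -
  have "0 \<le> (c * a - s * b)\<^sup>2 / (2 * c)"
    using assms by simp
  also have "\<dots> = c / 2 * a\<^sup>2 + s\<^sup>2 / (2 * c) * b\<^sup>2 - s * b * a"
    using assms by (simp add: power2_eq_square field_simps)
  finally show ?thesis by simp
qed

lemma block_update_idem [simp]: "block_update (block_update x i u) i w = block_update x i w"
  by (simp add: vec_eq_iff block_update_nth)

lemma objective_block_update:
  "objective f r (block_update y i u) =
    r i u + ereal (f (block_update y i u)) + (\<Sum>l\<in>UNIV - {i}. r l (y $ l))"
proof -
  have "(\<Sum>l\<in>UNIV. r l (block_update y i u $ l)) = r i u + (\<Sum>l\<in>UNIV - {i}. r l (y $ l))"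
    by (subst sum.remove[of _ i]) (auto simp: block_update_nth intro!: arg_cong2[where f = "(+)"] sum.cong)
  then show ?thesis
    by (simp add: objective_def add_ac)
qed

text \<open>The untouched blocks are added to both sides instead of being cancelled, so their values
  may be infinite.\<close>

lemma objective_block_update_le:
  assumes "r i u + ereal (f (block_update y i u) + a) \<le> r i (y $ i) + ereal (f y + b)"
  shows "objective f r (block_update y i u) + ereal a \<le> objective f r y + ereal b"
proof -
  let ?s = "\<Sum>l\<in>UNIV - {i}. r l (y $ l)"
  have "objective f r (block_update y i u) + ereal a = (r i u + ereal (f (block_update y i u) + a)) + ?s"
    by (simp only: objective_block_update plus_ereal.simps(1)[symmetric] add_ac)
  also have "\<dots> \<le> (r i (y $ i) + ereal (f y + b)) + ?s"
    by (intro add_right_mono assms)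
  also have "\<dots> = objective f r y + ereal b"
    using objective_block_update[of f r y i "y $ i"]
    by (simp only: block_update_self plus_ereal.simps(1)[symmetric] add_ac)
  finally show ?thesis .
qed

locale block_step =
  fixes V :: "'s::finite \<Rightarrow> 'b::euclidean_space set" and f :: "'b ^ 's \<Rightarrow> real"
    and r :: "'s \<Rightarrow> 'b \<Rightarrow> ereal" and H :: "'s \<Rightarrow> 'b \<Rightarrow> real" and \<sigma> LH :: "'s \<Rightarrow> real"
    and y :: "'b ^ 's" and q u :: 'b and i :: 's and \<alpha> \<beta> amax bmax :: real
  assumes problem: "composite_problem V f r" and C1: "C1_on (prod_space V) f"
    and kernels: "bregman_kernels V H \<sigma> LH"
    and y: "y \<in> prod_space V" and q: "q \<in> V i" and u: "u \<in> V i"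
    and \<alpha>: "0 \<le> \<alpha>" "\<alpha> \<le> amax" and \<beta>: "0 < \<beta>" "1 / \<beta> \<le> bmax"
begin

abbreviation "P \<equiv> prod_space V"
abbreviation "G \<equiv> gradient_on P f"
abbreviation "g \<equiv> gradient_on (V i) (block_fun f y i)"
abbreviation "y' \<equiv> block_update y i u"
abbreviation "xhat \<equiv> y $ i + \<alpha> *\<^sub>R (y $ i - q)"

lemma subspace_V: "subspace (V i)"
  using problem by (simp add: composite_problem_def)

lemma subspace_P: "subspace P"
  using problem by (intro subspace_prod_space) (simp add: composite_problem_def)

lemma yi: "y $ i \<in> V i"
  using y by (simp add: prod_space_def)

lemma kernel:
  "H i differentiable_on V i" "strongly_convex_on (\<sigma> i) (V i) (H i)" "0 < \<sigma> i"
  "(LH i)-lipschitz_on (V i) (gradient_on (V i) (H i))"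
  using kernels by (auto simp: bregman_kernels_def C1_on_def)

lemma LH_nonneg: "0 \<le> LH i"
  using kernel(4) by (rule lipschitz_on_nonneg)

lemma amax_nonneg: "0 \<le> amax"
  using \<alpha> by simp

lemma bmax_nonneg: "0 \<le> bmax"
  using \<beta> by (meson divide_nonneg_pos order_trans zero_le_one)

text \<open>Identifies the partial gradients of the algorithm with blocks of the full gradient, by
  uniqueness of the gradient within \<open>V i\<close>.\<close>

lemma block_gradient:
  assumes w: "w \<in> V i"
  shows "g w = G (block_update y i w) $ i"
    and "g w \<in> V i" and "(block_fun f y i has_derivative (\<lambda>h. g w \<bullet> h)) (at w within V i)"
proof -
  have z: "block_update y i w \<in> P"
    using y w by (rule block_update_in_prod_space)
  note G = gradient_on_works[OF subspace_P z, of f]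
  have G: "G (block_update y i w) \<in> P" "(f has_derivative (\<lambda>h. G (block_update y i w) \<bullet> h)) (at (block_update y i w) within P)"
    using G C1 z by (auto simp: C1_on_def differentiable_on_def)
  have Gi: "G (block_update y i w) $ i \<in> V i"
    using G(1) by (simp add: prod_space_def)
  have der: "(block_fun f y i has_derivative (\<lambda>h. G (block_update y i w) $ i \<bullet> h)) (at w within V i)"
    by (rule has_derivative_block_fun[OF y w G(2)])
  show eq: "g w = G (block_update y i w) $ i"
    by (rule gradient_on_eqI[OF subspace_V w Gi der])
  show "g w \<in> V i" "(block_fun f y i has_derivative (\<lambda>h. g w \<bullet> h)) (at w within V i)"
    using Gi der by (simp_all add: eq)
qed

lemma block_fun_differentiable: "block_fun f y i differentiable_on V i"
  using block_gradient(3) by (auto simp: differentiable_on_def differentiable_def)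

lemma norm_step: "norm (y' - y) = norm (u - y $ i)"
  using norm_block_update_diff[of y i u "y $ i"] by simp

lemma prox_stepI:
  assumes "\<And>w. w \<in> V i \<Longrightarrow>
      r i u + ereal (h u + 1 / \<beta> * bregman_dist (V i) (H i) u xhat)
        \<le> r i w + ereal (h w + 1 / \<beta> * bregman_dist (V i) (H i) w xhat)"
  shows "prox_step (V i) (H i) (r i) h (\<sigma> i) (LH i) \<alpha> \<beta> amax bmax (y $ i) q u"
  using assms kernel subspace_V yi q u \<alpha> \<beta> problem
  by unfold_locales (auto simp: composite_problem_def)

lemma IBP_descent_step:
  assumes min: "\<And>w. w \<in> V i \<Longrightarrow>
      step_objective IBP V f r H \<alpha> \<beta> \<gamma> y q i u \<le> step_objective IBP V f r H \<alpha> \<beta> \<gamma> y q i w"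
    and \<nu>: "0 < \<nu>" and W: "(LH i * \<alpha>)\<^sup>2 / (2 * \<nu> * \<sigma> i * \<beta>) \<le> W"
    and A: "A \<le> (1 - \<nu>) * \<sigma> i / (2 * \<beta>)" and K: "bmax * LH i * (1 + amax)\<^sup>2 \<le> K"
  shows "descent_step V f r A W K y q i y'"
proof -
  interpret prox: prox_step "V i" "H i" "r i" "block_fun f y i" "\<sigma> i" "LH i" \<alpha> \<beta> amax bmax "y $ i" q u
  proof (rule prox_stepI)
    fix w assume "w \<in> V i"
    from min[OF this] show "r i u + ereal (block_fun f y i u + 1 / \<beta> * bregman_dist (V i) (H i) u xhat)
        \<le> r i w + ereal (block_fun f y i w + 1 / \<beta> * bregman_dist (V i) (H i) w xhat)"
      by (simp only: step_objective_def Let_def block_scheme.case plus_ereal.simps(1)[symmetric] add_ac)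
  qed
  let ?a = "norm (u - y $ i)" and ?b = "norm (y $ i - q)"
  have "A * ?a\<^sup>2 - W * ?b\<^sup>2 \<le> 1 / \<beta> * (\<sigma> i / 2 * ?a\<^sup>2 - LH i * \<alpha> * ?b * ?a)"
  proof -
    \<comment> \<open>The share \<open>\<nu>\<close> of the strong convexity term pays for the cross
      term. After division by \<open>\<beta>\<close> the resulting coefficient of
      \<open>?b\<^sup>2\<close> is the weight theta, and the share \<open>1 - \<nu>\<close> is left
      for the descent.\<close>
    have "LH i * \<alpha> * ?b * ?a \<le> \<nu> * \<sigma> i / 2 * ?a\<^sup>2 + (LH i * \<alpha>)\<^sup>2 / (2 * (\<nu> * \<sigma> i)) * ?b\<^sup>2"
      using \<nu> kernel(3) by (intro young_le) simp
    then have "1 / \<beta> * (\<sigma> i / 2 * ?a\<^sup>2 - (\<nu> * \<sigma> i / 2 * ?a\<^sup>2 + (LH i * \<alpha>)\<^sup>2 / (2 * (\<nu> * \<sigma> i)) * ?b\<^sup>2))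
        \<le> 1 / \<beta> * (\<sigma> i / 2 * ?a\<^sup>2 - LH i * \<alpha> * ?b * ?a)"
      using \<beta> by (intro mult_left_mono) auto
    moreover have "1 / \<beta> * (\<sigma> i / 2 * ?a\<^sup>2 - (\<nu> * \<sigma> i / 2 * ?a\<^sup>2 + (LH i * \<alpha>)\<^sup>2 / (2 * (\<nu> * \<sigma> i)) * ?b\<^sup>2))
        = (1 - \<nu>) * \<sigma> i / (2 * \<beta>) * ?a\<^sup>2 - (LH i * \<alpha>)\<^sup>2 / (2 * \<nu> * \<sigma> i * \<beta>) * ?b\<^sup>2"
      using \<beta> \<nu> kernel(3) by (simp add: field_simps)
    moreover have "A * ?a\<^sup>2 \<le> (1 - \<nu>) * \<sigma> i / (2 * \<beta>) * ?a\<^sup>2"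
      "(LH i * \<alpha>)\<^sup>2 / (2 * \<nu> * \<sigma> i * \<beta>) * ?b\<^sup>2 \<le> W * ?b\<^sup>2"
      using A W by (intro mult_right_mono; simp)+
    ultimately show ?thesis
      by linarith
  qed
  with prox.descent have "r i u + ereal (f y' + A * ?a\<^sup>2) \<le> r i (y $ i) + ereal (f y + W * ?b\<^sup>2)"
    by (cases "r i u"; cases "r i (y $ i)") (auto simp: block_fun_def)
  note 1 = objective_block_update_le[of r i u f y, OF this]
  have 2: "\<exists>\<xi>\<in>frechet_subdiff (V i) (r i) u. norm (\<xi> + G y' $ i) \<le> K * (?a + ?b)"
  proof -
    have "bmax * LH i * (1 + amax) \<le> bmax * LH i * (1 + amax)\<^sup>2"
      using amax_nonneg bmax_nonneg LH_nonneg by (intro mult_left_mono) (auto simp: power2_eq_square algebra_simps)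
    then have "bmax * LH i * (1 + amax) * (?a + ?b) \<le> K * (?a + ?b)"
      using K by (intro mult_right_mono) auto
    with prox.subgradient[OF block_gradient(2,3)[OF u]] show ?thesis
      unfolding block_gradient(1)[OF u] by (meson order_trans)
  qed
  \<comment> \<open>The minimized function contains \<open>f\<close> itself. The descent lemma on
    \<open>B\<close> replaces its increment by the gradient at the new point, which accounts for
    \<open>M\<close>.\<close>
  have 3: "r i u \<le> r i w + ereal (G y' $ i \<bullet> (w - u) + (M + K) * e\<^sup>2)"
    if B: "B \<subseteq> P" "convex B" and M: "M-lipschitz_on B G" and mem: "y' \<in> B" "w \<in> V i" "block_update y i w \<in> B"
      and e: "e = norm (w - u) + ?a + ?b" for B M w e
  proof -
    have "f (block_update y i w) \<le> f y' + G y' \<bullet> (block_update y i w - y')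
        + M / 2 * (norm (block_update y i w - y'))\<^sup>2"
      using C1 by (intro descent_lemma_on[OF subspace_P _ B M mem(1,3)]) (simp add: C1_on_def)
    also have "G y' \<bullet> (block_update y i w - y') = G y' $ i \<bullet> (w - u)"
      unfolding block_update_eq[of y i w u] by (simp add: inner_axis)
    also have "norm (block_update y i w - y') = norm (w - u)"
      by (rule norm_block_update_diff)
    finally have "f (block_update y i w) - f y' \<le> G y' $ i \<bullet> (w - u) + M / 2 * (norm (w - u))\<^sup>2"
      by simp
    moreover have "M / 2 * (norm (w - u))\<^sup>2 \<le> M * e\<^sup>2"
      using lipschitz_on_nonneg[OF M] unfolding e by (intro mult_mono power_mono) auto
    moreover have "bmax * LH i * (1 + amax)\<^sup>2 * e\<^sup>2 \<le> K * e\<^sup>2"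
      using K by (intro mult_right_mono) auto
    ultimately have "block_fun f y i w - block_fun f y i u + bmax * LH i * (1 + amax)\<^sup>2 * e\<^sup>2
        \<le> G y' $ i \<bullet> (w - u) + (M + K) * e\<^sup>2"
      by (simp add: block_fun_def distrib_right)
    then have "r i w + ereal (block_fun f y i w - block_fun f y i u + bmax * LH i * (1 + amax)\<^sup>2 * e\<^sup>2)
        \<le> r i w + ereal (G y' $ i \<bullet> (w - u) + (M + K) * e\<^sup>2)"
      by (intro add_left_mono) simp
    with prox.value_le[OF mem(2) e] show ?thesis
      by (rule order_trans)
  qed
  show ?thesis
    using 1 2 3 by (simp add: descent_step_def norm_step block_update_nth)
qed

text \<open>The choice of \<open>\<beta>\<close> turns the strong convexity term into
  \<open>\<kappa> * L / 2\<close> times the squared move. Linearizing \<open>f\<close> costs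
  \<open>L / 2\<close> of it, and a share \<open>\<nu>\<close> of the remaining
  \<open>(\<kappa> - 1) * L / 2\<close> pays for the cross terms.\<close>

lemma IBPG_descent_step:
  assumes min: "\<And>w. w \<in> V i \<Longrightarrow>
      step_objective IBPG V f r H \<alpha> \<beta> \<gamma> y q i u \<le> step_objective IBPG V f r H \<alpha> \<beta> \<gamma> y q i w"
    and \<nu>: "0 < \<nu>" and \<kappa>: "1 < \<kappa>" and \<gamma>: "0 \<le> \<gamma>" "\<gamma> \<le> cmax"
    and L: "0 < L" "L \<le> Lmax" "L-lipschitz_on (V i) g" and \<beta>_eq: "\<beta> = \<sigma> i / (\<kappa> * L)"
    and W: "1 / 2 * (\<gamma> + \<kappa> * LH i * \<alpha> / \<sigma> i)\<^sup>2 * (L / (\<nu> * (\<kappa> - 1))) \<le> W"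
    and A: "A \<le> (1 - \<nu>) * (\<kappa> - 1) * L / 2"
    and K: "bmax * LH i * (1 + amax)\<^sup>2 + Lmax * (1 + cmax) \<le> K"
  shows "descent_step V f r A W K y q i y'"
proof -
  let ?xg = "y $ i + \<gamma> *\<^sub>R (y $ i - q)"
  interpret prox: prox_step "V i" "H i" "r i" "\<lambda>w. g ?xg \<bullet> w" "\<sigma> i" "LH i" \<alpha> \<beta> amax bmax "y $ i" q u
  proof (rule prox_stepI)
    fix w assume "w \<in> V i"
    from min[OF this] show "r i u + ereal (g ?xg \<bullet> u + 1 / \<beta> * bregman_dist (V i) (H i) u xhat)
        \<le> r i w + ereal (g ?xg \<bullet> w + 1 / \<beta> * bregman_dist (V i) (H i) w xhat)"
      by (simp only: step_objective_def Let_def block_scheme.case plus_ereal.simps(1)[symmetric] add_ac)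
  qed
  let ?a = "norm (u - y $ i)" and ?b = "norm (y $ i - q)"
  have xg: "?xg \<in> V i"
    using subspace_V yi q by (intro subspace_add subspace_scale subspace_diff)
  have xg_y: "norm (?xg - y $ i) = \<gamma> * ?b"
    using \<gamma> by simp
  have xg_u: "norm (g ?xg - g u) \<le> Lmax * (1 + cmax) * (?a + ?b)"
  proof -
    have "norm (g ?xg - g u) \<le> L * norm (?xg - u)"
      by (rule lipschitz_on_normD[OF L(3) xg u])
    also have "\<dots> \<le> Lmax * ((1 + cmax) * (?a + ?b))"
    proof (rule mult_mono)
      have "norm (?xg - u) \<le> norm (?xg - y $ i) + ?a"
        by (metis dist_norm dist_triangle norm_minus_commute)
      also have "\<dots> \<le> cmax * ?b + ?a"
        unfolding xg_y using \<gamma> by (simp add: mult_right_mono)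
      also have "\<dots> \<le> (1 + cmax) * (?a + ?b)"
        using \<gamma> by (simp add: algebra_simps)
      finally show "norm (?xg - u) \<le> (1 + cmax) * (?a + ?b)" .
    qed (use L in auto)
    finally show ?thesis
      by (simp add: mult.assoc)
  qed
  have smooth: "f y' \<le> f y + g (y $ i) \<bullet> (u - y $ i) + L / 2 * ?a\<^sup>2"
    using descent_lemma_on[OF subspace_V block_fun_differentiable order_refl
        subspace_imp_convex[OF subspace_V] L(3) yi u] by (simp add: block_fun_def)
  have "A * ?a\<^sup>2 - W * ?b\<^sup>2 \<le> 1 / \<beta> * (\<sigma> i / 2 * ?a\<^sup>2 - LH i * \<alpha> * ?b * ?a)
      + (g ?xg \<bullet> (u - y $ i) - g (y $ i) \<bullet> (u - y $ i)) - L / 2 * ?a\<^sup>2"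
  proof -
    \<comment> \<open>Two cross terms are collected: the gradient at the extrapolated point
      contributes \<open>L * \<gamma>\<close>, the inertia in the Bregman term contributes
      \<open>LH i * \<alpha> / \<beta>\<close>, which is
      \<open>L * (\<kappa> * LH i * \<alpha> / \<sigma> i)\<close>.\<close>
    let ?s = "\<gamma> + \<kappa> * LH i * \<alpha> / \<sigma> i"
    have "g (y $ i) \<bullet> (u - y $ i) - g ?xg \<bullet> (u - y $ i) \<le> norm (g ?xg - g (y $ i)) * ?a"
      using norm_cauchy_schwarz[of "g (y $ i) - g ?xg" "u - y $ i"]
      by (simp add: inner_diff_left norm_minus_commute)
    also have "\<dots> \<le> (L * norm (?xg - y $ i)) * ?a"
      by (intro mult_right_mono lipschitz_on_normD[OF L(3) xg yi]) simp
    finally have lip: "g (y $ i) \<bullet> (u - y $ i) - g ?xg \<bullet> (u - y $ i) \<le> L * (\<gamma> * ?b) * ?a"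
      unfolding xg_y .
    have "L * (?s * ?b * ?a) \<le> L * (\<nu> * (\<kappa> - 1) / 2 * ?a\<^sup>2 + ?s\<^sup>2 / (2 * (\<nu> * (\<kappa> - 1))) * ?b\<^sup>2)"
      using \<nu> \<kappa> L by (intro mult_left_mono young_le) auto
    also have "\<dots> = L * \<nu> * (\<kappa> - 1) / 2 * ?a\<^sup>2 + 1 / 2 * ?s\<^sup>2 * (L / (\<nu> * (\<kappa> - 1))) * ?b\<^sup>2"
      by (simp add: distrib_left mult_ac)
    finally have young: "L * (?s * ?b * ?a) \<le>
      L * \<nu> * (\<kappa> - 1) / 2 * ?a\<^sup>2 + 1 / 2 * ?s\<^sup>2 * (L / (\<nu> * (\<kappa> - 1))) * ?b\<^sup>2" .
    have "1 / \<beta> * (\<sigma> i / 2 * ?a\<^sup>2 - LH i * \<alpha> * ?b * ?a) = \<kappa> * L / 2 * ?a\<^sup>2 - L * ((?s - \<gamma>) * ?b * ?a)"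
      using kernel(3) by (simp add: \<beta>_eq field_simps)
    also have "L * ((?s - \<gamma>) * ?b * ?a) = L * (?s * ?b * ?a) - L * (\<gamma> * ?b) * ?a"
      by (simp only: left_diff_distrib right_diff_distrib mult.assoc)
    finally have prox: "1 / \<beta> * (\<sigma> i / 2 * ?a\<^sup>2 - LH i * \<alpha> * ?b * ?a) =
        \<kappa> * L / 2 * ?a\<^sup>2 - (L * (?s * ?b * ?a) - L * (\<gamma> * ?b) * ?a)" .
    have "A * ?a\<^sup>2 \<le> (1 - \<nu>) * (\<kappa> - 1) * L / 2 * ?a\<^sup>2"
      using A by (intro mult_right_mono) simp_all
    moreover have "1 / 2 * ?s\<^sup>2 * (L / (\<nu> * (\<kappa> - 1))) * ?b\<^sup>2 \<le> W * ?b\<^sup>2"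
      using W by (intro mult_right_mono) simp_all
    moreover have "(1 - \<nu>) * (\<kappa> - 1) * L / 2 * ?a\<^sup>2 =
        \<kappa> * L / 2 * ?a\<^sup>2 - L / 2 * ?a\<^sup>2 - L * \<nu> * (\<kappa> - 1) / 2 * ?a\<^sup>2"
      by (simp add: field_simps)
    ultimately show ?thesis
      using lip young prox by linarith
  qed
  with prox.descent smooth have "r i u + ereal (f y' + A * ?a\<^sup>2) \<le> r i (y $ i) + ereal (f y + W * ?b\<^sup>2)"
    by (cases "r i u"; cases "r i (y $ i)") (auto simp: inner_diff_right)
  note 1 = objective_block_update_le[of r i u f y, OF this]
  have K0: "0 \<le> bmax * LH i * (1 + amax)\<^sup>2" "0 \<le> Lmax * (1 + cmax)"
    using bmax_nonneg LH_nonneg L \<gamma> by auto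
  \<comment> \<open>The optimality condition contains the gradient at the extrapolated point;
    exchanging it for the one at \<open>u\<close> produces the second summand of the bound on
    \<open>K\<close>.\<close>
  have 2: "\<exists>\<xi>\<in>frechet_subdiff (V i) (r i) u. norm (\<xi> + G y' $ i) \<le> K * (?a + ?b)"
  proof -
    have "((\<lambda>w. g ?xg \<bullet> w) has_derivative (\<lambda>d. g ?xg \<bullet> d)) (at u within V i)"
      by (rule bounded_linear_imp_has_derivative) (rule bounded_linear_inner_right)
    from prox.subgradient[OF block_gradient(2)[OF xg] this] obtain \<xi> where
      \<xi>: "\<xi> \<in> frechet_subdiff (V i) (r i) u"
        "norm (\<xi> + g ?xg) \<le> bmax * LH i * (1 + amax) * (?a + ?b)"
      by blast
    have "norm (\<xi> + g u) = norm ((\<xi> + g ?xg) - (g ?xg - g u))"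
      by simp
    also have "\<dots> \<le> norm (\<xi> + g ?xg) + norm (g ?xg - g u)"
      by (rule norm_triangle_ineq4)
    also have "\<dots> \<le> bmax * LH i * (1 + amax) * (?a + ?b) + Lmax * (1 + cmax) * (?a + ?b)"
      by (intro add_mono \<xi>(2) xg_u)
    also have "\<dots> = (bmax * LH i * (1 + amax) + Lmax * (1 + cmax)) * (?a + ?b)"
      by (simp only: distrib_right)
    also have "\<dots> \<le> K * (?a + ?b)"
    proof (rule mult_right_mono)
      have "bmax * LH i * (1 + amax) \<le> bmax * LH i * (1 + amax)\<^sup>2"
        using amax_nonneg bmax_nonneg LH_nonneg by (intro mult_left_mono) (auto simp: power2_eq_square algebra_simps)
      with K show "bmax * LH i * (1 + amax) + Lmax * (1 + cmax) \<le> K"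
        by simp
    qed simp
    finally show ?thesis
      using \<xi>(1) unfolding block_gradient(1)[OF u] by blast
  qed
  \<comment> \<open>The linear model has slope \<open>g ?xg\<close> instead of \<open>g u\<close>;
    the error of this exchange is a product of two lengths bounded by \<open>e\<close>.\<close>
  have 3: "r i u \<le> r i w + ereal (G y' $ i \<bullet> (w - u) + (M + K) * e\<^sup>2)"
    if M: "M-lipschitz_on B G" and w: "w \<in> V i" and e: "e = norm (w - u) + ?a + ?b" for B M w e
  proof -
    have e0: "0 \<le> e" "?a + ?b \<le> e" "norm (w - u) \<le> e"
      by (simp_all add: e)
    have "g ?xg \<bullet> (w - u) - g u \<bullet> (w - u) \<le> norm (g ?xg - g u) * norm (w - u)"
      by (metis inner_diff_left norm_cauchy_schwarz)
    also have "\<dots> \<le> (Lmax * (1 + cmax) * e) * e"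
    proof (rule mult_mono)
      have "Lmax * (1 + cmax) * (?a + ?b) \<le> Lmax * (1 + cmax) * e"
        using K0 e0 by (intro mult_left_mono)
      with xg_u show "norm (g ?xg - g u) \<le> Lmax * (1 + cmax) * e"
        by (rule order_trans)
    qed (use K0 e0 in auto)
    finally have "g ?xg \<bullet> w - g ?xg \<bullet> u \<le> G y' $ i \<bullet> (w - u) + Lmax * (1 + cmax) * e\<^sup>2"
      unfolding block_gradient(1)[OF u] by (simp add: inner_diff_right power2_eq_square)
    moreover have "(bmax * LH i * (1 + amax)\<^sup>2 + Lmax * (1 + cmax)) * e\<^sup>2 \<le> (M + K) * e\<^sup>2"
      using K lipschitz_on_nonneg[OF M] by (intro mult_right_mono) auto
    ultimately have "g ?xg \<bullet> w - g ?xg \<bullet> u + bmax * LH i * (1 + amax)\<^sup>2 * e\<^sup>2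
        \<le> G y' $ i \<bullet> (w - u) + (M + K) * e\<^sup>2"
      by (simp only: distrib_right)
    then have "r i w + ereal (g ?xg \<bullet> w - g ?xg \<bullet> u + bmax * LH i * (1 + amax)\<^sup>2 * e\<^sup>2)
        \<le> r i w + ereal (G y' $ i \<bullet> (w - u) + (M + K) * e\<^sup>2)"
      by (intro add_left_mono) simp
    with prox.value_le[OF w e] show ?thesis
      by (rule order_trans)
  qed
  show ?thesis
    using 1 2 3 by (simp add: descent_step_def norm_step block_update_nth)
qed

end

subsection \<open>Parameters along the updates of a block\<close>

text \<open>Translates between the two indexings of the parameters: \<open>m\<close> is the number
  of updates of block \<open>i\<close> up to and including step \<open>j\<close>.\<close>

lemma at_update_eq:
  assumes j: "j \<in> {1..T k}" and i: "blk k j = i"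
  shows "\<exists>m\<in>{1..num_updates T blk i k}. \<forall>a. at_update blk a i k m = a k j"
proof (intro bexI allI)
  let ?U = "\<lambda>n. {l \<in> {1..n}. blk k l = i}"
  let ?m = "card (?U j)"
  have "j \<in> ?U j"
    using j i by simp
  then have "0 < ?m"
    by (auto simp: card_gt_0_iff)
  moreover have "?m \<le> num_updates T blk i k"
    unfolding num_updates_def using j by (intro card_mono) auto
  ultimately show "?m \<in> {1..num_updates T blk i k}"
    by simp
  have "update_step blk i k ?m = j"
    unfolding update_step_def
  proof (rule Least_equality)
    fix n assume n: "card (?U n) = ?m"
    \<comment> \<open>Step \<open>j\<close> is itself an update of the block, so the count is
      strictly smaller before it.\<close>
    show "j \<le> n"
    proof (rule ccontr)
      assume "\<not> j \<le> n"
      then have "?U n \<subseteq> ?U j" "j \<notin> ?U n"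
        by auto
      then have "?U n \<subset> ?U j"
        using \<open>j \<in> ?U j\<close> by blast
      then have "card (?U n) < ?m"
        by (intro psubset_card_mono) auto
      with n show False by simp
    qed
  qed simp
  then show "at_update blk a i k ?m = a k j" for a
    by (simp add: at_update_def)
qed

lemma num_updates_pos:
  assumes "blk k ` {1..T k} = UNIV"
  shows "1 \<le> num_updates T blk i k"
proof -
  obtain j where j: "j \<in> {1..T k}" "blk k j = i"
    using assms by (metis UNIV_I image_iff)
  from at_update_eq[of j T k blk i, OF j] show ?thesis
    by auto
qed

text \<open>Past the last update in a loop the weight is that of the first update in the next loop,
  which exists because every loop updates every block.\<close>

lemma roll_over_ge:
  assumes cyc: "\<And>k. 1 \<le> k \<Longrightarrow> blk k ` {1..T k} = UNIV" and k: "1 \<le> k"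
    and ge: "\<And>k m. 1 \<le> k \<Longrightarrow> m \<in> {1..num_updates T blk i k} \<Longrightarrow> c \<le> roll_over T blk w i k m"
  shows "c \<le> roll_over T blk w i k (m + 1)"
proof (cases "m + 1 \<le> num_updates T blk i k")
  case False
  have "1 \<le> num_updates T blk i (k + 1)"
    using k by (intro num_updates_pos cyc) simp
  then have "c \<le> roll_over T blk w i (k + 1) 1"
    using k by (intro ge) auto
  then show ?thesis
    using False \<open>1 \<le> num_updates T blk i (k + 1)\<close> by (simp add: roll_over_def)
qed (use ge[OF k] in simp)

text \<open>Replaces the coupling of consecutive weights by constants: the descent coefficient is at
  least \<open>\<delta>\<close> times the next weight, and that weight is at least
  \<open>W\<^sub>1\<close>.\<close>

lemma IBP_parameters_at:
  assumes cyc: "\<And>k. 1 \<le> k \<Longrightarrow> blk k ` {1..T k} = UNIV"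
    and pos: "0 \<le> \<delta>"
    and params: "IBP_parameters \<nu> \<delta> \<sigma> LH \<alpha> \<beta> T blk"
    and bounds: "IBP_bounds W\<^sub>1 \<nu> \<sigma> LH \<alpha> \<beta> T blk"
    and upper: "\<And>k i m. 1 \<le> k \<Longrightarrow> m \<in> {1..num_updates T blk i k} \<Longrightarrow>
      theta_weight \<nu> \<sigma> LH \<alpha> \<beta> T blk i k m \<le> W\<^sub>2"
  obtains amax bmin where "0 < amax" "0 < bmin"
    "\<And>k j i. 1 \<le> k \<Longrightarrow> j \<in> {1..T k} \<Longrightarrow> i = blk k j \<Longrightarrow>
      0 \<le> \<alpha> k j \<and> \<alpha> k j \<le> amax \<and> 0 < \<beta> k j \<and> bmin \<le> \<beta> k j \<and>
      W\<^sub>1 \<le> (LH i * \<alpha> k j)\<^sup>2 / (2 * \<nu> * \<sigma> i * \<beta> k j) \<and>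
      (LH i * \<alpha> k j)\<^sup>2 / (2 * \<nu> * \<sigma> i * \<beta> k j) \<le> W\<^sub>2 \<and>
      \<delta> * W\<^sub>1 \<le> (1 - \<nu>) * \<sigma> i / (2 * \<beta> k j)"
proof -
  let ?\<theta> = "theta_weight \<nu> \<sigma> LH \<alpha> \<beta> T blk"
  obtain amax bmin where amax: "0 < amax" "0 < bmin" and
    b: "\<And>k i m. 1 \<le> k \<Longrightarrow> m \<in> {1..num_updates T blk i k} \<Longrightarrow>
      W\<^sub>1 \<le> ?\<theta> i k m \<and> at_update blk \<alpha> i k m \<le> amax \<and> bmin \<le> at_update blk \<beta> i k m"
    using bounds unfolding IBP_bounds_def by blast
  show thesis
  proof (rule that[OF amax], goal_cases)
    case (1 k j i)
    obtain m where m: "m \<in> {1..num_updates T blk i k}" and at: "\<And>a. at_update blk a i k m = a k j"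
      using at_update_eq[of j T k blk i] 1(2,3) by blast
    have \<theta>: "?\<theta> i k m = (LH i * \<alpha> k j)\<^sup>2 / (2 * \<nu> * \<sigma> i * \<beta> k j)"
      using m by (simp add: theta_weight_def roll_over_def at)
    have "W\<^sub>1 \<le> ?\<theta> i k (m + 1)"
      unfolding theta_weight_def by (rule roll_over_ge[OF cyc 1(1)]) (use b in \<open>auto simp: theta_weight_def\<close>)
    then have "\<delta> * W\<^sub>1 \<le> \<delta> * ?\<theta> i k (m + 1)"
      using pos by (rule mult_left_mono)
    also have "\<dots> \<le> (1 - \<nu>) * \<sigma> i / (2 * \<beta> k j)"
      using params 1(1) m at[of \<beta>] unfolding IBP_parameters_def by metis
    finally show ?case
      using params 1 b[OF 1(1) m] upper[OF 1(1) m] unfolding \<theta> at by (simp add: IBP_parameters_def)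
  qed
qed

lemma IBPG_parameters_at:
  assumes cyc: "\<And>k. 1 \<le> k \<Longrightarrow> blk k ` {1..T k} = UNIV"
    and pos: "0 \<le> \<delta>"
    and params: "IBPG_parameters V f \<nu> \<delta> \<kappa> \<sigma> LH \<alpha> \<beta> \<gamma> L T blk x"
    and bounds: "IBPG_bounds W\<^sub>1 \<nu> \<kappa> \<sigma> LH \<alpha> \<gamma> L T blk"
    and upper: "\<And>k i m. 1 \<le> k \<Longrightarrow> m \<in> {1..num_updates T blk i k} \<Longrightarrow>
      lambda_weight \<nu> \<kappa> \<sigma> LH \<alpha> \<gamma> L T blk i k m \<le> W\<^sub>2"
  obtains Lmax amax cmax where "0 < Lmax" "0 < amax" "0 < cmax"
    "\<And>k j i. 1 \<le> k \<Longrightarrow> j \<in> {1..T k} \<Longrightarrow> i = blk k j \<Longrightarrow>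
      0 \<le> \<alpha> k j \<and> \<alpha> k j \<le> amax \<and> 0 \<le> \<gamma> k j \<and> \<gamma> k j \<le> cmax \<and> 0 < L k j \<and> L k j \<le> Lmax \<and>
      (L k j)-lipschitz_on (V i) (gradient_on (V i) (block_fun f (x k (j - 1)) i)) \<and>
      0 < \<beta> k j \<and> \<beta> k j = \<sigma> i / (\<kappa> * L k j) \<and>
      W\<^sub>1 \<le> 1 / 2 * (\<gamma> k j + \<kappa> * LH i * \<alpha> k j / \<sigma> i)\<^sup>2 * (L k j / (\<nu> * (\<kappa> - 1))) \<and>
      1 / 2 * (\<gamma> k j + \<kappa> * LH i * \<alpha> k j / \<sigma> i)\<^sup>2 * (L k j / (\<nu> * (\<kappa> - 1))) \<le> W\<^sub>2 \<and>
      \<delta> * W\<^sub>1 \<le> (1 - \<nu>) * (\<kappa> - 1) * L k j / 2"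
proof -
  let ?lam = "lambda_weight \<nu> \<kappa> \<sigma> LH \<alpha> \<gamma> L T blk"
  obtain Lmax amax cmax where max: "0 < Lmax" "0 < amax" "0 < cmax" and
    b: "\<And>k i m. 1 \<le> k \<Longrightarrow> m \<in> {1..num_updates T blk i k} \<Longrightarrow>
      W\<^sub>1 \<le> ?lam i k m \<and> at_update blk L i k m \<le> Lmax \<and> at_update blk \<alpha> i k m \<le> amax \<and>
      at_update blk \<gamma> i k m \<le> cmax"
    using bounds unfolding IBPG_bounds_def by blast
  show thesis
  proof (rule that[OF max], goal_cases)
    case (1 k j i)
    obtain m where m: "m \<in> {1..num_updates T blk i k}" and at: "\<And>a. at_update blk a i k m = a k j"
      using at_update_eq[of j T k blk i] 1(2,3) by blast
    have lam: "?lam i k m = 1 / 2 * (\<gamma> k j + \<kappa> * LH i * \<alpha> k j / \<sigma> i)\<^sup>2 * (L k j / (\<nu> * (\<kappa> - 1)))"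
      using m by (simp add: lambda_weight_def roll_over_def at)
    have "W\<^sub>1 \<le> ?lam i k (m + 1)"
      unfolding lambda_weight_def by (rule roll_over_ge[OF cyc 1(1)]) (use b in \<open>auto simp: lambda_weight_def\<close>)
    then have "\<delta> * W\<^sub>1 \<le> \<delta> * ?lam i k (m + 1)"
      using pos by (rule mult_left_mono)
    also have "\<dots> \<le> (1 - \<nu>) * (\<kappa> - 1) * L k j / 2"
      using params 1(1) m at[of L] unfolding IBPG_parameters_def by metis
    finally have "\<delta> * W\<^sub>1 \<le> (1 - \<nu>) * (\<kappa> - 1) * L k j / 2" .
    moreover have "\<beta> k j = \<sigma> i / (\<kappa> * L k j)"
      using params 1(1) m at[of L] at[of \<beta>] unfolding IBPG_parameters_def by metis
    moreover have "0 \<le> \<alpha> k j \<and> 0 < \<beta> k j \<and> 0 \<le> \<gamma> k j \<and> 0 < L k j \<and>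
        (L k j)-lipschitz_on (V i) (gradient_on (V i) (block_fun f (x k (j - 1)) i))"
      using params 1 unfolding IBPG_parameters_def by blast
    ultimately show ?case
      using b[OF 1(1) m] upper[OF 1(1) m] unfolding lam at by simp
  qed
qed

text \<open>
  If every modulus \<open>LH i\<close> is below \<open>\<sigma> i\<close>, all spaces \<open>V i\<close> are trivial and no step moves; only then
  can \<open>\<delta> W\<^sub>1 \<le> W\<^sub>2\<close> occur.
\<close>

lemma descent_constant:
  assumes kernels: "bregman_kernels V H \<sigma> LH" and V: "\<And>i. subspace (V i)"
    and W: "0 < W\<^sub>1" "0 < W\<^sub>2" and delta: "\<delta> > Max (range LH) * W\<^sub>2 / (Min (range \<sigma>) * W\<^sub>1)"
  obtains A where "W\<^sub>2 < A" "\<And>i u v. u \<in> V i \<Longrightarrow> v \<in> V i \<Longrightarrow> A * (norm (u - v))\<^sup>2 \<le> \<delta> * W\<^sub>1 * (norm (u - v))\<^sup>2"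
proof (cases "W\<^sub>2 < \<delta> * W\<^sub>1")
  case True
  then show thesis
    by (intro that[of "\<delta> * W\<^sub>1"]) auto
next
  case False
  have Min: "0 < Min (range \<sigma>)"
    using kernels by (subst Min_gr_iff) (auto simp: bregman_kernels_def)
  \<comment> \<open>A single index with \<open>\<sigma> i \<le> LH i\<close> would give
    \<open>Min (range \<sigma>) \<le> Max (range LH)\<close>, and then \<open>delta\<close> would
    imply \<open>W\<^sub>2 < \<delta> * W\<^sub>1\<close>.\<close>
  have "LH i < \<sigma> i" for i
  proof (rule ccontr)
    assume "\<not> LH i < \<sigma> i"
    then have "\<sigma> i \<le> LH i"
      by simp
    moreover have "Min (range \<sigma>) \<le> \<sigma> i" "LH i \<le> Max (range LH)"
      by (auto intro: Min_le Max_ge)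
    ultimately have "Min (range \<sigma>) \<le> Max (range LH)"
      by linarith
    then have "Min (range \<sigma>) * W\<^sub>2 \<le> Max (range LH) * W\<^sub>2"
      using W by (intro mult_right_mono) auto
    moreover have "Max (range LH) * W\<^sub>2 < \<delta> * (Min (range \<sigma>) * W\<^sub>1)"
      using delta Min W by (simp add: pos_divide_less_eq)
    ultimately have "Min (range \<sigma>) * W\<^sub>2 < Min (range \<sigma>) * (\<delta> * W\<^sub>1)"
      by (simp add: mult.left_commute)
    then show False
      using False Min by simp
  qed
  moreover have "\<sigma> i \<le> LH i" if "u \<in> V i" "v \<in> V i" "u \<noteq> v" for i u v
    using kernels V that strong_convexity_le_lipschitz[of "V i" "H i" "\<sigma> i" "LH i" u v]
    by (auto simp: bregman_kernels_def C1_on_def)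
  ultimately have eq: "u = v" if "u \<in> V i" "v \<in> V i" for i u v
    using that by (meson not_le)
  show thesis
  \<comment> \<open>Any constant above \<open>W\<^sub>2\<close> serves here, since all distances
    within a block vanish.\<close>
  proof (rule that[of "W\<^sub>2 + 1"])
    fix i u v assume "u \<in> V i" "v \<in> V i"
    then have "u = v" by (rule eq)
    then show "(W\<^sub>2 + 1) * (norm (u - v))\<^sup>2 \<le> \<delta> * W\<^sub>1 * (norm (u - v))\<^sup>2"
      by simp
  qed simp
qed

lemma descent_step_mono:
  assumes "descent_step V f r D W K y q i y'"
    and "A * (norm (y' - y))\<^sup>2 \<le> D * (norm (y' - y))\<^sup>2"
  shows "descent_step V f r A W K y q i y'"
proof -
  have "objective f r y' + ereal (A * (norm (y' - y))\<^sup>2) \<le> objective f r y' + ereal (D * (norm (y' - y))\<^sup>2)"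
    using assms(2) by (intro add_left_mono) simp
  then show ?thesis
    using assms(1) unfolding descent_step_def by (meson order_trans)
qed

theorem theorem4:
  fixes scheme :: block_scheme
    and V :: "'s::finite \<Rightarrow> 'b::euclidean_space set"
    and f :: "'b ^ 's \<Rightarrow> real"
    and r :: "'s \<Rightarrow> 'b \<Rightarrow> ereal"
    and H :: "'s \<Rightarrow> 'b \<Rightarrow> real"
    and \<sigma> LH :: "'s \<Rightarrow> real"
    and \<alpha> \<beta> \<gamma> L :: "nat \<Rightarrow> nat \<Rightarrow> real"
    and T :: "nat \<Rightarrow> nat"
    and blk :: "nat \<Rightarrow> nat \<Rightarrow> 's"
    and x :: "nat \<Rightarrow> nat \<Rightarrow> 'b ^ 's"
    and xt :: "nat \<Rightarrow> 'b ^ 's"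
    and \<nu> \<delta> \<kappa> W\<^sub>1 W\<^sub>2 :: real
  assumes problem: "composite_problem V f r"
    and kernels: "bregman_kernels V H \<sigma> LH"
    and run: "block_run scheme V f r H \<alpha> \<beta> \<gamma> T blk x xt"
    and cyclic: "essentially_cyclic T blk"
    and nu_delta: "0 < \<nu>" "\<nu> < 1" "1 < \<delta>"
    and params: "case scheme of
          IBP \<Rightarrow> IBP_parameters \<nu> \<delta> \<sigma> LH \<alpha> \<beta> T blk
        | IBPG \<Rightarrow> IBPG_parameters V f \<nu> \<delta> \<kappa> \<sigma> LH \<alpha> \<beta> \<gamma> L T blk x"
    and bounds: "case scheme of
          IBP \<Rightarrow> IBP_bounds W\<^sub>1 \<nu> \<sigma> LH \<alpha> \<beta> T blk
        | IBPG \<Rightarrow> IBPG_bounds W\<^sub>1 \<nu> \<kappa> \<sigma> LH \<alpha> \<gamma> L T blk"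
    and bounded: "bounded (range xt)"
    and KL: "KL_function (prod_space V) (objective f r)"
    and C1: "C1_on (prod_space V) f"
    and Lip: "\<And>B. B \<subseteq> prod_space V \<Longrightarrow> bounded B \<Longrightarrow>
          \<exists>M. M-lipschitz_on B (gradient_on (prod_space V) f)"
    and upper: "\<And>k i m. 1 \<le> k \<Longrightarrow> m \<in> {1..num_updates T blk i k} \<Longrightarrow>
          (case scheme of
             IBP \<Rightarrow> theta_weight \<nu> \<sigma> LH \<alpha> \<beta> T blk i k m
           | IBPG \<Rightarrow> lambda_weight \<nu> \<kappa> \<sigma> LH \<alpha> \<gamma> L T blk i k m) \<le> W\<^sub>2"
    and delta: "\<delta> > Max (range LH) * W\<^sub>2 / (Min (range \<sigma>) * W\<^sub>1)"
  shows "\<exists>xs. critical_point_II (prod_space V) (objective f r) xs \<and> xt \<longlonglongrightarrow> xs"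
proof -
  obtain Tbar where cyc: "\<And>k. 1 \<le> k \<Longrightarrow> blk k ` {1..T k} = UNIV" and Tbar: "\<And>k. 1 \<le> k \<Longrightarrow> T k \<le> Tbar"
    using cyclic unfolding essentially_cyclic_def by blast
  let ?q = "\<lambda>k j. prev_value T blk (xt 0) x (Suc k) j (blk (Suc k) (Suc j))"
  let ?u = "\<lambda>k j. x (Suc k) (Suc j) $ blk (Suc k) (Suc j)"
  have steps: "?u k j \<in> V (blk (Suc k) (Suc j)) \<and>
      x (Suc k) (Suc j) = block_update (x (Suc k) j) (blk (Suc k) (Suc j)) (?u k j) \<and>
      (\<forall>w\<in>V (blk (Suc k) (Suc j)).
        step_objective scheme V f r H (\<alpha> (Suc k) (Suc j)) (\<beta> (Suc k) (Suc j)) (\<gamma> (Suc k) (Suc j))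
          (x (Suc k) j) (?q k j) (blk (Suc k) (Suc j)) (?u k j)
        \<le> step_objective scheme V f r H (\<alpha> (Suc k) (Suc j)) (\<beta> (Suc k) (Suc j)) (\<gamma> (Suc k) (Suc j))
          (x (Suc k) j) (?q k j) (blk (Suc k) (Suc j)) w)"
    if j: "j < T (Suc k)" for k j
  proof -
    have "Suc j \<in> {1..T (Suc k)}" "1 \<le> Suc k"
      using j by auto
    then obtain u where u: "is_arg_min (step_objective scheme V f r H (\<alpha> (Suc k) (Suc j)) (\<beta> (Suc k) (Suc j))
          (\<gamma> (Suc k) (Suc j)) (x (Suc k) j) (?q k j) (blk (Suc k) (Suc j))) (\<lambda>u. u \<in> V (blk (Suc k) (Suc j))) u"
        "x (Suc k) (Suc j) = block_update (x (Suc k) j) (blk (Suc k) (Suc j)) u"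
      using run unfolding block_run_def Let_def by (metis diff_Suc_1)
    then have "?u k j = u"
      by (simp add: block_update_nth)
    with u show ?thesis
      by (auto simp: is_arg_min_linorder)
  qed
  interpret U: block_updates V f r T blk x xt Tbar
  proof
    show "xt 0 \<in> prod_space V"
      using run by (simp add: block_run_def)
    show "x (Suc k) 0 = xt k" "xt (Suc k) = x (Suc k) (T (Suc k))" for k
      using run by (auto simp: block_run_def dest!: spec[of _ "Suc k"])
  qed (use problem C1 cyc Tbar steps in auto)
  have block_stepI: "block_step V f r H \<sigma> LH (x (Suc k) j) (?q k j) (?u k j) (blk (Suc k) (Suc j))
      (\<alpha> (Suc k) (Suc j)) (\<beta> (Suc k) (Suc j)) amax bmax"
    if "j < T (Suc k)" "0 \<le> \<alpha> (Suc k) (Suc j)" "\<alpha> (Suc k) (Suc j) \<le> amax" "0 < \<beta> (Suc k) (Suc j)"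
      "1 / \<beta> (Suc k) (Suc j) \<le> bmax" for k j amax bmax
    using that problem C1 kernels steps U.x_in_P U.prev_value_in_V by unfold_locales auto
  define lh where "lh = Max (range LH)"
  have lh: "LH i \<le> lh" for i
    unfolding lh_def by (rule Max_ge) auto
  have "0 \<le> LH i" for i
    using kernels lipschitz_on_nonneg by (auto simp: bregman_kernels_def)
  then have lh0: "0 \<le> lh"
    using lh order_trans by blast
  \<comment> \<open>An inner step exists, and at it the chain
    \<open>W\<^sub>1 \<le> weight \<le> W\<^sub>2\<close> can be read off; this makes
    \<open>W\<^sub>2\<close> positive.\<close>
  have first: "0 < T (Suc 0)"
    using cyc[of "Suc 0"] by (cases "T (Suc 0)") auto
  \<comment> \<open>From here on the schemes matter only through \<open>descent_step\<close>. The
    constant \<open>\<delta> * W\<^sub>1\<close> is exchanged for one above \<open>W\<^sub>2\<close>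
    afterwards, which also covers zero spaces.\<close>
  have "\<exists>K\<ge>0. 0 < W\<^sub>1 \<and> W\<^sub>1 \<le> W\<^sub>2 \<and> (\<forall>k j. j < T (Suc k) \<longrightarrow>
      descent_step V f r (\<delta> * W\<^sub>1) W\<^sub>2 K (x (Suc k) j) (?q k j) (blk (Suc k) (Suc j)) (x (Suc k) (Suc j)))"
  proof (cases scheme)
    case IBP
    have \<delta>: "0 \<le> \<delta>" and params': "IBP_parameters \<nu> \<delta> \<sigma> LH \<alpha> \<beta> T blk"
      and bounds': "IBP_bounds W\<^sub>1 \<nu> \<sigma> LH \<alpha> \<beta> T blk"
      using params bounds nu_delta by (simp_all add: IBP)
    have upper': "theta_weight \<nu> \<sigma> LH \<alpha> \<beta> T blk i k m \<le> W\<^sub>2"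
      if "1 \<le> k" "m \<in> {1..num_updates T blk i k}" for i k m
      using upper[OF that] by (simp add: IBP)
    obtain amax bmin where max: "0 < amax" "0 < bmin" and
      at: "\<And>k j i. 1 \<le> k \<Longrightarrow> j \<in> {1..T k} \<Longrightarrow> i = blk k j \<Longrightarrow>
        0 \<le> \<alpha> k j \<and> \<alpha> k j \<le> amax \<and> 0 < \<beta> k j \<and> bmin \<le> \<beta> k j \<and>
        W\<^sub>1 \<le> (LH i * \<alpha> k j)\<^sup>2 / (2 * \<nu> * \<sigma> i * \<beta> k j) \<and>
        (LH i * \<alpha> k j)\<^sup>2 / (2 * \<nu> * \<sigma> i * \<beta> k j) \<le> W\<^sub>2 \<and>
        \<delta> * W\<^sub>1 \<le> (1 - \<nu>) * \<sigma> i / (2 * \<beta> k j)"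
      using IBP_parameters_at[OF cyc \<delta> params' bounds' upper'] by blast
    define K where "K = 1 / bmin * lh * (1 + amax)\<^sup>2"
    have "descent_step V f r (\<delta> * W\<^sub>1) W\<^sub>2 K (x (Suc k) j) (?q k j) (blk (Suc k) (Suc j)) (x (Suc k) (Suc j))"
      if j: "j < T (Suc k)" for k j
    proof -
      let ?i = "blk (Suc k) (Suc j)"
      have at': "0 \<le> \<alpha> (Suc k) (Suc j) \<and> \<alpha> (Suc k) (Suc j) \<le> amax \<and>
          0 < \<beta> (Suc k) (Suc j) \<and> bmin \<le> \<beta> (Suc k) (Suc j) \<and>
          (LH ?i * \<alpha> (Suc k) (Suc j))\<^sup>2 / (2 * \<nu> * \<sigma> ?i * \<beta> (Suc k) (Suc j)) \<le> W\<^sub>2 \<and>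
          \<delta> * W\<^sub>1 \<le> (1 - \<nu>) * \<sigma> ?i / (2 * \<beta> (Suc k) (Suc j))"
        using at[of "Suc k" "Suc j" ?i] j by simp
      then have "1 / \<beta> (Suc k) (Suc j) \<le> 1 / bmin"
        using max by (intro divide_left_mono) auto
      then interpret S: block_step V f r H \<sigma> LH "x (Suc k) j" "?q k j" "?u k j" ?i
        "\<alpha> (Suc k) (Suc j)" "\<beta> (Suc k) (Suc j)" amax "1 / bmin"
        using at' j by (intro block_stepI) auto
      have "1 / bmin * LH ?i * (1 + amax)\<^sup>2 \<le> K"
        unfolding K_def using max lh by (intro mult_right_mono mult_left_mono) auto
      then have "descent_step V f r (\<delta> * W\<^sub>1) W\<^sub>2 K (x (Suc k) j) (?q k j) ?i (block_update (x (Suc k) j) ?i (?u k j))"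
        using steps[OF j] at' nu_delta by (intro S.IBP_descent_step) (auto simp: IBP)
      then show ?thesis
        using steps[OF j] by simp
    qed
    moreover have "W\<^sub>1 \<le> W\<^sub>2"
      using at[of "Suc 0" "Suc 0" "blk (Suc 0) (Suc 0)"] first by auto
    moreover have "0 \<le> K"
      using max lh0 by (simp add: K_def)
    moreover have "0 < W\<^sub>1"
      using bounds' by (simp add: IBP_bounds_def)
    ultimately show ?thesis
      by blast
  next
    case IBPG
    have \<delta>: "0 \<le> \<delta>" and params': "IBPG_parameters V f \<nu> \<delta> \<kappa> \<sigma> LH \<alpha> \<beta> \<gamma> L T blk x"
      and bounds': "IBPG_bounds W\<^sub>1 \<nu> \<kappa> \<sigma> LH \<alpha> \<gamma> L T blk"
      using params bounds nu_delta by (simp_all add: IBPG)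
    have upper': "lambda_weight \<nu> \<kappa> \<sigma> LH \<alpha> \<gamma> L T blk i k m \<le> W\<^sub>2"
      if "1 \<le> k" "m \<in> {1..num_updates T blk i k}" for i k m
      using upper[OF that] by (simp add: IBPG)
    have \<kappa>: "1 < \<kappa>"
      using params' by (simp add: IBPG_parameters_def)
    obtain Lmax amax cmax where max: "0 < Lmax" "0 < amax" "0 < cmax" and
      at: "\<And>k j i. 1 \<le> k \<Longrightarrow> j \<in> {1..T k} \<Longrightarrow> i = blk k j \<Longrightarrow>
        0 \<le> \<alpha> k j \<and> \<alpha> k j \<le> amax \<and> 0 \<le> \<gamma> k j \<and> \<gamma> k j \<le> cmax \<and> 0 < L k j \<and> L k j \<le> Lmax \<and>
        (L k j)-lipschitz_on (V i) (gradient_on (V i) (block_fun f (x k (j - 1)) i)) \<and>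
        0 < \<beta> k j \<and> \<beta> k j = \<sigma> i / (\<kappa> * L k j) \<and>
        W\<^sub>1 \<le> 1 / 2 * (\<gamma> k j + \<kappa> * LH i * \<alpha> k j / \<sigma> i)\<^sup>2 * (L k j / (\<nu> * (\<kappa> - 1))) \<and>
        1 / 2 * (\<gamma> k j + \<kappa> * LH i * \<alpha> k j / \<sigma> i)\<^sup>2 * (L k j / (\<nu> * (\<kappa> - 1))) \<le> W\<^sub>2 \<and>
        \<delta> * W\<^sub>1 \<le> (1 - \<nu>) * (\<kappa> - 1) * L k j / 2"
      using IBPG_parameters_at[OF cyc \<delta> params' bounds' upper'] by blast
    \<comment> \<open>For IBPG the lower bound on \<open>\<beta>\<close> is a consequence of
      \<open>1 / \<beta> = \<kappa> * L / \<sigma> i\<close> and the upper bound on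
      \<open>L\<close>.\<close>
    define bmax where "bmax = \<kappa> * Lmax / Min (range \<sigma>)"
    have Min: "0 < Min (range \<sigma>)"
      using kernels by (subst Min_gr_iff) (auto simp: bregman_kernels_def)
    have bmax0: "0 \<le> bmax"
      unfolding bmax_def using Min \<kappa> max by (intro divide_nonneg_pos mult_nonneg_nonneg) auto
    define K where "K = bmax * lh * (1 + amax)\<^sup>2 + Lmax * (1 + cmax)"
    have "descent_step V f r (\<delta> * W\<^sub>1) W\<^sub>2 K (x (Suc k) j) (?q k j) (blk (Suc k) (Suc j)) (x (Suc k) (Suc j))"
      if j: "j < T (Suc k)" for k j
    proof -
      let ?i = "blk (Suc k) (Suc j)" and ?L = "L (Suc k) (Suc j)"
      note at' = at[of "Suc k" "Suc j" ?i]
      have a: "0 \<le> \<alpha> (Suc k) (Suc j)" "\<alpha> (Suc k) (Suc j) \<le> amax"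
        and c: "0 \<le> \<gamma> (Suc k) (Suc j)" "\<gamma> (Suc k) (Suc j) \<le> cmax"
        and L: "0 < ?L" "?L \<le> Lmax"
          "?L-lipschitz_on (V ?i) (gradient_on (V ?i) (block_fun f (x (Suc k) j) ?i))"
        and \<beta>: "0 < \<beta> (Suc k) (Suc j)" "\<beta> (Suc k) (Suc j) = \<sigma> ?i / (\<kappa> * ?L)"
        and W: "1 / 2 * (\<gamma> (Suc k) (Suc j) + \<kappa> * LH ?i * \<alpha> (Suc k) (Suc j) / \<sigma> ?i)\<^sup>2
            * (?L / (\<nu> * (\<kappa> - 1))) \<le> W\<^sub>2"
          "\<delta> * W\<^sub>1 \<le> (1 - \<nu>) * (\<kappa> - 1) * ?L / 2"
        using at' j by auto
      have "Min (range \<sigma>) \<le> \<sigma> ?i"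
        by (rule Min_le) auto
      then have "\<kappa> * ?L / \<sigma> ?i \<le> \<kappa> * Lmax / Min (range \<sigma>)"
        using \<kappa> L Min by (intro frac_le mult_left_mono) auto
      then have "1 / \<beta> (Suc k) (Suc j) \<le> bmax"
        by (simp add: \<beta>(2) bmax_def)
      then interpret S: block_step V f r H \<sigma> LH "x (Suc k) j" "?q k j" "?u k j" ?i
        "\<alpha> (Suc k) (Suc j)" "\<beta> (Suc k) (Suc j)" amax bmax
        using a \<beta>(1) j by (intro block_stepI) auto
      have "bmax * LH ?i * (1 + amax)\<^sup>2 \<le> bmax * lh * (1 + amax)\<^sup>2"
        using bmax0 lh by (intro mult_right_mono mult_left_mono) auto
      then have K: "bmax * LH ?i * (1 + amax)\<^sup>2 + Lmax * (1 + cmax) \<le> K"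
        by (simp add: K_def)
      have "descent_step V f r (\<delta> * W\<^sub>1) W\<^sub>2 K (x (Suc k) j) (?q k j) ?i (block_update (x (Suc k) j) ?i (?u k j))"
        using steps[OF j] by (intro S.IBPG_descent_step[OF _ nu_delta(1) \<kappa> c L \<beta>(2) W K]) (auto simp: IBPG)
      then show ?thesis
        using steps[OF j] by simp
    qed
    moreover have "W\<^sub>1 \<le> W\<^sub>2"
      using at[of "Suc 0" "Suc 0" "blk (Suc 0) (Suc 0)"] first by auto
    moreover have "0 \<le> K"
      using max lh0 bmax0 by (simp add: K_def)
    moreover have "0 < W\<^sub>1"
      using bounds' by (simp add: IBPG_bounds_def)
    ultimately show ?thesis
      by blast
  qed
  then obtain K where K: "0 \<le> K" and W: "0 < W\<^sub>1" "W\<^sub>1 \<le> W\<^sub>2" and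
    step: "\<And>k j. j < T (Suc k) \<Longrightarrow>
      descent_step V f r (\<delta> * W\<^sub>1) W\<^sub>2 K (x (Suc k) j) (?q k j) (blk (Suc k) (Suc j)) (x (Suc k) (Suc j))"
    by blast
  have W2: "0 < W\<^sub>2"
    using W by simp
  obtain A where A: "W\<^sub>2 < A" and A_le: "\<And>i u v. u \<in> V i \<Longrightarrow> v \<in> V i \<Longrightarrow>
      A * (norm (u - v))\<^sup>2 \<le> \<delta> * W\<^sub>1 * (norm (u - v))\<^sup>2"
    using descent_constant[OF kernels U.subspace_V W(1) W2 delta] by blast
  interpret D: block_descent V f r T blk x xt Tbar A W\<^sub>2 K
  proof
    fix k j i assume j: "j < T (Suc k)" and i: "i = blk (Suc k) (Suc j)"
    \<comment> \<open>The length of a step equals the distance of two points of a single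
      \<open>V i\<close>, which is the form in which \<open>A_le\<close> is available.\<close>
    have "norm (x (Suc k) (Suc j) - x (Suc k) j) = norm (?u k j - x (Suc k) j $ blk (Suc k) (Suc j))"
      using norm_block_update_diff[of "x (Suc k) j" "blk (Suc k) (Suc j)" "?u k j" "x (Suc k) j $ blk (Suc k) (Suc j)"]
        steps[OF j] by simp
    moreover have "x (Suc k) j $ blk (Suc k) (Suc j) \<in> V (blk (Suc k) (Suc j))"
      using U.x_in_P[of j k] j by (simp add: prod_space_def)
    ultimately have "A * (norm (x (Suc k) (Suc j) - x (Suc k) j))\<^sup>2 \<le> \<delta> * W\<^sub>1 * (norm (x (Suc k) (Suc j) - x (Suc k) j))\<^sup>2"
      using A_le[OF conjunct1[OF steps[OF j]]] by simp
    from descent_step_mono[OF step[OF j] this]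
    show "descent_step V f r A W\<^sub>2 K (x (Suc k) j) (prev_value T blk (xt 0) x (Suc k) j i) i (x (Suc k) (Suc j))"
      by (simp add: i)
  qed (use A W2 K in auto)
  show ?thesis
    by (rule D.convergence[OF bounded KL Lip])
qed

end
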